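(* Let $\alpha>0$, let $\mathcal{H}_\alpha$ be the $\alpha$-hyperbolic ensemble on the unit disc $\mathbb{D}$, and let $\mathcal{P}_{\alpha/4}$ be the Poisson point process on $\mathbb{R}$ with constant intensity $\alpha/4$ (with respect to Lebesgue measure). Then $$\big\{e^{R}(|z|_{\mathrm{h}}-R):z\in\mathcal{H}_{\alpha}\big\}\ \xrightarrow[R\to+\infty]{\mathrm{law}}\ \mathcal{P}_{\alpha/4}.$$
   Context: Point processes: for a locally compact Polish space $X$, $\mathrm{Conf}(X)$ is the space of locally finite configurations $\xi=\sum_i\delta_{x_i}$ on $X$ (finite mass on pre-compact Borel sets), with the vague topology (the weakest topology making $\xi\mapsto\int f\,\mathrm{d}\xi$ continuous for every compactly supported continuous $f$). A point process on $X$ is a $\mathrm{Conf}(X)$-valued random variable, and convergence in law of point processes is convergence in law of $\mathrm{Conf}(X)$-valued random variables. The notation $\{T(z):z\in\mathscr{X}\}$ denotes the push-forward configuration $\sum_{z\in\mathscr{X}}\delta_{T(z)}$. Determinantal point processes: given a Radon measure $\mu$ on $X$ and measurable $K:X\times X\to\mathbb{C}$, a simple point process $\mathscr{X}$ (no multiple points; $\mathscr{X}(\Delta)$ is the number of points in $\Delta$) is determinantal with kernel $K$ with respect to the reference measure $\mu$ if for every $k\ge 1$ and all mutually disjoint pre-compact Borel sets $\Delta_1,\dots,\Delta_k\subset X$, $$\mathbb{E}\Big[\prod_{i=1}^k\mathscr{X}(\Delta_i)\Big]=\int_{\Delta_1\times\cdots\times\Delta_k}\det[K(x_i,x_j)]_{1\le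 i,j\le k}\,\mathrm{d}\mu(x_1)\cdots\mathrm{d}\mu(x_k).$$ Hyperbolic ensemble: for $\alpha>0$ let $\mu_\alpha$ be the probability measure $\mathrm{d}\mu_\alpha(z)=\frac{\alpha}{\pi}(1-|z|^2)^{\alpha-1}\mathrm{d}m(z)$ on the open unit disc $\mathbb{D}\subset\mathbb{C}$, where $m$ is Lebesgue measure. The $\alpha$-hyperbolic ensemble $\mathcal{H}_\alpha$ is the determinantal point process on $\mathbb{D}$ with reference measure $\mu_\alpha$ and kernel equal to the kernel of the orthogonal projection of $L^2(\mathbb{D},\mu_\alpha)$ onto its subspace of holomorphic functions, i.e. $K(z,w)=(1-z\overline{w})^{-(\alpha+1)}$. Hyperbolic modulus: for $z\in\mathbb{D}$, $|z|_{\mathrm{h}}=\log\frac{1+|z|}{1-|z|}$. *)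

theory Defs
  imports "HOL-Probability.Probability" "Jordan_Normal_Form.Determinant"
begin

text \<open>
  A locally compact space is given by a carrier set \<open>X\<close> inside an ambient Hausdorff type; its
  Borel sets are those of \<open>restrict_space borel X\<close>.
\<close>

definition precompact_Borel :: "'a::t2_space set \<Rightarrow> 'a set set" where
  "precompact_Borel X =
     {B \<in> sets (restrict_space borel X). \<exists>C. compact C \<and> B \<subseteq> C \<and> C \<subseteq> X}"

text \<open>
  On a locally compact Polish space every locally finite Borel measure is inner and outer regular,
  so local finiteness is all that being a Radon measure requires.
\<close>

definition Radon_measure_on :: "'a::t2_space set \<Rightarrow> 'a measure \<Rightarrow> bool" where
  "Radon_measure_on X \<mu> \<longleftrightarrow>
     sets \<mu> = sets (restrict_space borel X) \<and> (\<forall>B\<in>precompact_Borel X. emeasure \<mu> B < \<infinity>)"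

text \<open>
  A configuration \<open>\<Sum>\<^sub>i \<delta>\<^bsub>x i\<^esub>\<close> is the measure on \<open>X\<close> obtained by pushing forward counting measure
  on the index set along \<open>x\<close>. Countable index sets suffice, since a locally finite configuration on
  a \<open>\<sigma>\<close>-compact space has at most countably many points.
\<close>

definition Conf :: "'a::t2_space set \<Rightarrow> 'a measure set" where
  "Conf X = {\<xi>. (\<exists>(I::nat set) x. x \<in> I \<rightarrow> X \<and>
                   \<xi> = distr (count_space I) (restrict_space borel X) x) \<and>
                (\<forall>B\<in>precompact_Borel X. emeasure \<xi> B < \<infinity>)}"

definition Cc :: "'a::t2_space set \<Rightarrow> ('a \<Rightarrow> real) set" where
  "Cc X = {f. continuous_on X f \<and> (\<exists>C. compact C \<and> C \<subseteq> X \<and> (\<forall>x\<in>X - C. f x = 0))}"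

definition vague_topology :: "'a::t2_space set \<Rightarrow> 'a measure topology" where
  "vague_topology X = topology_generated_by
     {{\<xi> \<in> Conf X. (\<integral>x. f x \<partial>\<xi>) \<in> U} | f U. f \<in> Cc X \<and> open U}"

definition borel_of_topology :: "'b topology \<Rightarrow> 'b measure" where
  "borel_of_topology T = sigma (topspace T) {U. openin T U}"

definition point_process :: "'p measure \<Rightarrow> 'a::t2_space set \<Rightarrow> ('p \<Rightarrow> 'a measure) \<Rightarrow> bool" where
  "point_process M X \<Xi> \<longleftrightarrow>
     prob_space M \<and> \<Xi> \<in> measurable M (borel_of_topology (vague_topology X))"

text \<open>
  Convergence in law along a filter of random variables with values in a topological space, all the
  approximating variables being defined on the same probability space.
\<close>

definition converges_in_law ::
    "'b topology \<Rightarrow> 'p measure \<Rightarrow> ('i \<Rightarrow> 'p \<Rightarrow> 'b) \<Rightarrow> 'i filter \<Rightarrow> 'q measure \<Rightarrow> ('q \<Rightarrow> 'b) \<Rightarrow> bool" where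
  "converges_in_law T M Y F N Z \<longleftrightarrow>
     prob_space M \<and> prob_space N \<and>
     (\<forall>i. Y i \<in> measurable M (borel_of_topology T)) \<and>
     Z \<in> measurable N (borel_of_topology T) \<and>
     (\<forall>\<phi>::'b \<Rightarrow> real. continuous_map T euclideanreal \<phi> \<and> bounded (\<phi> ` topspace T) \<longrightarrow>
        ((\<lambda>i. \<integral>\<omega>. \<phi> (Y i \<omega>) \<partial>M) \<longlongrightarrow> (\<integral>\<omega>. \<phi> (Z \<omega>) \<partial>N)) F)"

definition push_configuration ::
    "('a::t2_space \<Rightarrow> 'b::t2_space) \<Rightarrow> 'b set \<Rightarrow> 'a measure \<Rightarrow> 'b measure" where
  "push_configuration T Y \<xi> = distr \<xi> (restrict_space borel Y) T"

definition simple_point_process :: "'p measure \<Rightarrow> 'a::t2_space set \<Rightarrow> ('p \<Rightarrow> 'a measure) \<Rightarrow> bool" where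
  "simple_point_process M X \<Xi> \<longleftrightarrow>
     point_process M X \<Xi> \<and> (AE \<omega> in M. \<forall>x\<in>X. emeasure (\<Xi> \<omega>) {x} \<le> 1)"

text \<open>
  The integrability clauses express that both sides of the defining identity are genuine finite
  integrals, since non-convergent Bochner integrals would be set to zero.
\<close>

definition determinantal_process ::
    "'p measure \<Rightarrow> 'a::t2_space set \<Rightarrow> 'a measure \<Rightarrow> ('a \<Rightarrow> 'a \<Rightarrow> complex) \<Rightarrow> ('p \<Rightarrow> 'a measure) \<Rightarrow> bool"
  where
  "determinantal_process M X \<mu> K \<Xi> \<longleftrightarrow>
     Radon_measure_on X \<mu> \<and> (\<lambda>(x, y). K x y) \<in> borel_measurable (\<mu> \<Otimes>\<^sub>M \<mu>) \<and>
     simple_point_process M X \<Xi> \<and>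
     (\<forall>k\<ge>1. \<forall>\<Delta>::nat \<Rightarrow> 'a set.
        (\<forall>i<k. \<Delta> i \<in> precompact_Borel X) \<and> disjoint_family_on \<Delta> {..<k} \<longrightarrow>
        integrable M (\<lambda>\<omega>. \<Prod>i<k. measure (\<Xi> \<omega>) (\<Delta> i)) \<and>
        set_integrable (Pi\<^sub>M {..<k} (\<lambda>_. \<mu>)) (Pi\<^sub>E {..<k} \<Delta>)
          (\<lambda>x. Determinant.det (mat k k (\<lambda>(i, j). K (x i) (x j)))) \<and>
        complex_of_real (\<integral>\<omega>. (\<Prod>i<k. measure (\<Xi> \<omega>) (\<Delta> i)) \<partial>M) =
          set_lebesgue_integral (Pi\<^sub>M {..<k} (\<lambda>_. \<mu>)) (Pi\<^sub>E {..<k} \<Delta>)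
            (\<lambda>x. Determinant.det (mat k k (\<lambda>(i, j). K (x i) (x j)))))"

definition poisson_process ::
    "'p measure \<Rightarrow> 'a::t2_space set \<Rightarrow> 'a measure \<Rightarrow> ('p \<Rightarrow> 'a measure) \<Rightarrow> bool" where
  "poisson_process M X \<nu> \<Xi> \<longleftrightarrow>
     Radon_measure_on X \<nu> \<and> point_process M X \<Xi> \<and>
     (\<forall>B\<in>precompact_Borel X. \<forall>n::nat.
        measure M {\<omega> \<in> space M. measure (\<Xi> \<omega>) B = real n} =
          exp (- measure \<nu> B) * measure \<nu> B ^ n / fact n) \<and>
     (\<forall>k. \<forall>\<Delta>::nat \<Rightarrow> 'a set.
        (\<forall>i<k. \<Delta> i \<in> precompact_Borel X) \<and> disjoint_family_on \<Delta> {..<k} \<longrightarrow>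
        prob_space.indep_vars M (\<lambda>_. borel) (\<lambda>i \<omega>. measure (\<Xi> \<omega>) (\<Delta> i)) {..<k})"

abbreviation unit_disc :: "complex set" where
  "unit_disc \<equiv> ball 0 1"

definition mu_hyp :: "real \<Rightarrow> complex measure" where
  "mu_hyp \<alpha> = density (restrict_space lborel unit_disc)
     (\<lambda>z. ennreal (\<alpha> / pi * (1 - (cmod z)\<^sup>2) powr (\<alpha> - 1)))"

text \<open>
  For \<open>z, w\<close> in the disc, \<open>1 - z * cnj w\<close> has positive real part, so the principal branch used by
  \<open>powr\<close> is the one that makes this the weighted Bergman kernel, i.e. the kernel of the orthogonal
  projection of \<open>L\<^sup>2(mu_hyp \<alpha>)\<close> onto its subspace of holomorphic functions.
\<close>

definition K_hyp :: "real \<Rightarrow> complex \<Rightarrow> complex \<Rightarrow> complex" where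
  "K_hyp \<alpha> z w = (1 - z * cnj w) powr (- complex_of_real (\<alpha> + 1))"

definition hyperbolic_ensemble :: "'p measure \<Rightarrow> real \<Rightarrow> ('p \<Rightarrow> complex measure) \<Rightarrow> bool" where
  "hyperbolic_ensemble M \<alpha> H \<longleftrightarrow> determinantal_process M unit_disc (mu_hyp \<alpha>) (K_hyp \<alpha>) H"

definition hyp_modulus :: "complex \<Rightarrow> real" where
  "hyp_modulus z = ln ((1 + cmod z) / (1 - cmod z))"

end

theory Submission
  imports Defs
begin

text \<open>
  By Renyi's idea, a simple limit process is determined by its avoidance probabilities, so no joint
  laws of counts are needed. For a set \<open>U\<close> of the line, let \<open>A\<close> be the corresponding thin shell in the
  disc. The factorial moments of the number of points in \<open>A\<close> are integrals of determinants; in the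
  Leibniz expansion the identity contributes the power of the mass \<open>\<integral>\<^sub>A K(z, z) d\<mu>\<close>, and every other
  permutation is controlled by \<open>\<integral>\<^sub>A \<kappa>(z, w) K(z, z) d\<mu>(z)\<close> with
  \<open>\<kappa> = |K(z, w)| / sqrt (K(z, z) K(w, w)) \<le> 1\<close>, which tends to \<open>0\<close> because \<open>\<kappa>\<close> is small away from the
  diagonal while a disc of small radius meets the shell in a small proportion of its mass. Hence the
  factorial moments converge to those of a Poisson variable, and Bonferroni's inequalities give the
  avoidance probabilities. A bounded vaguely continuous functional is approximated from below by
  functions of the set of occupied dyadic intervals, up to the event that some interval contains two
  points; this yields a lower bound for the lower limit of the expectations, and applying it to the
  functional and its negative gives convergence in law without any compactness argument.
\<close>

section \<open>Counting injections\<close>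

text \<open>The determinantal identity only speaks of products of counts of disjoint sets, whereas
  Bonferroni requires binomial moments of a single count. The shell is therefore cut into ever finer
  cells: products over distinct cells count the ordered tuples of points lying in different cells,
  and simplicity of the process makes this exact in the limit.

  The scales explain the constant. At hyperbolic radius about \<open>R\<close>, 1 - |z|^2 is of
  order 4 exp(-R), and the rescaled interval [a, b) becomes a ring with s^2 - r^2 of order 4 (b - a)
  exp(-2 R). Against the density \<alpha> / pi / (1 - |z|^2)^2 of \<open>K(z, z) d\<mu>\<close> the
  ring has mass close to \<alpha> 4 (b - a) / 16. The kernel correlates points at distance of order
  exp(-R), far more than the thickness of the ring but negligible along its circumference; so the
  area estimate for a small square must gain a factor from the length along the ring and another
  from its thickness.

  On the line the obstacle is that dyadic counts are not vaguely continuous; infima of the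
  functional over all configurations with a prescribed occupancy pattern take the place of
  continuous approximations.\<close>

lemma sum_injections_prod_card:
  fixes J :: "'i set" and Q :: "'b set" and c :: "'i \<Rightarrow> 'b" and k :: nat
  assumes J: "finite J" and Q: "finite Q" and c: "c \<in> J \<rightarrow> Q"
  shows "(\<Sum>f\<in>{f\<in>{..<k} \<rightarrow>\<^sub>E Q. inj_on f {..<k}}. \<Prod>i<k. card {j\<in>J. c j = f i})
       = card {g\<in>{..<k} \<rightarrow>\<^sub>E J. inj_on (c \<circ> g) {..<k}}"
proof -
  let ?F = "{f\<in>{..<k} \<rightarrow>\<^sub>E Q. inj_on f {..<k}}"
  let ?P = "\<lambda>f. Pi\<^sub>E {..<k} (\<lambda>i. {j\<in>J. c j = f i})"
  have finF: "finite ?F" using Q by (intro finite_Collect_conjI disjI1) (auto intro: finite_PiE)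
  \<comment> \<open>A tuple \<open>g\<close> with distinct colours lies over exactly one colour
    sequence \<open>f = c \<circ> g\<close>, and the fibre over \<open>f\<close> is a product of
    colour classes. Later \<open>J\<close> indexes the points of a configuration and
    \<open>Q\<close> the cells.\<close>
  have "(\<Union>f\<in>?F. ?P f) = {g\<in>{..<k} \<rightarrow>\<^sub>E J. inj_on (c \<circ> g) {..<k}}" (is "?L = ?R")
  proof
    show "?L \<subseteq> ?R"
    proof
      fix g assume "g \<in> ?L"
      then obtain f where f: "f \<in> ?F" "g \<in> ?P f" by blast
      have "c (g i) = f i" "g i \<in> J" if "i < k" for i using f(2) that by (auto simp: PiE_iff)
      moreover have "g \<in> extensional {..<k}" using f(2) by (auto simp: PiE_iff)
      ultimately show "g \<in> ?R" using f(1) by (auto simp: PiE_iff inj_on_def)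
    qed
    show "?R \<subseteq> ?L"
    proof
      fix g assume g: "g \<in> ?R"
      let ?f = "restrict (c \<circ> g) {..<k}"
      have "?f \<in> ?F" using g c by (auto simp: PiE_iff inj_on_def)
      moreover have "g \<in> ?P ?f" using g by (auto simp: PiE_iff)
      ultimately show "g \<in> ?L" by blast
    qed
  qed
  moreover have "card (\<Union>f\<in>?F. ?P f) = (\<Sum>f\<in>?F. card (?P f))"
  proof (rule card_UN_disjoint[OF finF])
    show "\<forall>f\<in>?F. finite (?P f)" using J by (intro ballI finite_PiE) auto
    show "\<forall>f\<in>?F. \<forall>f'\<in>?F. f \<noteq> f' \<longrightarrow> ?P f \<inter> ?P f' = {}"
    proof (intro ballI impI)
      fix f f' assume f: "f \<in> ?F" "f' \<in> ?F" "f \<noteq> f'"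
      then obtain i where "i < k" "f i \<noteq> f' i"
        using PiE_ext[of f "{..<k}" "\<lambda>_. Q" f'] by auto
      then have "g \<notin> ?P f'" if "g \<in> ?P f" for g
        using PiE_mem[OF that, of i] PiE_mem[of g "{..<k}" "\<lambda>i. {j\<in>J. c j = f' i}" i] by auto
      then show "?P f \<inter> ?P f' = {}" by blast
    qed
  qed
  moreover have "card (?P f) = (\<Prod>i<k. card {j\<in>J. c j = f i})" for f
    by (simp add: card_PiE)
  ultimately show ?thesis by simp
qed

lemma card_injections:
  assumes "finite J"
  shows "real (card {g\<in>{..<k} \<rightarrow>\<^sub>E J. inj_on g {..<k}}) = fact k * real (card J choose k)"
proof -
  have "real (prod ((-) n) {0..<k}) = (\<Prod>i=0..<k. real n - real i)" for n
  proof (cases "k \<le> n")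
    case False
    \<comment> \<open>For \<open>k > n\<close> the truncated and the real falling factorial agree
      because both contain the factor 0 at \<open>i = n\<close>.\<close>
    then have "n \<in> {0..<k}" by auto
    then have "(\<Prod>i=0..<k. real n - real i) = 0" "prod ((-) n) {0..<k} = 0"
      by (auto intro!: prod_zero bexI[of _ n])
    then show ?thesis by (simp only: of_nat_0)
  qed (auto intro!: prod.cong simp: of_nat_diff)
  also have "\<dots> n = fact k * real (n choose k)" for n
    by (simp add: gbinomial_mult_fact binomial_gbinomial)
  finally show ?thesis
    using card_inj_on_subset_funcset[of "{..<k}" J "{..<k}"] assms by simp
qed

text \<open>Tuples with distinct colours have distinct entries, so counting through cells never
  exceeds the falling factorial. This is the domination used when the partition is refined.\<close>

lemma sum_injections_prod_card_le:
  assumes "finite J" "finite Q" "c \<in> J \<rightarrow> Q"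
  shows "(\<Sum>f\<in>{f\<in>{..<k} \<rightarrow>\<^sub>E Q. inj_on f {..<k}}. \<Prod>i<k. real (card {j\<in>J. c j = f i}))
       \<le> fact k * real (card J choose k)"
proof -
  have "card {g\<in>{..<k} \<rightarrow>\<^sub>E J. inj_on (c \<circ> g) {..<k}} \<le> card {g\<in>{..<k} \<rightarrow>\<^sub>E J. inj_on g {..<k}}"
    using assms(1) by (intro card_mono finite_Collect_conjI) (auto intro: finite_PiE simp: inj_on_def)
  then show ?thesis
    using card_injections[OF assms(1), of k] sum_injections_prod_card[OF assms, of k]
    by (metis (no_types, lifting) of_nat_mono of_nat_prod of_nat_sum prod.cong sum.cong)
qed

text \<open>Once the cells separate the points, distinct entries also have distinct colours, and the
  undercount of the previous lemma becomes exact.\<close>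

lemma sum_injections_prod_card_eq:
  assumes "finite J" "finite Q" "c \<in> J \<rightarrow> Q" "inj_on c J"
  shows "(\<Sum>f\<in>{f\<in>{..<k} \<rightarrow>\<^sub>E Q. inj_on f {..<k}}. \<Prod>i<k. real (card {j\<in>J. c j = f i}))
       = fact k * real (card J choose k)"
proof -
  have "{g\<in>{..<k} \<rightarrow>\<^sub>E J. inj_on (c \<circ> g) {..<k}} = {g\<in>{..<k} \<rightarrow>\<^sub>E J. inj_on g {..<k}}"
    using assms(4) by (auto simp: inj_on_def PiE_iff)
  then show ?thesis
    using card_injections[OF assms(1), of k] sum_injections_prod_card[OF assms(1-3), of k]
    by (metis (no_types, lifting) of_nat_prod of_nat_sum prod.cong sum.cong)
qed

lemma sum_UN_le:
  fixes f :: "'b \<Rightarrow> real"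
  assumes "finite I" "\<And>i. i \<in> I \<Longrightarrow> finite (A i)" "\<And>i x. i \<in> I \<Longrightarrow> x \<in> A i \<Longrightarrow> 0 \<le> f x"
  shows "sum f (\<Union>i\<in>I. A i) \<le> (\<Sum>i\<in>I. sum f (A i))"
  using assms
proof (induction I)
  case (insert i I)
  have "sum f (A i \<union> (\<Union>i\<in>I. A i)) = sum f (A i) + sum f (\<Union>i\<in>I. A i) - sum f (A i \<inter> (\<Union>i\<in>I. A i))"
    using insert by (intro sum_Un) auto
  moreover have "0 \<le> sum f (A i \<inter> (\<Union>i\<in>I. A i))" using insert by (intro sum_nonneg) auto
  moreover have "sum f (\<Union>i\<in>I. A i) \<le> (\<Sum>i\<in>I. sum f (A i))"
    using insert by (intro insert.IH) auto
  ultimately show ?case using insert by simp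
qed simp

text \<open>The power expands into a sum over all maps. A non-injective map has some collision
  \<open>f a = f b\<close>; for a fixed pair the factor at \<open>b\<close> is at most
  \<open>\<delta>\<close> and the other \<open>k - 1\<close> factors sum to at most the power of
  order \<open>k - 1\<close>. There are at most \<open>k ^ 2\<close> pairs.\<close>

lemma sum_injections_prod_ge:
  fixes v :: "'b \<Rightarrow> real" and k :: nat
  assumes Q: "finite Q" and \<delta>: "0 \<le> \<delta>" and v: "\<And>c. c \<in> Q \<Longrightarrow> 0 \<le> v c" "\<And>c. c \<in> Q \<Longrightarrow> v c \<le> \<delta>"
  shows "(\<Sum>c\<in>Q. v c) ^ k - real k ^ 2 * \<delta> * (\<Sum>c\<in>Q. v c) ^ (k - 1)
       \<le> (\<Sum>f\<in>{f\<in>{..<k} \<rightarrow>\<^sub>E Q. inj_on f {..<k}}. \<Prod>i<k. v (f i))"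
proof -
  let ?F = "{f\<in>{..<k} \<rightarrow>\<^sub>E Q. inj_on f {..<k}}" and ?V = "\<Sum>c\<in>Q. v c"
  let ?pr = "\<lambda>f. \<Prod>i<k. v (f i)"
  let ?E = "\<lambda>(a,b). {f\<in>{..<k} \<rightarrow>\<^sub>E Q. f a = f b}"
  let ?I = "{(a,b). a < k \<and> b < k \<and> a \<noteq> b}"
  have finA: "finite ({..<k} \<rightarrow>\<^sub>E Q)" using Q by (auto intro: finite_PiE)
  have finI: "finite ?I" by (rule finite_subset[of _ "{..<k} \<times> {..<k}"]) auto
  have "card ?I \<le> card ({..<k} \<times> {..<k})" by (rule card_mono) auto
  then have cI: "card ?I \<le> k ^ 2" by (simp add: power2_eq_square)
  have pr0: "0 \<le> ?pr f" if "f \<in> {..<k} \<rightarrow>\<^sub>E Q" for f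
    using that by (intro prod_nonneg) (auto simp: PiE_iff v)
  have sub: "({..<k} \<rightarrow>\<^sub>E Q) - ?F \<subseteq> (\<Union>p\<in>?I. ?E p)" by (auto simp: inj_on_def)
  have E: "sum ?pr (?E p) \<le> \<delta> * ?V ^ (k - 1)" if p: "p \<in> ?I" for p
  proof -
    obtain a b where ab: "p = (a,b)" "a < k" "b < k" "a \<noteq> b" using p by auto
    let ?K = "{..<k} - {b}"
    \<comment> \<open>Forgetting the value at \<open>b\<close> loses nothing, since it is recovered
      as the value at \<open>a\<close>.\<close>
    have inj: "inj_on (\<lambda>f. restrict f ?K) (?E p)"
    proof (rule inj_onI)
      fix f g assume fg: "f \<in> ?E p" "g \<in> ?E p" "restrict f ?K = restrict g ?K"
      have eq: "f i = g i" if "i \<in> ?K" for i using fg(3) that by (metis restrict_apply)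
      have "f b = g b" using fg(1,2) eq[of a] ab by auto
      with eq fg(1,2) show "f = g" by (auto simp: ab PiE_iff extensional_def fun_eq_iff) (metis)
    qed
    have "sum ?pr (?E p) \<le> (\<Sum>f\<in>?E p. \<delta> * (\<Prod>i\<in>?K. v (restrict f ?K i)))"
    proof (rule sum_mono)
      fix f assume f: "f \<in> ?E p"
      have "?pr f = v (f b) * (\<Prod>i\<in>?K. v (f i))" using ab by (intro prod.remove) auto
      also have "\<dots> \<le> \<delta> * (\<Prod>i\<in>?K. v (f i))"
        using f ab by (intro mult_right_mono prod_nonneg) (auto simp: PiE_iff v)
      finally show "?pr f \<le> \<delta> * (\<Prod>i\<in>?K. v (restrict f ?K i))" by simp
    qed
    also have "\<dots> = (\<Sum>g\<in>(\<lambda>f. restrict f ?K) ` ?E p. \<delta> * (\<Prod>i\<in>?K. v (g i)))"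
      by (simp add: sum.reindex[OF inj])
    also have "\<dots> \<le> (\<Sum>g\<in>?K \<rightarrow>\<^sub>E Q. \<delta> * (\<Prod>i\<in>?K. v (g i)))"
    proof (rule sum_mono2)
      show "finite (?K \<rightarrow>\<^sub>E Q)" using Q by (auto intro: finite_PiE)
      show "(\<lambda>f. restrict f ?K) ` ?E p \<subseteq> ?K \<rightarrow>\<^sub>E Q"
        by (simp add: ab image_subset_iff PiE_iff)
      fix g assume g: "g \<in> (?K \<rightarrow>\<^sub>E Q) - (\<lambda>f. restrict f ?K) ` ?E p"
      then have "0 \<le> (\<Prod>i\<in>?K. v (g i))" using g by (intro prod_nonneg) (auto simp: PiE_iff v)
      then show "0 \<le> \<delta> * (\<Prod>i\<in>?K. v (g i))" using \<delta> by simp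
    qed
    also have "\<dots> = \<delta> * (\<Prod>i\<in>?K. ?V)"
      using Q by (subst prod_sum_PiE) (auto simp: sum_distrib_left)
    also have "\<dots> = \<delta> * ?V ^ (k - 1)" using ab by simp
    finally show ?thesis .
  qed
  have "?V ^ k = (\<Prod>i<k. ?V)" by simp
  also have "\<dots> = sum ?pr ({..<k} \<rightarrow>\<^sub>E Q)" using Q by (subst prod_sum_PiE) auto
  also have "\<dots> = sum ?pr ?F + sum ?pr (({..<k} \<rightarrow>\<^sub>E Q) - ?F)"
    using finA by (subst sum.subset_diff[of ?F]) auto
  also have "sum ?pr (({..<k} \<rightarrow>\<^sub>E Q) - ?F) \<le> sum ?pr (\<Union>p\<in>?I. ?E p)"
    using sub finA by (intro sum_mono2) (auto intro!: pr0 finite_UN_I finI)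
  also have "\<dots> \<le> (\<Sum>p\<in>?I. sum ?pr (?E p))"
    using finA finI by (intro sum_UN_le) (auto simp: pr0 split: prod.splits)
  also have "\<dots> \<le> (\<Sum>p\<in>?I. \<delta> * ?V ^ (k - 1))" by (rule sum_mono) (rule E)
  also have "\<dots> \<le> real (k^2) * (\<delta> * ?V ^ (k - 1))"
    using cI \<delta> v by (simp add: mult_right_mono sum_nonneg)
  finally show ?thesis by simp
qed

section \<open>Bonferroni inequalities and configurations\<close>

text \<open>Pascal's rule makes the sum telescope. The sign of the single remaining term is what
  alternates in Bonferroni's inequalities.\<close>

lemma alternating_binomial_partial_sum:
  "(\<Sum>j\<le>m. (- 1) ^ j * real (Suc n choose j)) = (- 1) ^ m * real (n choose m)"
  by (induction m) (simp_all add: algebra_simps)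

lemma
  shows bonferroni_upper: "of_bool (n = 0) \<le> (\<Sum>j\<le>2 * m. (- 1) ^ j * real (n choose j))"
    and bonferroni_lower: "(\<Sum>j\<le>Suc (2 * m). (- 1) ^ j * real (n choose j)) \<le> of_bool (n = 0)"
proof -
  have zero: "(\<Sum>j\<le>k. (- 1) ^ j * real (0 choose j)) = 1" for k
    by (induction k) simp_all
  have "of_bool (n = 0) \<le> (\<Sum>j\<le>2 * m. (- 1) ^ j * real (n choose j)) \<and>
    (\<Sum>j\<le>Suc (2 * m). (- 1) ^ j * real (n choose j)) \<le> of_bool (n = 0)"
  proof (cases n)
    case 0
    then show ?thesis using zero by (simp del: sum.atMost_Suc)
  next
    case (Suc n')
    then show ?thesis by (simp only: alternating_binomial_partial_sum) simp
  qed
  then show "of_bool (n = 0) \<le> (\<Sum>j\<le>2 * m. (- 1) ^ j * real (n choose j))"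
    "(\<Sum>j\<le>Suc (2 * m). (- 1) ^ j * real (n choose j)) \<le> of_bool (n = 0)" by blast+
qed

text \<open>The order \<open>m\<close> of truncation is fixed first, according to the required
  accuracy, and only then does \<open>R\<close> move; so each limit in \<open>R\<close> involves
  finitely many moments and no interchange with an infinite series occurs. The bounds are only
  eventual because integrability of the moments will be known for large \<open>R\<close>.\<close>

lemma tendsto_exp_minus_bonferroni:
  fixes p :: "'i \<Rightarrow> real" and b :: "nat \<Rightarrow> 'i \<Rightarrow> real"
  assumes b: "\<And>k. (b k \<longlongrightarrow> x ^ k / fact k) F"
    and lower: "\<And>m. \<forall>\<^sub>F R in F. (\<Sum>j\<le>Suc (2 * m). (- 1) ^ j * b j R) \<le> p R"
    and upper: "\<And>m. \<forall>\<^sub>F R in F. p R \<le> (\<Sum>j\<le>2 * m. (- 1) ^ j * b j R)"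
  shows "(p \<longlongrightarrow> exp (- x)) F"
proof -
  define s where "s n = (\<Sum>j\<le>n. (- 1) ^ j * (x ^ j / fact j))" for n
  have "(\<lambda>n. (- x) ^ n /\<^sub>R fact n) sums exp (- x)" by (rule exp_converges)
  moreover have "(- x) ^ n /\<^sub>R fact n = (- 1) ^ n * (x ^ n / fact n)" for n
    by (subst power_minus) (simp add: divide_inverse)
  ultimately have s: "s \<longlonglongrightarrow> exp (- x)" by (simp add: sums_def_le s_def[abs_def])
  have lim: "((\<lambda>R. \<Sum>j\<le>n. (- 1) ^ j * b j R) \<longlongrightarrow> s n) F" for n
    unfolding s_def by (intro tendsto_intros b)
  have odd: "(\<lambda>m. s (Suc (2 * m))) \<longlonglongrightarrow> exp (- x)"
    by (rule LIMSEQ_subseq_LIMSEQ[OF s, unfolded o_def]) (simp add: strict_mono_def)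
  have even: "(\<lambda>m. s (2 * m)) \<longlonglongrightarrow> exp (- x)"
    by (rule LIMSEQ_subseq_LIMSEQ[OF s, unfolded o_def]) (simp add: strict_mono_def)
  show ?thesis
  proof (rule order_tendstoI)
    fix a assume "a < exp (- x)"
    then have "\<forall>\<^sub>F m in sequentially. a < s (Suc (2 * m))" by (rule order_tendstoD(1)[OF odd])
    then obtain m where "a < s (Suc (2 * m))"
      by (auto simp: eventually_sequentially)
    then have "\<forall>\<^sub>F R in F. a < (\<Sum>j\<le>Suc (2 * m). (- 1) ^ j * b j R)"
      by (rule order_tendstoD(1)[OF lim])
    then show "\<forall>\<^sub>F R in F. a < p R" using lower[of m] by eventually_elim linarith
  next
    fix a assume "exp (- x) < a"
    then have "\<forall>\<^sub>F m in sequentially. s (2 * m) < a" by (rule order_tendstoD(2)[OF even])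
    then obtain m where "s (2 * m) < a"
      by (auto simp: eventually_sequentially)
    then have "\<forall>\<^sub>F R in F. (\<Sum>j\<le>2 * m. (- 1) ^ j * b j R) < a"
      by (rule order_tendstoD(2)[OF lim])
    then show "\<forall>\<^sub>F R in F. p R < a" using upper[of m] by eventually_elim linarith
  qed
qed

section \<open>Local structure of configurations\<close>

lemma precompact_BorelD:
  assumes "B \<in> precompact_Borel X"
  shows "B \<in> sets (restrict_space borel X)" "B \<subseteq> X"
  using assms by (auto simp: precompact_Borel_def)

lemma precompact_Borel_subset:
  assumes "B \<in> precompact_Borel X" "B' \<in> sets (restrict_space borel X)" "B' \<subseteq> B"
  shows "B' \<in> precompact_Borel X"
  using assms unfolding precompact_Borel_def by blast

text \<open>Infinitely many indices over a precompact set would give it infinite mass. A single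
  finite family \<open>J\<close>, \<open>x\<close> then serves all Borel subsets of \<open>A\<close>
  at once, and multiplicities are retained as different indices with the same point.\<close>

lemma Conf_local_points:
  assumes \<xi>: "\<xi> \<in> Conf X" and A: "A \<in> precompact_Borel X"
  obtains J :: "nat set" and x where "finite J" "x \<in> J \<rightarrow> A"
    "\<And>B. B \<in> sets (restrict_space borel X) \<Longrightarrow> B \<subseteq> A \<Longrightarrow> emeasure \<xi> B = of_nat (card {j\<in>J. x j \<in> B})"
    "\<And>B. B \<in> sets (restrict_space borel X) \<Longrightarrow> B \<subseteq> A \<Longrightarrow> measure \<xi> B = real (card {j\<in>J. x j \<in> B})"
proof -
  obtain I :: "nat set" and x where x: "x \<in> I \<rightarrow> X"
    and eq: "\<xi> = distr (count_space I) (restrict_space borel X) x"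
    and fin: "\<And>B. B \<in> precompact_Borel X \<Longrightarrow> emeasure \<xi> B < \<infinity>"
    using \<xi> unfolding Conf_def by auto
  let ?J = "{i\<in>I. x i \<in> A}"
  have em: "emeasure \<xi> B = emeasure (count_space I) {i\<in>I. x i \<in> B}"
    if "B \<in> sets (restrict_space borel X)" for B
  proof -
    have "x -` B \<inter> I = {i\<in>I. x i \<in> B}" by auto
    then show ?thesis unfolding eq using x that
      by (subst emeasure_distr) (auto simp: space_restrict_space)
  qed
  have J: "finite ?J"
  proof (rule ccontr)
    assume "infinite ?J"
    then have "emeasure \<xi> A = \<infinity>"
      using em[OF precompact_BorelD(1)[OF A]] by (simp add: emeasure_count_space)
    then show False using fin[OF A] by simp
  qed
  have *: "emeasure \<xi> B = of_nat (card {j\<in>?J. x j \<in> B})"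
    if B: "B \<in> sets (restrict_space borel X)" "B \<subseteq> A" for B
  proof -
    have "{j\<in>?J. x j \<in> B} = {i\<in>I. x i \<in> B}" using B by auto
    moreover have "finite {i\<in>I. x i \<in> B}" using J by (rule rev_finite_subset) (use B in auto)
    ultimately show ?thesis using em[OF B(1)] by (simp add: emeasure_count_space)
  qed
  show thesis
  proof (rule that[OF J])
    show "x \<in> ?J \<rightarrow> A" by auto
    show "measure \<xi> B = real (card {j\<in>?J. x j \<in> B})"
      if B: "B \<in> sets (restrict_space borel X)" "B \<subseteq> A" for B
      using *[OF B] by (simp add: measure_def ennreal_of_nat_eq_real_of_nat)
  qed (rule *)
qed

lemma Conf_count:
  assumes "\<xi> \<in> Conf X" "A \<in> precompact_Borel X"
  obtains n :: nat where "measure \<xi> A = real n" "emeasure \<xi> A = of_nat n"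
  using Conf_local_points[OF assms] precompact_BorelD(1)[OF assms(2)] by (metis subset_refl)

lemma sets_Conf: "\<xi> \<in> Conf X \<Longrightarrow> sets \<xi> = sets (restrict_space borel X)"
  unfolding Conf_def by auto

lemma measure_Conf_UN:
  assumes \<xi>: "\<xi> \<in> Conf X" and A: "\<And>i. i \<in> S \<Longrightarrow> A i \<in> precompact_Borel X"
    and S: "finite S" "disjoint_family_on A S"
  shows "measure \<xi> (\<Union>i\<in>S. A i) = (\<Sum>i\<in>S. measure \<xi> (A i))"
proof (rule measure_finite_Union[OF S(1)])
  show "A ` S \<subseteq> sets \<xi>" using A precompact_BorelD(1) sets_Conf[OF \<xi>] by blast
  show "emeasure \<xi> (A i) \<noteq> \<infinity>" if "i \<in> S" for i
    using Conf_count[OF \<xi> A[OF that]] by (metis ennreal_of_nat_eq_real_of_nat ennreal_neq_top infinity_ennreal_def)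
qed (rule S(2))

section \<open>Factorial moments of determinantal processes\<close>

lemma determinantal_processD:
  assumes det: "determinantal_process M X \<mu> K \<Xi>" and k: "1 \<le> k"
    and \<Delta>: "\<forall>i<k. \<Delta> i \<in> precompact_Borel X" "disjoint_family_on \<Delta> {..<k}"
  shows "integrable M (\<lambda>w. \<Prod>i<k. measure (\<Xi> w) (\<Delta> i)) \<and>
    set_integrable (Pi\<^sub>M {..<k} (\<lambda>_. \<mu>)) (Pi\<^sub>E {..<k} \<Delta>)
      (\<lambda>x. Determinant.det (mat k k (\<lambda>(i, j). K (x i) (x j)))) \<and>
    complex_of_real (\<integral>w. (\<Prod>i<k. measure (\<Xi> w) (\<Delta> i)) \<partial>M) =
      set_lebesgue_integral (Pi\<^sub>M {..<k} (\<lambda>_. \<mu>)) (Pi\<^sub>E {..<k} \<Delta>)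
        (\<lambda>x. Determinant.det (mat k k (\<lambda>(i, j). K (x i) (x j))))"
  by (rule det[unfolded determinantal_process_def, THEN conjunct2, THEN conjunct2, THEN conjunct2,
        THEN spec, THEN mp, OF k, THEN spec, THEN mp, OF conjI[OF \<Delta>]])

text \<open>Everything concerns one set \<open>A\<close>. The function \<open>q\<close> is the
  square root of the diagonal of the kernel, \<open>\<kappa>\<close> bounds the normalised modulus
  of the kernel, and \<open>c\<close> bounds the mass of \<open>A\<close> weighted by the
  correlation with any one of its points: it is the quantity that has to be small. The maps
  \<open>cell n\<close> form partitions that eventually separate any two points and whose cells have
  mass at most \<open>\<delta> n\<close>.\<close>

locale dominated_determinantal_process =
  fixes M :: "'p measure" and X :: "'a::t2_space set" and \<mu> :: "'a measure"
    and K :: "'a \<Rightarrow> 'a \<Rightarrow> complex" and \<Xi> :: "'p \<Rightarrow> 'a measure"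
    and A :: "'a set" and q :: "'a \<Rightarrow> real" and \<kappa> :: "'a \<Rightarrow> 'a \<Rightarrow> real" and c :: real
    and cell :: "nat \<Rightarrow> 'a \<Rightarrow> 'b" and Q :: "nat \<Rightarrow> 'b set" and \<delta> :: "nat \<Rightarrow> real"
  assumes determinantal: "determinantal_process M X \<mu> K \<Xi>"
    and sigma_finite: "sigma_finite_measure \<mu>"
    and A: "A \<in> precompact_Borel X"
    and q_measurable [measurable]: "q \<in> borel_measurable \<mu>"
    and q_nonneg: "\<And>x. x \<in> A \<Longrightarrow> 0 \<le> q x"
    and q_integrable: "set_integrable \<mu> A (\<lambda>x. (q x)\<^sup>2)"
    and \<kappa>_measurable: "(\<lambda>(x, y). \<kappa> x y) \<in> borel_measurable (\<mu> \<Otimes>\<^sub>M \<mu>)"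
    and \<kappa>_nonneg: "\<And>x y. x \<in> A \<Longrightarrow> y \<in> A \<Longrightarrow> 0 \<le> \<kappa> x y"
    and \<kappa>_le_1: "\<And>x y. x \<in> A \<Longrightarrow> y \<in> A \<Longrightarrow> \<kappa> x y \<le> 1"
    and K_diag: "\<And>x. x \<in> A \<Longrightarrow> K x x = complex_of_real ((q x)\<^sup>2)"
    and K_bound: "\<And>x y. x \<in> A \<Longrightarrow> y \<in> A \<Longrightarrow> cmod (K x y) \<le> q x * q y * \<kappa> x y"
    and c_nonneg: "0 \<le> c"
    and c_bound: "\<And>y. y \<in> A \<Longrightarrow> (\<integral>\<^sup>+x. ennreal (indicator A x * (q x)\<^sup>2 * \<kappa> x y) \<partial>\<mu>) \<le> ennreal c"
    and finite_Q: "\<And>n. finite (Q n)"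
    and cell_Q: "\<And>n x. x \<in> A \<Longrightarrow> cell n x \<in> Q n"
    and cell_sets: "\<And>n d. {x\<in>A. cell n x = d} \<in> sets (restrict_space borel X)"
    and cell_separates: "\<And>x y. x \<in> A \<Longrightarrow> y \<in> A \<Longrightarrow> x \<noteq> y \<Longrightarrow> \<forall>\<^sub>F n in sequentially. cell n x \<noteq> cell n y"
    and cell_small: "\<And>n d. (LINT x:{x\<in>A. cell n x = d}|\<mu>. (q x)\<^sup>2) \<le> \<delta> n"
    and \<delta>_tendsto: "\<delta> \<longlonglongrightarrow> 0"
begin

definition v :: "'a set \<Rightarrow> real" where "v B = (LINT x:B|\<mu>. (q x)\<^sup>2)"

definition \<Delta> :: "nat \<Rightarrow> 'b \<Rightarrow> 'a set" where "\<Delta> n d = {x\<in>A. cell n x = d}"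

definition injections :: "nat \<Rightarrow> nat \<Rightarrow> (nat \<Rightarrow> 'b) set" where
  "injections k n = {f\<in>{..<k} \<rightarrow>\<^sub>E Q n. inj_on f {..<k}}"

abbreviation cell_prod :: "nat \<Rightarrow> nat \<Rightarrow> (nat \<Rightarrow> 'b) \<Rightarrow> 'p \<Rightarrow> real" where
  "cell_prod k n f \<equiv> \<lambda>w. \<Prod>i<k. measure (\<Xi> w) (\<Delta> n (f i))"

abbreviation cell_mass :: "nat \<Rightarrow> nat \<Rightarrow> (nat \<Rightarrow> 'b) \<Rightarrow> real" where
  "cell_mass k n f \<equiv> \<Prod>i<k. v (\<Delta> n (f i))"

sublocale prod_sf: product_sigma_finite "\<lambda>_::nat. \<mu>"
  using sigma_finite by (simp add: product_sigma_finite_def)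

lemma sets_\<mu>: "sets \<mu> = sets (restrict_space borel X)"
  using determinantal by (simp add: determinantal_process_def Radon_measure_on_def)

lemma A_sets [measurable]: "A \<in> sets \<mu>"
  using precompact_BorelD(1)[OF A] sets_\<mu> by simp

lemma \<Delta>_sets [measurable]: "\<Delta> n d \<in> sets \<mu>"
  using cell_sets sets_\<mu> by (simp add: \<Delta>_def)

lemma \<Delta>_subset: "\<Delta> n d \<subseteq> A" by (auto simp: \<Delta>_def)

lemma \<Delta>_precompact: "\<Delta> n d \<in> precompact_Borel X"
  by (rule precompact_Borel_subset[OF A]) (use cell_sets in \<open>auto simp: \<Delta>_def\<close>)

lemma finite_injections: "finite (injections k n)"
  unfolding injections_def using finite_PiE[of "{..<k}" "\<lambda>_. Q n"] finite_Q by simp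

lemma integrable_\<Delta>: "set_integrable \<mu> (\<Delta> n d) (\<lambda>x. (q x)\<^sup>2)"
  by (rule set_integrable_subset[OF q_integrable]) (auto simp: \<Delta>_subset)

lemma v_nonneg: "0 \<le> v B"
  unfolding v_def set_lebesgue_integral_def by (intro Bochner_Integration.integral_nonneg) auto

lemma v_A: "(\<Sum>d\<in>Q n. v (\<Delta> n d)) = v A"
proof -
  have "(\<Sum>d\<in>Q n. v (\<Delta> n d)) = (LINT x|\<mu>. (\<Sum>d\<in>Q n. indicator (\<Delta> n d) x *\<^sub>R (q x)\<^sup>2))"
    unfolding v_def set_lebesgue_integral_def using integrable_\<Delta>
    by (intro Bochner_Integration.integral_sum[symmetric]) (auto simp: set_integrable_def)
  also have "\<dots> = (LINT x|\<mu>. indicator A x *\<^sub>R (q x)\<^sup>2)"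
  proof (intro Bochner_Integration.integral_cong refl)
    fix x show "(\<Sum>d\<in>Q n. indicator (\<Delta> n d) x *\<^sub>R (q x)\<^sup>2) = indicator A x *\<^sub>R (q x)\<^sup>2"
  proof (cases "x \<in> A")
    case True
    then have "(\<Sum>d\<in>Q n. indicator (\<Delta> n d) x *\<^sub>R (q x)\<^sup>2) = (\<Sum>d\<in>Q n. if d = cell n x then (q x)\<^sup>2 else 0)"
      by (intro sum.cong) (auto simp: \<Delta>_def)
    then show ?thesis using True cell_Q[OF True] finite_Q by simp
  qed (simp add: \<Delta>_def)
  qed
  finally show ?thesis by (simp add: v_def set_lebesgue_integral_def)
qed

text \<open>One displaced index per permutation is enough: the factor \<open>\<kappa>\<close> at
  this index is kept and all others are bounded by 1. The choice is meaningful only for permutations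
  other than the identity, which are the only ones to occur in \<open>excess\<close>.\<close>

definition moved :: "nat \<Rightarrow> (nat \<Rightarrow> nat) \<Rightarrow> nat" where
  "moved k \<sigma> = (SOME a. a < k \<and> \<sigma> a \<noteq> a)"

text \<open>Majorant of the Leibniz expansion without its identity term, keeping a single
  correlation per permutation so that it can be integrated one variable at a time.\<close>

definition excess :: "nat \<Rightarrow> (nat \<Rightarrow> 'a) \<Rightarrow> real" where
  "excess k x = (\<Sum>\<sigma>\<in>{\<sigma>. \<sigma> permutes {0..<k}} - {id}.
     (\<Prod>i<k. (q (x i))\<^sup>2) * \<kappa> (x (moved k \<sigma>)) (x (\<sigma> (moved k \<sigma>))))"

lemma moved:
  assumes "\<sigma> permutes {0..<k}" "\<sigma> \<noteq> id"
  shows "moved k \<sigma> < k" "\<sigma> (moved k \<sigma>) < k" "\<sigma> (moved k \<sigma>) \<noteq> moved k \<sigma>"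
proof -
  have "\<exists>a. a < k \<and> \<sigma> a \<noteq> a"
  proof (rule ccontr)
    assume "\<not> ?thesis"
    then have "\<sigma> a = a" for a using permutes_not_in[OF assms(1), of a] by (cases "a < k") auto
    then show False using assms(2) by auto
  qed
  then have *: "moved k \<sigma> < k \<and> \<sigma> (moved k \<sigma>) \<noteq> moved k \<sigma>"
    unfolding moved_def by (rule someI_ex)
  then show "moved k \<sigma> < k" "\<sigma> (moved k \<sigma>) \<noteq> moved k \<sigma>" by auto
  show "\<sigma> (moved k \<sigma>) < k"
    using * permutes_in_image[OF assms(1), of "moved k \<sigma>"] by simp
qed

text \<open>The identity permutation yields the product of the diagonal entries. In every other term
  the row factors \<open>q (x i)\<close> and the column factors \<open>q (x (\<sigma> i))\<close>
  combine to the same product of squares, leaving only a product of values of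
  \<open>\<kappa>\<close>.\<close>

lemma det_excess:
  assumes x: "\<And>i. i < k \<Longrightarrow> x i \<in> A"
  shows "cmod (Determinant.det (mat k k (\<lambda>(i, j). K (x i) (x j))) - complex_of_real (\<Prod>i<k. (q (x i))\<^sup>2))
    \<le> excess k x"
proof -
  let ?P = "{\<sigma>. \<sigma> permutes {0..<k}}"
  let ?t = "\<lambda>\<sigma>. signof \<sigma> * (\<Prod>i=0..<k. K (x i) (x (\<sigma> i)))"
  have fin: "finite ?P" by (rule finite_permutations) simp
  have "Determinant.det (mat k k (\<lambda>(i, j). K (x i) (x j))) = (\<Sum>\<sigma>\<in>?P. ?t \<sigma>)"
  proof (subst det_def'[of _ k], simp, rule sum.cong, simp)
    fix \<sigma> assume "\<sigma> \<in> ?P"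
    then have "\<sigma> i < k" if "i < k" for i using permutes_in_image[of \<sigma> "{0..<k}" i] that by simp
    then show "signof \<sigma> * (\<Prod>i=0..<k. mat k k (\<lambda>(i, j). K (x i) (x j)) $$ (i, \<sigma> i)) = ?t \<sigma>"
      by (auto intro!: arg_cong[where f="\<lambda>z. _ * z"] prod.cong)
  qed
  also have "\<dots> = ?t id + (\<Sum>\<sigma>\<in>?P - {id}. ?t \<sigma>)"
    by (rule sum.remove[OF fin]) (simp add: permutes_id)
  also have "?t id = complex_of_real (\<Prod>i<k. (q (x i))\<^sup>2)"
    using K_diag x by (auto simp: sign_id atLeast0LessThan intro!: prod.cong)
  finally have "cmod (Determinant.det (mat k k (\<lambda>(i, j). K (x i) (x j))) - complex_of_real (\<Prod>i<k. (q (x i))\<^sup>2))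
      = cmod (\<Sum>\<sigma>\<in>?P - {id}. ?t \<sigma>)" by (simp only: add_diff_cancel_left')
  also have "\<dots> \<le> excess k x"
    unfolding excess_def
  proof (rule order_trans[OF norm_sum], rule sum_mono)
    fix \<sigma> assume "\<sigma> \<in> ?P - {id}"
    then have \<sigma>: "\<sigma> permutes {0..<k}" "\<sigma> \<noteq> id" by auto
    note m = moved[OF \<sigma>]
    have \<sigma>k: "\<sigma> i < k" if "i < k" for i using permutes_in_image[OF \<sigma>(1), of i] that by simp
    have "cmod (signof \<sigma>) = 1" by (cases rule: sign_cases[of \<sigma>]) auto
    then have "cmod (?t \<sigma>) = (\<Prod>i<k. cmod (K (x i) (x (\<sigma> i))))"
      by (simp add: norm_mult prod_norm atLeast0LessThan)
    also have "\<dots> \<le> (\<Prod>i<k. q (x i) * q (x (\<sigma> i)) * \<kappa> (x i) (x (\<sigma> i)))"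
      using x \<sigma>k by (intro prod_mono) (auto intro!: K_bound)
    also have "\<dots> = (\<Prod>i<k. q (x i)) * (\<Prod>i<k. q (x (\<sigma> i))) * (\<Prod>i<k. \<kappa> (x i) (x (\<sigma> i)))"
      by (simp add: prod.distrib)
    \<comment> \<open>Reindexing by the permutation turns the column factors into the row
      factors.\<close>
    also have "(\<Prod>i<k. q (x (\<sigma> i))) = (\<Prod>i<k. q (x i))"
      using prod.permute[of \<sigma> "{..<k}" "\<lambda>i. q (x i)"] \<sigma>(1) by (simp add: atLeast0LessThan o_def)
    also have "(\<Prod>i<k. \<kappa> (x i) (x (\<sigma> i))) = \<kappa> (x (moved k \<sigma>)) (x (\<sigma> (moved k \<sigma>))) *
        (\<Prod>i\<in>{..<k} - {moved k \<sigma>}. \<kappa> (x i) (x (\<sigma> i)))"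
      using m by (intro prod.remove) auto
    also have "(\<Prod>i<k. q (x i)) * (\<Prod>i<k. q (x i)) * (\<kappa> (x (moved k \<sigma>)) (x (\<sigma> (moved k \<sigma>))) *
        (\<Prod>i\<in>{..<k} - {moved k \<sigma>}. \<kappa> (x i) (x (\<sigma> i))))
      \<le> (\<Prod>i<k. q (x i)) * (\<Prod>i<k. q (x i)) * (\<kappa> (x (moved k \<sigma>)) (x (\<sigma> (moved k \<sigma>))) * 1)"
      using x \<sigma>k m
      by (intro mult_left_mono prod_le_1 mult_nonneg_nonneg prod_nonneg conjI \<kappa>_nonneg \<kappa>_le_1 q_nonneg ballI) auto
    finally show "cmod (?t \<sigma>) \<le> (\<Prod>i<k. (q (x i))\<^sup>2) * \<kappa> (x (moved k \<sigma>)) (x (\<sigma> (moved k \<sigma>)))"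
      by (simp add: power2_eq_square prod.distrib)
  qed
  finally show ?thesis .
qed

abbreviation PM :: "nat \<Rightarrow> (nat \<Rightarrow> 'a) measure" where "PM k \<equiv> Pi\<^sub>M {..<k} (\<lambda>_. \<mu>)"

lemma \<kappa>_comp_measurable:
  assumes "a < k" "b < k"
  shows "(\<lambda>x. \<kappa> (x a) (x b)) \<in> borel_measurable (PM k)"
proof -
  have "(\<lambda>x. (x a, x b)) \<in> measurable (PM k) (\<mu> \<Otimes>\<^sub>M \<mu>)"
    using assms by (intro measurable_Pair measurable_component_singleton) auto
  from measurable_compose[OF this \<kappa>_measurable] show ?thesis by simp
qed

lemma q_comp_measurable: "i < k \<Longrightarrow> (\<lambda>x. q (x i)) \<in> borel_measurable (PM k)"
  by (rule measurable_compose[OF _ q_measurable]) (auto intro: measurable_component_singleton)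

lemma indicator_comp_measurable:
  "i < k \<Longrightarrow> (\<lambda>x. indicator A (x i) :: real) \<in> borel_measurable (PM k)"
  by (rule measurable_compose[OF _ borel_measurable_indicator[OF A_sets]]) (auto intro: measurable_component_singleton)

lemma nn_integral_q: "(\<integral>\<^sup>+x. ennreal (indicator A x * (q x)\<^sup>2) \<partial>\<mu>) = ennreal (v A)"
  unfolding v_def set_lebesgue_integral_def
  by (subst nn_integral_eq_integral) (use q_integrable in \<open>auto simp: set_integrable_def\<close>)

text \<open>By Tonelli the variable \<open>x a\<close> is integrated first, with \<open>x b\<close>
  frozen; \<open>c_bound\<close> turns this inner integral into \<open>c\<close>. The remaining
  \<open>k - 1\<close> variables are decoupled and contribute \<open>v A\<close> each.\<close>

lemma pair_excess_integral:
  assumes ab: "a < k" "b < k" "a \<noteq> b"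
  shows "(\<integral>\<^sup>+x. ennreal ((\<Prod>i<k. indicator A (x i) * (q (x i))\<^sup>2) * \<kappa> (x a) (x b)) \<partial>PM k)
    \<le> ennreal (c * v A ^ (k - 1))"
proof -
  let ?J = "{..<k} - {a}" and ?g = "\<lambda>y. indicator A y * (q y)\<^sup>2"
  have I: "{..<k} = insert a ?J" using ab by auto
  let ?f = "\<lambda>x. ennreal ((\<Prod>i<k. ?g (x i)) * \<kappa> (x a) (x b))"
  have meas: "?f \<in> borel_measurable (PM k)"
    using ab by (intro measurable_compose[OF _ measurable_ennreal] borel_measurable_times borel_measurable_prod
        \<kappa>_comp_measurable borel_measurable_power q_comp_measurable indicator_comp_measurable) auto
  have "(\<integral>\<^sup>+x. ?f x \<partial>PM k) = (\<integral>\<^sup>+x. \<integral>\<^sup>+y. ?f (x(a := y)) \<partial>\<mu> \<partial>Pi\<^sub>M ?J (\<lambda>_. \<mu>))"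
    using meas unfolding I[symmetric]
    by (subst (1) I, subst prod_sf.product_nn_integral_insert) (auto simp: insert_absorb ab I[symmetric])
  also have "\<dots> \<le> (\<integral>\<^sup>+x. ennreal c * (\<Prod>i\<in>?J. ennreal (?g (x i))) \<partial>Pi\<^sub>M ?J (\<lambda>_. \<mu>))"
  proof (rule nn_integral_mono)
    fix x assume "x \<in> space (Pi\<^sub>M ?J (\<lambda>_. \<mu>))"
    have g0: "0 \<le> (\<Prod>i\<in>?J. ?g (x i))" by (intro prod_nonneg) auto
    have eq: "(\<Prod>i<k. ?g ((x(a := y)) i)) = ?g y * (\<Prod>i\<in>?J. ?g (x i))" for y
      using ab by (subst prod.remove[of _ a]) auto
    show "(\<integral>\<^sup>+y. ?f (x(a := y)) \<partial>\<mu>) \<le> ennreal c * (\<Prod>i\<in>?J. ennreal (?g (x i)))"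
    \<comment> \<open>The bound by \<open>c\<close> is available only for \<open>x b\<close> in
      \<open>A\<close>; otherwise the indicator at \<open>b\<close>, which is still among the
      remaining factors because \<open>a \<noteq> b\<close>, makes both sides vanish.\<close>
    proof (cases "x b \<in> A")
      case True
      have "(\<integral>\<^sup>+y. ?f (x(a := y)) \<partial>\<mu>) =
          (\<integral>\<^sup>+y. ennreal (\<Prod>i\<in>?J. ?g (x i)) * ennreal (indicator A y * (q y)\<^sup>2 * \<kappa> y (x b)) \<partial>\<mu>)"
        unfolding eq using ab by (intro nn_integral_cong) (simp add: ennreal_mult'[OF g0, symmetric] del: ennreal_mult'', simp add: ac_simps)
      also have "\<dots> = ennreal (\<Prod>i\<in>?J. ?g (x i)) * (\<integral>\<^sup>+y. ennreal (indicator A y * (q y)\<^sup>2 * \<kappa> y (x b)) \<partial>\<mu>)"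
      proof (rule nn_integral_cmult)
        have "(\<lambda>y. \<kappa> y (x b)) \<in> borel_measurable \<mu>"
        proof -
          have "x b \<in> space \<mu>" using True sets.sets_into_space[OF A_sets] by blast
          then have "(\<lambda>y. (y, x b)) \<in> measurable \<mu> (\<mu> \<Otimes>\<^sub>M \<mu>)" by measurable
          from measurable_compose[OF this \<kappa>_measurable] show ?thesis by simp
        qed
        then show "(\<lambda>y. ennreal (indicator A y * (q y)\<^sup>2 * \<kappa> y (x b))) \<in> borel_measurable \<mu>" by measurable
      qed
      also have "\<dots> \<le> ennreal (\<Prod>i\<in>?J. ?g (x i)) * ennreal c"
        by (intro mult_left_mono c_bound True) auto
      also have "\<dots> = ennreal c * (\<Prod>i\<in>?J. ennreal (?g (x i)))"
        by (subst prod_ennreal) (auto simp: mult.commute)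
      finally show ?thesis .
    next
      case False
      then have zero: "(\<Prod>i\<in>?J. ?g (x i)) = 0" using ab by (intro prod_zero) (auto intro!: bexI[of _ b])
      show ?thesis unfolding eq zero by simp
    qed
  qed
  also have "\<dots> = ennreal c * (\<integral>\<^sup>+x. (\<Prod>i\<in>?J. ennreal (?g (x i))) \<partial>Pi\<^sub>M ?J (\<lambda>_. \<mu>))"
    by (rule nn_integral_cmult) measurable
  also have "(\<integral>\<^sup>+x. (\<Prod>i\<in>?J. ennreal (?g (x i))) \<partial>Pi\<^sub>M ?J (\<lambda>_. \<mu>)) = (\<Prod>i\<in>?J. ennreal (v A))"
    by (subst prod_sf.product_nn_integral_prod) (auto simp: nn_integral_q)
  also have "\<dots> = ennreal (v A ^ (k - 1))" using ab v_nonneg by (simp add: ennreal_power)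
  finally show ?thesis by (simp add: ennreal_mult'[OF c_nonneg])
qed


lemma excess_integral:
  "(\<integral>\<^sup>+x. ennreal ((\<Prod>i<k. indicator A (x i)) * excess k x) \<partial>PM k) \<le> ennreal (fact k * (c * v A ^ (k - 1)))"
proof -
  let ?S = "{\<sigma>. \<sigma> permutes {0..<k}} - {id}"
  let ?h = "\<lambda>\<sigma> x. (\<Prod>i<k. indicator A (x i) * (q (x i))\<^sup>2) * \<kappa> (x (moved k \<sigma>)) (x (\<sigma> (moved k \<sigma>)))"
  have fin: "finite {\<sigma>. \<sigma> permutes {0..<k}}" by (rule finite_permutations) simp
  have "card ?S \<le> card {\<sigma>. \<sigma> permutes {0..<k}}" by (rule card_mono[OF fin]) auto
  also have "\<dots> = fact k" by (rule card_permutations) auto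
  finally have card_S: "real (card ?S) \<le> fact k" by (metis of_nat_fact of_nat_mono)
  have "(\<integral>\<^sup>+x. ennreal ((\<Prod>i<k. indicator A (x i)) * excess k x) \<partial>PM k) \<le> (\<integral>\<^sup>+x. (\<Sum>\<sigma>\<in>?S. ennreal (?h \<sigma> x)) \<partial>PM k)"
  proof (rule nn_integral_mono)
    fix x assume "x \<in> space (PM k)"
    show "ennreal ((\<Prod>i<k. indicator A (x i)) * excess k x) \<le> (\<Sum>\<sigma>\<in>?S. ennreal (?h \<sigma> x))"
    proof (cases "\<forall>i<k. x i \<in> A")
      case True
      then have "(\<Prod>i<k. indicator A (x i)) * excess k x = (\<Sum>\<sigma>\<in>?S. ?h \<sigma> x)"
        by (simp add: excess_def)
      moreover have "0 \<le> ?h \<sigma> x" if "\<sigma> \<in> ?S" for \<sigma>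
        using True moved[of \<sigma> k] that by (intro mult_nonneg_nonneg prod_nonneg \<kappa>_nonneg) auto
      ultimately show ?thesis by (subst sum_ennreal) auto
    next
      case False
      then obtain j where "j < k" "x j \<notin> A" by auto
      then have "(\<Prod>i<k. indicator A (x i) :: real) = 0" by (intro prod_zero) (auto intro!: bexI[of _ j])
      then show ?thesis by (simp only: mult_zero_left) simp
    qed
  qed
  also have "\<dots> = (\<Sum>\<sigma>\<in>?S. \<integral>\<^sup>+x. ennreal (?h \<sigma> x) \<partial>PM k)"
    using moved
    by (intro nn_integral_sum measurable_compose[OF _ measurable_ennreal] borel_measurable_times borel_measurable_prod
        \<kappa>_comp_measurable borel_measurable_power q_comp_measurable indicator_comp_measurable) auto
  also have "\<dots> \<le> (\<Sum>\<sigma>\<in>?S. ennreal (c * v A ^ (k - 1)))"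
  proof (rule sum_mono)
    fix \<sigma> assume "\<sigma> \<in> ?S"
    then have "\<sigma> permutes {0..<k}" "\<sigma> \<noteq> id" by auto
    note m = moved[OF this]
    show "(\<integral>\<^sup>+x. ennreal (?h \<sigma> x) \<partial>PM k) \<le> ennreal (c * v A ^ (k - 1))"
      by (rule pair_excess_integral) (use m in auto)
  qed
  also have "\<dots> = ennreal (real (card ?S) * (c * v A ^ (k - 1)))"
    using c_nonneg v_nonneg by (simp add: ennreal_mult ennreal_of_nat_eq_real_of_nat)
  also have "\<dots> \<le> ennreal (fact k * (c * v A ^ (k - 1)))"
    using card_S c_nonneg v_nonneg by (intro ennreal_leI mult_right_mono) auto
  finally show ?thesis .
qed

text \<open>Distinct cells are disjoint, so the expectation is the integral of the determinant over
  a box, and by Fubini the product of masses is the integral of the diagonal product over the same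
  box. The error is left as an integral with its indicators: bounding each box separately would
  multiply the error by the number of boxes.\<close>

lemma cell_product_expectation:
  assumes k: "1 \<le> k" and f: "f \<in> injections k n"
  shows "integrable M (cell_prod k n f)"
    and "ennreal \<bar>(\<integral>w. cell_prod k n f w \<partial>M) - cell_mass k n f\<bar>
      \<le> (\<integral>\<^sup>+x. (\<Prod>i<k. indicator (\<Delta> n (f i)) (x i)) * ennreal (excess k x) \<partial>PM k)"
proof -
  let ?D = "\<lambda>i. \<Delta> n (f i)" and ?S = "Pi\<^sub>E {..<k} (\<lambda>i. \<Delta> n (f i))"
  let ?det = "\<lambda>x. Determinant.det (mat k k (\<lambda>(i, j). K (x i) (x j)))"
  let ?h = "\<lambda>x. \<Prod>i<k. indicator (?D i) (x i) *\<^sub>R (q (x i))\<^sup>2"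
  have "disjoint_family_on ?D {..<k}"
    using f by (auto simp: disjoint_family_on_def injections_def inj_on_def \<Delta>_def)
  moreover have "\<forall>i<k. ?D i \<in> precompact_Borel X" using \<Delta>_precompact by simp
  ultimately have det: "integrable M (cell_prod k n f)"
      "set_integrable (PM k) ?S ?det"
      "complex_of_real (\<integral>w. cell_prod k n f w \<partial>M) = (LINT x:?S|PM k. ?det x)"
    using determinantal_processD[OF determinantal k, of ?D] by blast+
  show "integrable M (cell_prod k n f)" by fact
  have int: "integrable (PM k) ?h"
    using integrable_\<Delta> by (intro prod_sf.product_integrable_prod) (auto simp: set_integrable_def)
  have "(\<integral>x. ?h x \<partial>PM k) = cell_mass k n f"
    using integrable_\<Delta> unfolding v_def set_lebesgue_integral_def
    by (intro prod_sf.product_integral_prod) (auto simp: set_integrable_def)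
  then have "complex_of_real (cell_mass k n f) = (\<integral>x. complex_of_real (?h x) \<partial>PM k)"
    by (simp only: integral_complex_of_real)
  then have eq: "complex_of_real ((\<integral>w. cell_prod k n f w \<partial>M) - cell_mass k n f)
      = (\<integral>x. indicator ?S x *\<^sub>R ?det x - complex_of_real (?h x) \<partial>PM k)"
    using det int by (simp only: of_real_diff det(3) set_lebesgue_integral_def)
      (intro Bochner_Integration.integral_diff[symmetric], auto simp: set_integrable_def simp del: of_real_prod)
  from arg_cong[OF eq, of cmod] have abs_eq: "\<bar>(\<integral>w. cell_prod k n f w \<partial>M) - cell_mass k n f\<bar>
      = cmod (\<integral>x. indicator ?S x *\<^sub>R ?det x - complex_of_real (?h x) \<partial>PM k)"
    by (simp only: norm_of_real)
  have "ennreal \<bar>(\<integral>w. cell_prod k n f w \<partial>M) - cell_mass k n f\<bar>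
      \<le> (\<integral>\<^sup>+x. ennreal (cmod (indicator ?S x *\<^sub>R ?det x - complex_of_real (?h x))) \<partial>PM k)"
    unfolding abs_eq using det(2) int by (intro integral_norm_bound_ennreal Bochner_Integration.integrable_diff)
      (auto simp: set_integrable_def simp del: of_real_prod)
  also have "\<dots> \<le> (\<integral>\<^sup>+x. (\<Prod>i<k. indicator (?D i) (x i)) * ennreal (excess k x) \<partial>PM k)"
  proof (rule nn_integral_mono)
    fix x assume "x \<in> space (PM k)"
    then have ext: "x \<in> extensional {..<k}" by (simp add: space_PiM PiE_def)
    show "ennreal (cmod (indicator ?S x *\<^sub>R ?det x - complex_of_real (?h x)))
      \<le> (\<Prod>i<k. indicator (?D i) (x i)) * ennreal (excess k x)"
    proof (cases "\<forall>i<k. x i \<in> ?D i")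
      case True
      then have "x \<in> ?S" using ext by (simp add: PiE_iff)
      moreover have "?h x = (\<Prod>i<k. (q (x i))\<^sup>2)" using True by (intro prod.cong) auto
      moreover have "(\<Prod>i<k. indicator (?D i) (x i) :: ennreal) = 1" using True by (intro prod.neutral) auto
      moreover have "x i \<in> A" if "i < k" for i using True that \<Delta>_subset by blast
      ultimately show ?thesis using det_excess[of k x]
        by (simp only: indicator_simps scaleR_one mult_1 ennreal_leI)
    next
      case False
      then obtain j where j: "j < k" "x j \<notin> ?D j" by auto
      then have "?h x = 0" by (intro prod_zero) (auto intro!: bexI[of _ j])
      moreover have "x \<notin> ?S" using j PiE_mem by blast
      ultimately show ?thesis by (simp only: indicator_simps) simp
    qed
  qed
  finally show "ennreal \<bar>(\<integral>w. cell_prod k n f w \<partial>M) - cell_mass k n f\<bar>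
      \<le> (\<integral>\<^sup>+x. (\<Prod>i<k. indicator (\<Delta> n (f i)) (x i)) * ennreal (excess k x) \<partial>PM k)" .
qed

end

section \<open>The underlying set of the vague topology\<close>

lemma space_borel_of_topology [simp]: "space (borel_of_topology T) = topspace T"
  by (simp add: borel_of_topology_def space_measure_of_conv)

lemma topspace_vague_topology [simp]: "topspace (vague_topology X) = Conf X"
proof -
  \<comment> \<open>The zero test function with the whole line as open set exhibits the full set
    \<open>Conf X\<close> as a basic open set.\<close>
  have "(\<lambda>_. 0) \<in> Cc X" by (auto simp: Cc_def intro!: exI[of _ "{}"])
  then have "{\<xi> \<in> Conf X. (\<integral>x. 0 \<partial>\<xi>) \<in> (UNIV::real set)} \<in>
      {{\<xi> \<in> Conf X. (\<integral>x. f x \<partial>\<xi>) \<in> U} | f U. f \<in> Cc X \<and> open U}"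
    by (intro CollectI exI[of _ "\<lambda>_. 0"] exI[of _ UNIV]) auto
  then show ?thesis by (auto simp: vague_topology_def)
qed

lemma point_process_Conf: "point_process M X \<Xi> \<Longrightarrow> w \<in> space M \<Longrightarrow> \<Xi> w \<in> Conf X"
  by (auto simp: point_process_def dest: measurable_space)

context dominated_determinantal_process
begin

text \<open>The \<open>k\<close>-th falling factorial of the number of points in \<open>A\<close> as
  seen at resolution \<open>n\<close>: ordered \<open>k\<close>-tuples of points in pairwise
  distinct cells.\<close>

definition cell_sum :: "nat \<Rightarrow> nat \<Rightarrow> 'p \<Rightarrow> real" where
  "cell_sum k n w = (\<Sum>f\<in>injections k n. cell_prod k n f w)"

abbreviation mass_sum :: "nat \<Rightarrow> nat \<Rightarrow> real" where
  "mass_sum k n \<equiv> \<Sum>f\<in>injections k n. cell_mass k n f"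

lemma cell_sum_integrable: "1 \<le> k \<Longrightarrow> integrable M (cell_sum k n)"
  unfolding cell_sum_def[abs_def] by (intro Bochner_Integration.integrable_sum cell_product_expectation)

lemma excess_measurable: "excess k \<in> borel_measurable (PM k)"
  unfolding excess_def[abs_def] using moved
  by (intro borel_measurable_sum borel_measurable_times borel_measurable_prod
        \<kappa>_comp_measurable borel_measurable_power q_comp_measurable) auto

text \<open>At most one summand is nonzero, the one for the sequence of cells of \<open>x\<close>.
  Equality fails when this sequence repeats a cell, as it is then absent from
  \<open>injections k n\<close>.\<close>

lemma sum_indicator_cells_le:
  "(\<Sum>f\<in>injections k n. \<Prod>i<k. indicator (\<Delta> n (f i)) (x i) :: ennreal) \<le> (\<Prod>i<k. indicator A (x i))"
proof (cases "\<forall>i<k. x i \<in> A")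
  case True
  let ?g = "restrict (\<lambda>i. cell n (x i)) {..<k}"
  have "(\<Sum>f\<in>injections k n. \<Prod>i<k. indicator (\<Delta> n (f i)) (x i) :: ennreal)
      \<le> (\<Sum>f\<in>injections k n. if f = ?g then 1 else 0)"
  proof (rule sum_mono)
    fix f assume f: "f \<in> injections k n"
    show "(\<Prod>i<k. indicator (\<Delta> n (f i)) (x i) :: ennreal) \<le> (if f = ?g then 1 else 0)"
    proof (cases "f = ?g")
      case True
      have "(\<Prod>i<k. indicator (\<Delta> n (f i)) (x i) :: ennreal) \<le> 1"
        by (rule prod_le_1) (auto simp: indicator_def)
      then show ?thesis using True by simp
    next
      case False
      have "\<exists>i<k. f i \<noteq> cell n (x i)"
      proof (rule ccontr)
        assume "\<not> ?thesis"
        moreover have "f \<in> extensional {..<k}" using f by (simp add: injections_def PiE_iff)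
        ultimately have "f = ?g" by (intro extensionalityI[of f "{..<k}"]) auto
        then show False using False by simp
      qed
      then obtain i where "i < k" "x i \<notin> \<Delta> n (f i)" by (auto simp: \<Delta>_def)
      then have "(\<Prod>i<k. indicator (\<Delta> n (f i)) (x i) :: ennreal) = 0"
        by (intro prod_zero) (auto intro!: bexI[of _ i])
      then show ?thesis by (simp only:) simp
    qed
  qed
  also have "\<dots> \<le> 1" using finite_injections by (simp add: sum.delta)
  also have "1 = (\<Prod>i<k. indicator A (x i) :: ennreal)" using True by simp
  finally show ?thesis .
next
  case False
  then obtain j where j: "j < k" "x j \<notin> A" by auto
  then have "(\<Prod>i<k. indicator (\<Delta> n (f i)) (x i) :: ennreal) = 0" for f
    using subsetD[OF \<Delta>_subset, of "x j"] by (intro prod_zero) (auto intro!: bexI[of _ j] simp: indicator_def)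
  then show ?thesis by (simp only: sum.neutral_const) simp
qed

text \<open>The disjoint boxes are summed under the integral before \<open>excess\<close> is
  integrated over all of \<open>A\<close>; hence the error does not depend on the resolution
  \<open>n\<close>.\<close>

lemma cell_sum_expectation:
  assumes k: "1 \<le> k"
  shows "\<bar>(\<integral>w. cell_sum k n w \<partial>M) - mass_sum k n\<bar>
    \<le> fact k * (c * v A ^ (k - 1))"
proof -
  let ?e = "\<lambda>f. (\<integral>w. cell_prod k n f w \<partial>M) - cell_mass k n f"
  let ?i = "\<lambda>f x. \<Prod>i<k. indicator (\<Delta> n (f i)) (x i) :: ennreal"
  have meas: "?i f \<in> borel_measurable (PM k)" for f
  proof (rule borel_measurable_prod_ennreal)
    fix i assume "i \<in> {..<k}"
    then show "(\<lambda>x. indicator (\<Delta> n (f i)) (x i) :: ennreal) \<in> borel_measurable (PM k)"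
      by (intro measurable_compose[OF _ borel_measurable_indicator[OF \<Delta>_sets]]) (auto intro: measurable_component_singleton)
  qed
  have "(\<integral>w. cell_sum k n w \<partial>M) = (\<Sum>f\<in>injections k n. \<integral>w. cell_prod k n f w \<partial>M)"
    unfolding cell_sum_def by (rule Bochner_Integration.integral_sum) (rule cell_product_expectation[OF k])
  then have "\<bar>(\<integral>w. cell_sum k n w \<partial>M) - mass_sum k n\<bar>
      = \<bar>\<Sum>f\<in>injections k n. ?e f\<bar>"
    by (simp only: sum_subtractf)
  also have "\<dots> \<le> (\<Sum>f\<in>injections k n. \<bar>?e f\<bar>)" by (rule sum_abs)
  also have "(\<Sum>f\<in>injections k n. \<bar>?e f\<bar>) \<le> fact k * (c * v A ^ (k - 1))"
  proof -
    have "ennreal (\<Sum>f\<in>injections k n. \<bar>?e f\<bar>) = (\<Sum>f\<in>injections k n. ennreal \<bar>?e f\<bar>)"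
      by (subst sum_ennreal) auto
    also have "\<dots> \<le> (\<Sum>f\<in>injections k n. \<integral>\<^sup>+x. ?i f x * ennreal (excess k x) \<partial>PM k)"
      by (rule sum_mono) (rule cell_product_expectation[OF k])
    also have "\<dots> = (\<integral>\<^sup>+x. (\<Sum>f\<in>injections k n. ?i f x * ennreal (excess k x)) \<partial>PM k)"
      using meas excess_measurable by (intro nn_integral_sum[symmetric]) auto
    also have "\<dots> \<le> (\<integral>\<^sup>+x. ennreal ((\<Prod>i<k. indicator A (x i)) * excess k x) \<partial>PM k)"
    proof (rule nn_integral_mono)
      fix x assume "x \<in> space (PM k)"
      have "(\<Sum>f\<in>injections k n. ?i f x * ennreal (excess k x)) = (\<Sum>f\<in>injections k n. ?i f x) * ennreal (excess k x)"
        by (rule sum_distrib_right[symmetric])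
      also have "\<dots> \<le> (\<Prod>i<k. indicator A (x i)) * ennreal (excess k x)"
        by (rule mult_right_mono[OF sum_indicator_cells_le]) simp
      also have "\<dots> = ennreal ((\<Prod>i<k. indicator A (x i)) * excess k x)"
      proof (cases "\<forall>i<k. x i \<in> A")
        case False
        then obtain j where j: "j < k" "x j \<notin> A" by auto
        then have z: "(\<Prod>i<k. indicator A (x i) :: ennreal) = 0" "(\<Prod>i<k. indicator A (x i) :: real) = 0"
          by (intro prod_zero; auto intro!: bexI[of _ j])+
        show ?thesis by (simp only: z) simp
      qed simp
      finally show "(\<Sum>f\<in>injections k n. ?i f x * ennreal (excess k x)) \<le> ennreal ((\<Prod>i<k. indicator A (x i)) * excess k x)" .
    qed
    also have "\<dots> \<le> ennreal (fact k * (c * v A ^ (k - 1)))" by (rule excess_integral)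
    finally show ?thesis using c_nonneg v_nonneg by (subst (asm) ennreal_le_iff) auto
  qed
  finally show ?thesis .
qed

text \<open>Cell sequences with a repetition have total mass at most a constant multiple of
  \<open>\<delta> n\<close>, so restricting to injective ones costs nothing in the limit.\<close>

lemma sum_prod_v_tendsto:
  "(mass_sum k) \<longlonglongrightarrow> v A ^ k"
proof (rule tendsto_sandwich)
  have \<delta>: "v (\<Delta> n d) \<le> \<delta> n" for n d using cell_small[of n d] by (simp add: v_def \<Delta>_def)
  have \<delta>0: "0 \<le> \<delta> n" for n using \<delta>[of n] v_nonneg order_trans by blast
  show "\<forall>\<^sub>F n in sequentially. v A ^ k - real k ^ 2 * \<delta> n * v A ^ (k - 1) \<le> mass_sum k n"
  proof (intro always_eventually allI)
    fix n
    show "v A ^ k - real k ^ 2 * \<delta> n * v A ^ (k - 1) \<le> mass_sum k n"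
      using sum_injections_prod_ge[of "Q n" "\<delta> n" "\<lambda>d. v (\<Delta> n d)" k] finite_Q \<delta>0 v_nonneg \<delta>
      unfolding v_A injections_def by auto
  qed
  show "\<forall>\<^sub>F n in sequentially. mass_sum k n \<le> v A ^ k"
  proof (intro always_eventually allI)
    fix n
    have "mass_sum k n \<le> (\<Sum>f\<in>{..<k} \<rightarrow>\<^sub>E Q n. cell_mass k n f)"
    proof (rule sum_mono2)
      show "finite ({..<k} \<rightarrow>\<^sub>E Q n)" using finite_PiE[of "{..<k}" "\<lambda>_. Q n"] finite_Q by simp
    qed (auto simp: injections_def intro!: prod_nonneg v_nonneg)
    also have "\<dots> = (\<Prod>i<k. \<Sum>d\<in>Q n. v (\<Delta> n d))" using finite_Q by (subst prod_sum_PiE) auto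
    finally show "mass_sum k n \<le> v A ^ k" by (simp add: v_A)
  qed
  have "(\<lambda>n. v A ^ k - real k ^ 2 * \<delta> n * v A ^ (k - 1)) \<longlonglongrightarrow> v A ^ k - real k ^ 2 * 0 * v A ^ (k - 1)"
    by (intro tendsto_intros \<delta>_tendsto)
  then show "(\<lambda>n. v A ^ k - real k ^ 2 * \<delta> n * v A ^ (k - 1)) \<longlonglongrightarrow> v A ^ k" by simp
qed simp

text \<open>Counts of configurations are integers already; the floor only gives them the type
  \<open>nat\<close>, on which binomial coefficients are defined.\<close>

definition number :: "'p \<Rightarrow> nat" where "number w = nat \<lfloor>measure (\<Xi> w) A\<rfloor>"

text \<open>Simplicity places the finitely many points of \<open>A\<close> at distinct positions, so
  from some resolution on all pairs are separated and the count through cells is exact. Before that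
  it is an undercount.\<close>

lemma cell_sum_pointwise:
  assumes \<xi>: "\<Xi> w \<in> Conf X" and simple: "\<forall>x\<in>X. emeasure (\<Xi> w) {x} \<le> 1"
  shows "cell_sum k n w \<le> fact k * real (number w choose k)"
    and "(\<lambda>n. cell_sum k n w) \<longlonglongrightarrow> fact k * real (number w choose k)"
proof -
  obtain J :: "nat set" and x where J: "finite J" "x \<in> J \<rightarrow> A"
    and em: "\<And>B. B \<in> sets (restrict_space borel X) \<Longrightarrow> B \<subseteq> A \<Longrightarrow> emeasure (\<Xi> w) B = of_nat (card {j\<in>J. x j \<in> B})"
    and me: "\<And>B. B \<in> sets (restrict_space borel X) \<Longrightarrow> B \<subseteq> A \<Longrightarrow> measure (\<Xi> w) B = real (card {j\<in>J. x j \<in> B})"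
    by (rule Conf_local_points[OF \<xi> A]) (rule that)
  have "{j\<in>J. x j \<in> A} = J" using J by auto
  then have number: "number w = card J"
    using me[of A] precompact_BorelD(1)[OF A] by (simp add: number_def)
  \<comment> \<open>Two indices at one position would give a singleton mass at least 2.\<close>
  have inj: "inj_on x J"
  proof (rule inj_onI, rule ccontr)
    fix i j assume ij: "i \<in> J" "j \<in> J" "x i = x j" "i \<noteq> j"
    have xA: "x i \<in> A" "x i \<in> X" using J ij precompact_BorelD(2)[OF A] by auto
    then have "{x i} \<in> sets (restrict_space borel X)"
      by (auto simp: sets_restrict_space intro!: image_eqI[of _ _ "{x i}"])
    then have "of_nat (card {l\<in>J. x l \<in> {x i}}) \<le> (1::ennreal)"
      using em[of "{x i}"] simple xA by auto
    then have "card {l\<in>J. x l \<in> {x i}} \<le> 1" by (metis of_nat_1 of_nat_le_iff)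
    moreover have "card {i, j} \<le> card {l\<in>J. x l \<in> {x i}}" using ij J by (intro card_mono) auto
    ultimately show False using ij by simp
  qed
  have cells: "cell_sum k n w = (\<Sum>f\<in>{f\<in>{..<k} \<rightarrow>\<^sub>E Q n. inj_on f {..<k}}. \<Prod>i<k. real (card {j\<in>J. (cell n \<circ> x) j = f i}))" for n
  proof -
    have "measure (\<Xi> w) (\<Delta> n d) = real (card {j\<in>J. (cell n \<circ> x) j = d})" for d
    proof -
      have "{j\<in>J. x j \<in> \<Delta> n d} = {j\<in>J. (cell n \<circ> x) j = d}" using J by (auto simp: \<Delta>_def)
      then show ?thesis using me[OF precompact_BorelD(1)[OF \<Delta>_precompact] \<Delta>_subset] by simp
    qed
    then show ?thesis by (simp add: cell_sum_def injections_def)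
  qed
  have range: "cell n \<circ> x \<in> J \<rightarrow> Q n" for n using J(2) cell_Q by (auto simp: Pi_iff)
  show "cell_sum k n w \<le> fact k * real (number w choose k)"
    unfolding cells number by (rule sum_injections_prod_card_le[OF J(1) finite_Q range])
  have "\<forall>\<^sub>F n in sequentially. \<forall>i\<in>J. \<forall>j\<in>J. i \<noteq> j \<longrightarrow> cell n (x i) \<noteq> cell n (x j)"
  proof (intro eventually_ball_finite J ballI)
    fix i j assume ij: "i \<in> J" "j \<in> J"
    show "\<forall>\<^sub>F n in sequentially. i \<noteq> j \<longrightarrow> cell n (x i) \<noteq> cell n (x j)"
    proof (cases "i = j")
      case False
      then have "x i \<noteq> x j" using inj ij by (auto simp: inj_on_def)
      then show ?thesis using cell_separates[of "x i" "x j"] J ij by (auto elim: eventually_mono)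
    qed simp
  qed
  then have "\<forall>\<^sub>F n in sequentially. fact k * real (number w choose k) = cell_sum k n w"
  proof eventually_elim
    case (elim n)
    then have "inj_on (cell n \<circ> x) J" by (auto simp: inj_on_def)
    then show ?case unfolding cells number
      by (rule sum_injections_prod_card_eq[OF J(1) finite_Q range, symmetric])
  qed
  then show "(\<lambda>n. cell_sum k n w) \<longlonglongrightarrow> fact k * real (number w choose k)"
    by (rule Lim_transform_eventually[OF tendsto_const])
qed

text \<open>Measurability is read off from the integrability clause of the determinantal identity at
  \<open>k = 1\<close>, which bypasses an analysis of the vague sigma-algebra.\<close>

lemma measure_A_measurable: "(\<lambda>w. measure (\<Xi> w) A) \<in> borel_measurable M"
proof -
  have "integrable M (\<lambda>w. \<Prod>i<Suc 0. measure (\<Xi> w) ((\<lambda>_. A) i))"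
    using determinantal_processD[OF determinantal, of "Suc 0" "\<lambda>_. A"] A
    by (simp add: disjoint_family_on_def)
  then show ?thesis by simp
qed

text \<open>The error bound at resolution \<open>n\<close> is uniform in \<open>n\<close>, so it
  survives the refinement of the partition once the expectations are known to converge.\<close>

theorem factorial_moment:
  assumes k: "1 \<le> k"
  shows "integrable M (\<lambda>w. fact k * real (number w choose k))"
    and "\<bar>(\<integral>w. fact k * real (number w choose k) \<partial>M) - v A ^ k\<bar> \<le> fact k * (c * v A ^ (k - 1))"
proof -
  let ?Y = "\<lambda>w. fact k * real (number w choose k)" and ?err = "fact k * (c * v A ^ (k - 1))"
  have pp: "point_process M X \<Xi>" and simple: "AE w in M. \<forall>x\<in>X. emeasure (\<Xi> w) {x} \<le> 1"
    using determinantal by (auto simp: determinantal_process_def simple_point_process_def)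
  have good: "AE w in M. \<Xi> w \<in> Conf X \<and> (\<forall>x\<in>X. emeasure (\<Xi> w) {x} \<le> 1)"
    using simple AE_space by eventually_elim (auto intro: point_process_Conf[OF pp])
  note [measurable] = measure_A_measurable
  have Y_meas [measurable]: "?Y \<in> borel_measurable M" unfolding number_def by measurable
  have lim: "AE w in M. (\<lambda>n. cell_sum k n w) \<longlonglongrightarrow> ?Y w"
    using good by eventually_elim (auto intro: cell_sum_pointwise)
  have cs0: "0 \<le> cell_sum k n w" for n w
    unfolding cell_sum_def by (intro sum_nonneg prod_nonneg) auto
  have cs_meas [measurable]: "cell_sum k n \<in> borel_measurable M" for n
    using cell_sum_integrable[OF k] by blast
  have bound: "\<bar>(\<integral>w. cell_sum k n w \<partial>M) - mass_sum k n\<bar> \<le> ?err" for n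
    by (rule cell_sum_expectation[OF k])
  have "(\<integral>\<^sup>+w. ennreal (?Y w) \<partial>M) = (\<integral>\<^sup>+w. liminf (\<lambda>n. ennreal (cell_sum k n w)) \<partial>M)"
  proof (rule nn_integral_cong_AE)
    show "AE w in M. ennreal (?Y w) = liminf (\<lambda>n. ennreal (cell_sum k n w))"
      using lim by eventually_elim (rule lim_imp_Liminf[symmetric], auto intro: tendsto_ennrealI)
  qed
  \<comment> \<open>Fatou's lemma comes first, since it yields the integrability of the limit from
    the uniform bound on the approximating expectations.\<close>
  also have "\<dots> \<le> liminf (\<lambda>n. \<integral>\<^sup>+w. ennreal (cell_sum k n w) \<partial>M)"
    by (rule nn_integral_liminf) measurable
  also have "\<dots> = liminf (\<lambda>n. ennreal (\<integral>w. cell_sum k n w \<partial>M))"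
    by (subst nn_integral_eq_integral[OF cell_sum_integrable[OF k]]) (auto simp: cs0)
  also have "\<dots> \<le> liminf (\<lambda>n. ennreal (mass_sum k n + ?err))"
    by (intro Liminf_mono always_eventually allI ennreal_leI) (use bound in \<open>smt (verit)\<close>)
  also have "\<dots> = ennreal (v A ^ k + ?err)"
    by (intro lim_imp_Liminf tendsto_ennrealI tendsto_intros sum_prod_v_tendsto) auto
  finally have "(\<integral>\<^sup>+w. ennreal (?Y w) \<partial>M) < \<infinity>" using le_less_trans ennreal_less_top by fastforce
  then show int: "integrable M ?Y" by (intro integrableI_nonneg) auto
  \<comment> \<open>The limit, now known to be integrable, itself dominates every
    approximation.\<close>
  have "(\<lambda>n. \<integral>w. cell_sum k n w \<partial>M) \<longlonglongrightarrow> (\<integral>w. ?Y w \<partial>M)"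
  proof (rule integral_dominated_convergence[OF _ _ int])
    show "AE w in M. norm (cell_sum k n w) \<le> ?Y w" for n
      using good by eventually_elim (use cs0 cell_sum_pointwise(1) in auto)
  qed (use lim in auto)
  then have "(\<lambda>n. \<bar>(\<integral>w. cell_sum k n w \<partial>M) - mass_sum k n\<bar>)
      \<longlonglongrightarrow> \<bar>(\<integral>w. ?Y w \<partial>M) - v A ^ k\<bar>"
    by (intro tendsto_intros sum_prod_v_tendsto)
  then show "\<bar>(\<integral>w. ?Y w \<partial>M) - v A ^ k\<bar> \<le> ?err"
    by (rule LIMSEQ_le_const2) (use bound in auto)
qed

end

section \<open>The hyperbolic kernel\<close>

lemma lborel_complex: "lborel = distr (lborel \<Otimes>\<^sub>M lborel) borel (\<lambda>(x, y). Complex x y)"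
proof (rule lborel_eqI)
  fix l u :: complex assume lu: "\<And>b. b \<in> Basis \<Longrightarrow> l \<bullet> b \<le> u \<bullet> b"
  then have le: "Re l \<le> Re u" "Im l \<le> Im u"
    using lu[of 1] lu[of \<i>] by (auto simp: Basis_complex_def)
  have "(\<lambda>(x, y). Complex x y) \<in> borel_measurable (lborel \<Otimes>\<^sub>M lborel)"
    by (simp add: lborel_prod) (intro borel_measurable_continuous_onI continuous_intros, simp add: case_prod_beta' Complex_eq continuous_intros)
  moreover have "(\<lambda>(x, y). Complex x y) -` box l u \<inter> space (lborel \<Otimes>\<^sub>M lborel)
      = {Re l<..<Re u} \<times> {Im l<..<Im u}"
    by (auto simp: in_box_complex_iff space_pair_measure)
  ultimately show "emeasure (distr (lborel \<Otimes>\<^sub>M lborel) borel (\<lambda>(x, y). Complex x y)) (box l u)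
      = ennreal (prod ((\<bullet>) (u - l)) Basis)"
    using le by (simp add: emeasure_distr lborel.emeasure_pair_measure_Times ennreal_mult Basis_complex_def)
qed simp

lemma emeasure_lborel_complex:
  assumes [measurable]: "S \<in> sets borel"
  shows "emeasure lborel S = (\<integral>\<^sup>+y. emeasure lborel {x. Complex x y \<in> S} \<partial>lborel)"
    and "emeasure lborel S = (\<integral>\<^sup>+x. emeasure lborel {y. Complex x y \<in> S} \<partial>lborel)"
proof -
  have [measurable]: "(\<lambda>(x, y). Complex x y) \<in> borel_measurable (lborel \<Otimes>\<^sub>M lborel)"
    by (simp add: lborel_prod) (intro borel_measurable_continuous_onI continuous_intros, simp add: case_prod_beta' Complex_eq continuous_intros)
  let ?T = "(\<lambda>(x, y). Complex x y) -` S \<inter> space (lborel \<Otimes>\<^sub>M lborel)"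
  have S: "emeasure lborel S = emeasure (lborel \<Otimes>\<^sub>M lborel) ?T"
    by (subst lborel_complex) (simp add: emeasure_distr)
  have T: "?T \<in> sets (lborel \<Otimes>\<^sub>M lborel)" by measurable
  have "(\<lambda>x. (x, y)) -` ?T = {x. Complex x y \<in> S}" "Pair x -` ?T = {y. Complex x y \<in> S}" for x y
    by (auto simp: space_pair_measure)
  then show "emeasure lborel S = (\<integral>\<^sup>+y. emeasure lborel {x. Complex x y \<in> S} \<partial>lborel)"
    "emeasure lborel S = (\<integral>\<^sup>+x. emeasure lborel {y. Complex x y \<in> S} \<partial>lborel)"
    using lborel_pair.emeasure_pair_measure_alt2[OF T] lborel.emeasure_pair_measure_alt[OF T] S by simp_all
qed

lemma emeasure_lborel_diameter_le:
  fixes T :: "real set"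
  assumes T: "T \<in> sets borel" and d: "\<And>x x'. x \<in> T \<Longrightarrow> x' \<in> T \<Longrightarrow> \<bar>x - x'\<bar> \<le> d"
  shows "emeasure lborel T \<le> ennreal (2 * d)"
proof (cases "T = {}")
  case False
  then obtain x0 where x0: "x0 \<in> T" by blast
  have "T \<subseteq> {x0 - d..x0 + d}" using d[OF _ x0] by (fastforce simp: abs_le_iff)
  then have "emeasure lborel T \<le> emeasure lborel {x0 - d..x0 + d}" by (intro emeasure_mono) auto
  moreover have "0 \<le> d" using d[OF x0 x0] by simp
  ultimately show ?thesis by simp
qed simp

text \<open>Away from 0 squaring expands distances by at least 2/3, so on each half-line the slice
  has diameter at most 3/2 (t - s). The crude measure bound by twice the diameter and the two signs
  give 6 = 2 * 2 * 3/2.\<close>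

lemma emeasure_ring_slice_le:
  assumes "s \<le> t"
  shows "emeasure lborel {x::real. 1/3 \<le> \<bar>x\<bar> \<and> s \<le> x^2 \<and> x^2 < t} \<le> ennreal (6 * (t - s))"
proof -
  let ?P = "{x::real. 1/3 \<le> x \<and> s \<le> x^2 \<and> x^2 < t}" and ?N = "{x::real. x \<le> - (1/3) \<and> s \<le> x^2 \<and> x^2 < t}"
  have [measurable]: "?P \<in> sets borel" "?N \<in> sets borel" by measurable
  have key: "\<bar>x - x'\<bar> \<le> 3/2 * (t - s)"
    if "1/3 \<le> x" "1/3 \<le> x'" "s \<le> x^2" "x^2 < t" "s \<le> x'^2" "x'^2 < t" for x x' :: real
  proof -
    have "\<bar>x - x'\<bar> * (2/3) \<le> \<bar>x - x'\<bar> * (x + x')" using that by (intro mult_left_mono) auto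
    also have "\<dots> = \<bar>(x - x') * (x + x')\<bar>" using that by (simp add: abs_mult)
    also have "\<dots> = \<bar>x^2 - x'^2\<bar>" by (simp add: power2_eq_square algebra_simps)
    also have "\<dots> \<le> t - s" using that by (auto simp: abs_le_iff)
    finally show ?thesis by simp
  qed
  have "{x::real. 1/3 \<le> \<bar>x\<bar> \<and> s \<le> x^2 \<and> x^2 < t} = ?P \<union> ?N" by (auto simp: abs_if)
  then have "emeasure lborel {x::real. 1/3 \<le> \<bar>x\<bar> \<and> s \<le> x^2 \<and> x^2 < t} \<le> emeasure lborel ?P + emeasure lborel ?N"
    by (simp add: emeasure_subadditive)
  also have "\<dots> \<le> ennreal (2 * (3/2 * (t - s))) + ennreal (2 * (3/2 * (t - s)))"
  proof (intro add_mono emeasure_lborel_diameter_le)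
    fix x x' assume "x \<in> ?N" "x' \<in> ?N"
    then show "\<bar>x - x'\<bar> \<le> 3/2 * (t - s)" using key[of "- x" "- x'"] by (simp add: abs_minus_commute)
  next
    fix x x' assume "x \<in> ?P" "x' \<in> ?P"
    then show "\<bar>x - x'\<bar> \<le> 3/2 * (t - s)" using key[of x x'] by simp
  qed auto
  also have "\<dots> = ennreal (6 * (t - s))" using assms by (simp flip: ennreal_plus)
  finally show ?thesis .
qed

text \<open>A point of modulus at least 2/3 has a coordinate of absolute value at least 1/3, because
  the absolute values of the coordinates add up to at least the modulus. Slicing along that
  coordinate crosses the ring transversally: each slice has length at most 6 (s^2 - r^2), and the
  other coordinate ranges over an interval of length 2 \<delta>. The two cases together give
  24.\<close>

lemma emeasure_ring_square_le:
  assumes r: "2/3 \<le> r" "r \<le> s" and \<delta>: "0 \<le> \<delta>"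
  shows "emeasure lborel {w::complex. r \<le> cmod w \<and> cmod w < s \<and> \<bar>Re w - a\<bar> < \<delta> \<and> \<bar>Im w - b\<bar> < \<delta>}
    \<le> ennreal (24 * \<delta> * (s^2 - r^2))"
proof -
  let ?S1 = "{w::complex. 1/3 \<le> \<bar>Re w\<bar> \<and> r \<le> cmod w \<and> cmod w < s \<and> \<bar>Im w - b\<bar> < \<delta>}"
  let ?S2 = "{w::complex. 1/3 \<le> \<bar>Im w\<bar> \<and> r \<le> cmod w \<and> cmod w < s \<and> \<bar>Re w - a\<bar> < \<delta>}"
  have rs: "r^2 \<le> s^2" using r by (intro power_mono) auto
  have [measurable]: "Re \<in> borel_measurable borel" "Im \<in> borel_measurable borel"
    by (intro borel_measurable_continuous_onI continuous_intros)+
  have S [measurable]: "?S1 \<in> sets borel" "?S2 \<in> sets borel" by measurable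
  have norm_iff: "r \<le> cmod (Complex x y) \<longleftrightarrow> r^2 \<le> x^2 + y^2" "cmod (Complex x y) < s \<longleftrightarrow> x^2 + y^2 < s^2" for x y
  proof -
    show "r \<le> cmod (Complex x y) \<longleftrightarrow> r^2 \<le> x^2 + y^2"
      using power_mono_iff[of r "cmod (Complex x y)" 2] r by (simp add: cmod_power2)
    show "cmod (Complex x y) < s \<longleftrightarrow> x^2 + y^2 < s^2"
      using power_mono_iff[of s "cmod (Complex x y)" 2] r by (simp add: cmod_power2 flip: not_le)
  qed
  have slice: "emeasure lborel {x::real. 1/3 \<le> \<bar>x\<bar> \<and> r^2 - y^2 \<le> x^2 \<and> x^2 < s^2 - y^2} \<le> ennreal (6 * (s^2 - r^2))" for y
    using emeasure_ring_slice_le[of "r^2 - y^2" "s^2 - y^2"] rs by simp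
  have strip: "(\<integral>\<^sup>+y. emeasure lborel (T y) \<partial>lborel) \<le> ennreal (12 * \<delta> * (s^2 - r^2))"
    if T: "\<And>y. \<bar>y - b\<bar> < \<delta> \<Longrightarrow> T y = {x. 1/3 \<le> \<bar>x\<bar> \<and> r^2 - y^2 \<le> x^2 \<and> x^2 < s^2 - y^2}"
      "\<And>y. \<not> \<bar>y - b\<bar> < \<delta> \<Longrightarrow> T y = {}" for b :: real and T :: "real \<Rightarrow> real set"
  proof -
    have eq: "{y. \<bar>y - b\<bar> < \<delta>} = {b - \<delta><..<b + \<delta>}" by auto
    have "(\<integral>\<^sup>+y. emeasure lborel (T y) \<partial>lborel) \<le> (\<integral>\<^sup>+y. ennreal (6 * (s^2 - r^2)) * indicator {y. \<bar>y - b\<bar> < \<delta>} y \<partial>lborel)"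
    proof (rule nn_integral_mono)
      fix y show "emeasure lborel (T y) \<le> ennreal (6 * (s^2 - r^2)) * indicator {y. \<bar>y - b\<bar> < \<delta>} y"
        using slice[of y] T by (cases "\<bar>y - b\<bar> < \<delta>") simp_all
    qed
    also have "\<dots> = ennreal (6 * (s^2 - r^2)) * emeasure lborel {b - \<delta><..<b + \<delta>}"
      unfolding eq by (rule nn_integral_cmult_indicator) simp
    also have "emeasure lborel {b - \<delta><..<b + \<delta>} = ennreal (2 * \<delta>)" using \<delta> by simp
    also have "ennreal (6 * (s^2 - r^2)) * ennreal (2 * \<delta>) = ennreal (12 * \<delta> * (s^2 - r^2))"
      using \<delta> rs by (subst ennreal_mult[symmetric]) (auto simp: algebra_simps)
    finally show ?thesis .
  qed
  have 1: "emeasure lborel ?S1 \<le> ennreal (12 * \<delta> * (s^2 - r^2))"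
    unfolding emeasure_lborel_complex(1)[OF S(1)] by (rule strip[of b]) (auto simp: norm_iff)
  have 2: "emeasure lborel ?S2 \<le> ennreal (12 * \<delta> * (s^2 - r^2))"
    unfolding emeasure_lborel_complex(2)[OF S(2)] by (rule strip[of a]) (auto simp: norm_iff)
  have "{w::complex. r \<le> cmod w \<and> cmod w < s \<and> \<bar>Re w - a\<bar> < \<delta> \<and> \<bar>Im w - b\<bar> < \<delta>} \<subseteq> ?S1 \<union> ?S2"
  proof clarsimp
    fix w assume "r \<le> cmod w" "\<not> 1 \<le> \<bar>Im w\<bar> * 3"
    then show "1 \<le> \<bar>Re w\<bar> * 3" using cmod_le[of w] r by linarith
  qed
  then have "emeasure lborel {w::complex. r \<le> cmod w \<and> cmod w < s \<and> \<bar>Re w - a\<bar> < \<delta> \<and> \<bar>Im w - b\<bar> < \<delta>}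
      \<le> emeasure lborel (?S1 \<union> ?S2)" by (intro emeasure_mono) auto
  also have "\<dots> \<le> emeasure lborel ?S1 + emeasure lborel ?S2" by (intro emeasure_subadditive) auto
  also have "\<dots> \<le> ennreal (12 * \<delta> * (s^2 - r^2)) + ennreal (12 * \<delta> * (s^2 - r^2))" using 1 2 by (rule add_mono)
  also have "\<dots> = ennreal (24 * \<delta> * (s^2 - r^2))" using \<delta> rs by (simp flip: ennreal_plus)
  finally show ?thesis .
qed

lemma emeasure_ring:
  assumes "0 \<le> r" "r \<le> s"
  shows "emeasure lborel {w::complex. r \<le> cmod w \<and> cmod w < s} = ennreal (pi * (s^2 - r^2))"
proof -
  have "{w::complex. r \<le> cmod w \<and> cmod w < s} = ball 0 s - ball 0 r" by auto
  moreover have "emeasure lborel (ball 0 s - ball 0 r :: complex set) = emeasure lborel (ball 0 s :: complex set) - emeasure lborel (ball 0 r :: complex set)"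
    using assms emeasure_lborel_ball_finite[of "0::complex" r] by (intro emeasure_Diff) auto
  moreover have "emeasure lborel (ball 0 t :: complex set) = ennreal (pi * t^2)" if "0 \<le> t" for t
    using emeasure_ball[of t "0::complex"] that by (simp add: unit_ball_vol_2)
  ultimately show ?thesis using assms by (simp add: ennreal_minus algebra_simps)
qed


section \<open>The normalised weighted Bergman kernel\<close>

definition q_hyp :: "real \<Rightarrow> complex \<Rightarrow> real" where
  "q_hyp \<alpha> z = (1 - (cmod z)^2) powr (- ((\<alpha> + 1) / 2))"

text \<open>The base of the power is 1 minus the squared pseudo-hyperbolic distance of
  \<open>z\<close> and \<open>w\<close>.\<close>

definition k_hyp :: "real \<Rightarrow> complex \<Rightarrow> complex \<Rightarrow> real" where
  "k_hyp \<alpha> z w = ((1 - (cmod z)^2) * (1 - (cmod w)^2) / (cmod (1 - z * cnj w))^2) powr ((\<alpha> + 1) / 2)"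

text \<open>The density of \<open>K(z, z) d\<mu>\<close> with respect to Lebesgue measure. The
  exponents \<alpha> - 1 of the weight and -(\<alpha> + 1) of the kernel add up to -2, so for every
  \<alpha> it is a multiple of the hyperbolic area density.\<close>

definition hyp_density :: "real \<Rightarrow> complex \<Rightarrow> real" where
  "hyp_density \<alpha> z = \<alpha> / pi / (1 - (cmod z)^2)^2"

text \<open>Both properties of the normalised kernel come from this identity: dropping the distance
  term gives the bound 1, keeping it gives smallness away from the diagonal.\<close>

lemma cmod_one_minus_mult_cnj:
  "(cmod (1 - z * cnj w))^2 = (cmod (z - w))^2 + (1 - (cmod z)^2) * (1 - (cmod w)^2)"
  unfolding cmod_power2 by (simp add: power2_eq_square algebra_simps)

lemma unit_disc_pos: "z \<in> unit_disc \<Longrightarrow> 0 < 1 - (cmod z)^2"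
  using power_strict_mono[of "cmod z" 1 2] by simp

lemma k_hyp_base_le_1:
  assumes "z \<in> unit_disc" "w \<in> unit_disc"
  shows "(1 - (cmod z)^2) * (1 - (cmod w)^2) / (cmod (1 - z * cnj w))^2 \<le> 1"
proof -
  have "0 < (1 - (cmod z)^2) * (1 - (cmod w)^2)"
    using unit_disc_pos[OF assms(1)] unit_disc_pos[OF assms(2)] by (rule mult_pos_pos)
  then show ?thesis by (subst divide_le_eq_1_pos) (auto simp: cmod_one_minus_mult_cnj add_nonneg_pos)
qed

lemma k_hyp_nonneg: "0 \<le> k_hyp \<alpha> z w"
  by (simp add: k_hyp_def)

lemma k_hyp_le_1:
  assumes "z \<in> unit_disc" "w \<in> unit_disc" "0 < \<alpha>"
  shows "k_hyp \<alpha> z w \<le> 1"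
  unfolding k_hyp_def using k_hyp_base_le_1[OF assms(1,2)] unit_disc_pos[OF assms(1)] unit_disc_pos[OF assms(2)] assms(3)
  by (intro powr_le1) auto

text \<open>The base is at most 1 and the exponent at least 1/2, so the power is bounded by a square
  root; this makes the estimate the same for all positive \<alpha>.\<close>

lemma k_hyp_le:
  assumes zw: "z \<in> unit_disc" "w \<in> unit_disc" and \<alpha>: "0 < \<alpha>" and \<delta>: "0 < \<delta>" "\<delta> \<le> cmod (z - w)"
    and e: "1 - (cmod z)^2 \<le> e" "1 - (cmod w)^2 \<le> e"
  shows "k_hyp \<alpha> z w \<le> e / \<delta>"
proof -
  let ?x = "1 - (cmod z)^2" and ?y = "1 - (cmod w)^2"
  let ?t = "?x * ?y / (cmod (1 - z * cnj w))^2"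
  have pos: "0 < ?x" "0 < ?y" using zw unit_disc_pos by auto
  have "\<delta>^2 \<le> (cmod (z - w))^2" using \<delta> by (intro power_mono) auto
  then have d: "\<delta>^2 \<le> (cmod (1 - z * cnj w))^2" using pos by (simp add: cmod_one_minus_mult_cnj add_increasing2)
  have d0: "0 < \<delta>^2" using \<delta> by simp
  have "?x * ?y \<le> e * e" using e pos by (intro mult_mono) auto
  then have "?t \<le> e^2 / \<delta>^2" using d d0 pos by (intro frac_le) (auto simp: power2_eq_square)
  then have t: "?t \<le> (e / \<delta>)^2" by (simp add: power_divide)
  have t0: "0 < ?t" using pos d d0 by (intro divide_pos_pos mult_pos_pos) linarith+
  have "k_hyp \<alpha> z w \<le> ?t powr (1/2)"
    unfolding k_hyp_def using t0 k_hyp_base_le_1[OF zw] \<alpha> by (intro powr_mono') auto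
  also have "\<dots> = sqrt ?t" using t0 by (simp add: powr_half_sqrt)
  also have "\<dots> \<le> sqrt ((e / \<delta>)^2)" using t by (rule real_sqrt_le_mono)
  also have "\<dots> = e / \<delta>" using pos e \<delta> by simp
  finally show ?thesis .
qed

text \<open>For a real exponent the argument of \<open>u\<close> affects only the phase, so the
  modulus of the kernel is independent of the branch.\<close>

lemma cmod_powr_of_real: "u \<noteq> 0 \<Longrightarrow> cmod (u powr complex_of_real s) = cmod u powr s"
  by (simp add: powr_def)

lemma q_hyp_squared: "(q_hyp \<alpha> z)^2 = (1 - (cmod z)^2) powr (- (\<alpha> + 1))"
proof -
  have "- ((\<alpha> + 1) / 2) + - ((\<alpha> + 1) / 2) = - (\<alpha> + 1)" by (simp add: field_simps)
  then show ?thesis unfolding q_hyp_def power2_eq_square by (metis powr_add)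
qed

lemma K_hyp_diag:
  assumes "z \<in> unit_disc"
  shows "K_hyp \<alpha> z z = complex_of_real ((q_hyp \<alpha> z)^2)"
proof -
  have "1 - z * cnj z = complex_of_real (1 - (cmod z)^2)" by (simp add: complex_norm_square[symmetric])
  then show ?thesis
    unfolding K_hyp_def q_hyp_squared using unit_disc_pos[OF assms]
    by (metis less_imp_le of_real_minus powr_of_real)
qed

lemma norm_K_hyp:
  assumes zw: "z \<in> unit_disc" "w \<in> unit_disc"
  shows "cmod (K_hyp \<alpha> z w) = q_hyp \<alpha> z * q_hyp \<alpha> w * k_hyp \<alpha> z w"
proof -
  let ?x = "1 - (cmod z)^2" and ?y = "1 - (cmod w)^2" and ?a = "cmod (1 - z * cnj w)"
  define p s where "p = (\<alpha> + 1) / 2" and "s = \<alpha> + 1"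
  have pos: "0 < ?x" "0 < ?y" using zw unit_disc_pos by auto
  then have "0 < ?a^2" by (simp add: cmod_one_minus_mult_cnj add_nonneg_pos)
  then have a: "0 < ?a" by simp
  have "k_hyp \<alpha> z w = ?x powr p * ?y powr p / (?a^2) powr p"
    unfolding k_hyp_def p_def[symmetric] using pos a by (simp add: powr_divide powr_mult)
  also have "(?a^2) powr p = ?a powr s"
    using a by (simp add: power2_eq_square powr_mult p_def s_def flip: powr_add)
  finally have "q_hyp \<alpha> z * q_hyp \<alpha> w * k_hyp \<alpha> z w = ?a powr (- s)"
    unfolding q_hyp_def p_def[symmetric] using pos a by (simp add: powr_minus field_simps)
  moreover have "cmod (K_hyp \<alpha> z w) = ?a powr (- s)"
    unfolding K_hyp_def of_real_minus[symmetric] s_def using a by (intro cmod_powr_of_real) auto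
  ultimately show ?thesis by simp
qed

lemma q_hyp_measurable [measurable]: "q_hyp \<alpha> \<in> borel_measurable borel"
  unfolding q_hyp_def by measurable

lemma hyp_density_measurable [measurable]: "hyp_density \<alpha> \<in> borel_measurable borel"
  unfolding hyp_density_def by measurable

lemma k_hyp_measurable: "(\<lambda>(z, w). k_hyp \<alpha> z w) \<in> borel_measurable (borel \<Otimes>\<^sub>M borel)"
proof -
  have [measurable]: "cnj \<in> borel_measurable borel"
    by (intro borel_measurable_continuous_onI continuous_intros)
  show ?thesis unfolding k_hyp_def by measurable
qed

lemma sets_mu_hyp: "sets (mu_hyp \<alpha>) = sets (restrict_space borel unit_disc)"
  unfolding mu_hyp_def by (simp add: sets_restrict_space)

lemma sigma_finite_mu_hyp: "sigma_finite_measure (mu_hyp \<alpha>)"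
proof -
  have "sigma_finite_measure (restrict_space lborel unit_disc)"
    by (intro sigma_finite_measure_restrict_space) (auto intro: lborel.sigma_finite_measure_axioms)
  then show ?thesis unfolding mu_hyp_def
    by (subst sigma_finite_measure.sigma_finite_iff_density_finite) (auto intro!: measurable_restrict_space1)
qed

lemma borel_measurable_mu_hyp: "f \<in> borel_measurable borel \<Longrightarrow> f \<in> borel_measurable (mu_hyp \<alpha>)"
  unfolding measurable_cong_sets[OF sets_mu_hyp refl] by (rule measurable_restrict_space1)

lemma nn_integral_mu_hyp:
  fixes f :: "complex \<Rightarrow> real"
  assumes \<alpha>: "0 < \<alpha>" and [measurable]: "f \<in> borel_measurable borel" "B \<in> sets borel"
    and B: "B \<subseteq> unit_disc" and f: "\<And>z. 0 \<le> f z"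
  shows "(\<integral>\<^sup>+z. ennreal (indicator B z * (q_hyp \<alpha> z)^2 * f z) \<partial>mu_hyp \<alpha>)
       = (\<integral>\<^sup>+z. ennreal (indicator B z * hyp_density \<alpha> z * f z) \<partial>lborel)"
proof -
  let ?d = "\<lambda>z. \<alpha> / pi * (1 - (cmod z)^2) powr (\<alpha> - 1)"
  have "(\<integral>\<^sup>+z. ennreal (indicator B z * (q_hyp \<alpha> z)^2 * f z) \<partial>mu_hyp \<alpha>)
      = (\<integral>\<^sup>+z. ennreal (?d z) * ennreal (indicator B z * (q_hyp \<alpha> z)^2 * f z) \<partial>restrict_space lborel unit_disc)"
    unfolding mu_hyp_def by (intro nn_integral_density measurable_restrict_space1) measurable
  also have "\<dots> = (\<integral>\<^sup>+z. ennreal (?d z) * ennreal (indicator B z * (q_hyp \<alpha> z)^2 * f z) * indicator unit_disc z \<partial>lborel)"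
    by (rule nn_integral_restrict_space) simp
  also have "\<dots> = (\<integral>\<^sup>+z. ennreal (indicator B z * hyp_density \<alpha> z * f z) \<partial>lborel)"
  proof (rule nn_integral_cong)
    fix z
    show "ennreal (?d z) * ennreal (indicator B z * (q_hyp \<alpha> z)^2 * f z) * indicator unit_disc z
        = ennreal (indicator B z * hyp_density \<alpha> z * f z)"
    proof (cases "z \<in> B")
      case True
      then have z: "z \<in> unit_disc" using B by auto
      let ?x = "1 - (cmod z)^2"
      have x: "0 < ?x" using unit_disc_pos[OF z] .
      have "?x powr (\<alpha> - 1) * ?x powr (- (\<alpha> + 1)) = ?x powr (- 2)" by (simp flip: powr_add)
      also have "\<dots> = 1 / ?x^2" using x by (simp add: powr_minus_divide powr_numeral)
      finally have "?d z * (q_hyp \<alpha> z)^2 = hyp_density \<alpha> z"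
        unfolding q_hyp_squared hyp_density_def by (simp add: mult.assoc)
      then have "?d z * ((q_hyp \<alpha> z)^2 * f z) = hyp_density \<alpha> z * f z" by (simp only: mult.assoc[symmetric])
      then show ?thesis using True z \<alpha> f by (simp add: ennreal_mult'[symmetric])
    qed simp
  qed
  finally show ?thesis .
qed

section \<open>Thin hyperbolic shells\<close>

text \<open>This is tanh(\<rho> / 2), the Euclidean radius of the circle of hyperbolic radius \<rho>
  around 0.\<close>

definition hyp_radius :: "real \<Rightarrow> real" where "hyp_radius \<rho> = (exp \<rho> - 1) / (exp \<rho> + 1)"

abbreviation shell_radius :: "real \<Rightarrow> real \<Rightarrow> real" where
  "shell_radius R x \<equiv> hyp_radius (R + x * exp (- R))"

lemma one_minus_hyp_radius_squared:
  "1 - (hyp_radius \<rho>)^2 = 4 * exp (- \<rho>) / (1 + exp (- \<rho>))^2"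
proof -
  have pos: "1 + exp \<rho> > 0" by (simp add: add_pos_pos)
  have eq: "hyp_radius \<rho> = 1 - 2 / (1 + exp \<rho>)" using pos by (simp add: hyp_radius_def field_simps)
  have "1 - (hyp_radius \<rho>)^2 = 4 * exp \<rho> / (1 + exp \<rho>)^2"
  proof -
    have "1 - (1 - 2 / u)^2 = 4 * (u - 1) / u^2" if "0 < u" for u :: real
      using that by (simp add: field_simps power2_eq_square)
    from this[OF pos] show ?thesis unfolding eq by simp
  qed
  also have "exp \<rho> = 1 / exp (- \<rho>)" by (simp add: exp_minus field_simps)
  finally show ?thesis by (simp add: field_simps power2_eq_square)
qed

text \<open>The small variable exp(-\<rho>) makes the ratio rational and isolates the difference of
  its values at \<open>a\<close> and \<open>b\<close>. The radius in the denominator is left free so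
  that the density can be evaluated at either edge of the ring.\<close>

lemma hyp_radius_ratio:
  fixes a b c R :: real
  defines "t x \<equiv> exp (- (R + x * exp (- R)))"
  shows "((shell_radius R b)^2 - (shell_radius R a)^2) / (1 - (shell_radius R c)^2)^2
   = (t a - t b) * (1 - t a * t b) * (1 + t c) ^ 4 / ((1 + t a)^2 * (1 + t b)^2 * 4 * (t c)^2)"
proof -
  have pos: "0 < t x" for x by (simp add: t_def)
  have g: "1 - (shell_radius R x)^2 = 4 * t x / (1 + t x)^2" for x
    unfolding one_minus_hyp_radius_squared t_def ..
  have "(shell_radius R b)^2 - (shell_radius R a)^2 = 4 * t a / (1 + t a)^2 - 4 * t b / (1 + t b)^2"
    using g[of a] g[of b] by linarith
  also have "\<dots> = 4 * ((t a - t b) * (1 - t a * t b)) / ((1 + t a)^2 * (1 + t b)^2)"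
  proof -
    have nz: "(1 + t a)^2 \<noteq> 0" "(1 + t b)^2 \<noteq> 0" using pos[of a] pos[of b] by (auto simp: add_pos_pos add_eq_0_iff)
    show ?thesis unfolding diff_frac_eq[OF nz] by (simp add: power2_eq_square algebra_simps)
  qed
  finally have *: "(shell_radius R b)^2 - (shell_radius R a)^2 = 4 * ((t a - t b) * (1 - t a * t b)) / ((1 + t a)^2 * (1 + t b)^2)" .
  have **: "4 * N / B / (4 * T / C^2)^2 = N * C ^ 4 / (B * 4 * T^2)" for N B T C :: real
    by (simp add: power_divide power_mult_distrib)
  show ?thesis unfolding * g ** by (simp add: mult.assoc)
qed

text \<open>With \<open>e R = exp (- R)\<close>, the difference of the small variables is of order
  \<open>e R\<close> squared, one factor from each variable and one from its dependence on the end
  point. This matches the square in the denominator, whose coefficient 4 remains.\<close>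

lemma hyp_radius_ratio_tendsto:
  "((\<lambda>R. ((shell_radius R b)^2 - (shell_radius R a)^2) / (1 - (shell_radius R c)^2)^2)
    \<longlongrightarrow> (b - a) / 4) at_top"
proof -
  define e where "e R = exp (- R)" for R :: real
  define t where "t x R = exp (- (R + x * exp (- R)))" for x R :: real
  have e0: "(e \<longlongrightarrow> 0) at_top"
    unfolding e_def[abs_def] by (intro filterlim_compose[OF exp_at_bot] filterlim_uminus_at_bot_at_top)
  have t: "t x R = e R * exp (- x * e R)" for x R by (simp add: t_def e_def flip: exp_add)
  then have t': "t x = (\<lambda>R. e R * exp (- x * e R))" for x by blast
  have t0: "(t x \<longlongrightarrow> 0) at_top" for x
    using tendsto_mult[OF e0 tendsto_exp[OF tendsto_mult[OF tendsto_const[of "- x"] e0]]] by (simp add: t')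
  have ne: "e R \<noteq> 0" for R by (simp add: e_def)
  \<comment> \<open>A difference quotient at 0 with increment \<open>e R\<close>, which tends to 0
    without ever being 0.\<close>
  have d: "((\<lambda>R. (exp (- x * e R) - 1) / e R) \<longlongrightarrow> - x) at_top" for x
  proof -
    have "((\<lambda>y. exp (- x * y)) has_real_derivative - x) (at 0)"
      by (auto intro!: derivative_eq_intros)
    then have "((\<lambda>y. (exp (- x * y) - 1) / y) \<longlongrightarrow> - x) (at 0)" by (simp add: DERIV_def)
    moreover have "filterlim e (at 0) at_top" using e0 ne by (simp add: filterlim_at)
    ultimately show ?thesis by (rule filterlim_compose)
  qed
  have diff: "((\<lambda>R. (t a R - t b R) / (e R)^2) \<longlongrightarrow> b - a) at_top"
  proof -
    have "(t a R - t b R) / (e R)^2 = (exp (- a * e R) - 1) / e R - (exp (- b * e R) - 1) / e R" for R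
      using ne[of R] by (simp add: t power2_eq_square field_simps)
    then show ?thesis using tendsto_diff[OF d[of a] d[of b]] by simp
  qed
  have c: "((\<lambda>R. exp (- c * e R)) \<longlongrightarrow> 1) at_top"
    using tendsto_exp[OF tendsto_mult[OF tendsto_const[of "- c"] e0]] by simp
  have "((\<lambda>R. (t a R - t b R) / (e R)^2 * ((1 - t a R * t b R) * (1 + t c R) ^ 4) / ((1 + t a R)^2 * (1 + t b R)^2 * 4 * (exp (- c * e R))^2))
     \<longlongrightarrow> (b - a) * ((1 - 0 * 0) * (1 + 0) ^ 4) / ((1 + 0)^2 * (1 + 0)^2 * 4 * 1^2)) at_top"
    by (intro tendsto_intros diff t0 c) auto
  moreover have "(t a R - t b R) / (e R)^2 * ((1 - t a R * t b R) * (1 + t c R) ^ 4) / ((1 + t a R)^2 * (1 + t b R)^2 * 4 * (exp (- c * e R))^2)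
     = ((shell_radius R b)^2 - (shell_radius R a)^2) / (1 - (shell_radius R c)^2)^2" for R
    unfolding hyp_radius_ratio t_def[symmetric] by (subst (5) t) (simp add: power_mult_distrib mult_ac)
  ultimately show ?thesis by simp
qed

lemma hyp_radius_tendsto_1: "((\<lambda>R. shell_radius R a) \<longlongrightarrow> 1) at_top"
proof -
  have e0: "((\<lambda>R::real. exp (- R)) \<longlongrightarrow> 0) at_top"
    by (intro filterlim_compose[OF exp_at_bot] filterlim_uminus_at_bot_at_top)
  have t0: "((\<lambda>R. exp (- R) * exp (- a * exp (- R))) \<longlongrightarrow> 0) at_top"
    using tendsto_mult[OF e0 tendsto_exp[OF tendsto_mult[OF tendsto_const[of "- a"] e0]]] by simp
  have "hyp_radius \<rho> = (1 - exp (- \<rho>)) / (1 + exp (- \<rho>))" for \<rho>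
  proof -
    have "hyp_radius \<rho> = (exp (- \<rho>) * (exp \<rho> - 1)) / (exp (- \<rho>) * (exp \<rho> + 1))"
      by (simp add: hyp_radius_def)
    then show ?thesis by (simp add: algebra_simps flip: exp_add)
  qed
  then have "shell_radius R a = (1 - exp (- R) * exp (- a * exp (- R))) / (1 + exp (- R) * exp (- a * exp (- R)))" for R
    by (simp flip: exp_add)
  moreover have "((\<lambda>R. (1 - exp (- R) * exp (- a * exp (- R))) / (1 + exp (- R) * exp (- a * exp (- R)))) \<longlongrightarrow> (1 - 0) / (1 + 0)) at_top"
    by (intro tendsto_intros t0) auto
  ultimately show ?thesis by simp
qed

lemma hyp_radius_less_1: "hyp_radius \<rho> < 1"
  by (simp add: hyp_radius_def add_pos_pos)

lemma hyp_radius_mono: "\<rho> \<le> \<rho>' \<Longrightarrow> hyp_radius \<rho> \<le> hyp_radius \<rho>'"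
proof -
  assume "\<rho> \<le> \<rho>'"
  moreover have "hyp_radius x = 1 - 2 / (exp x + 1)" for x
    using add_pos_pos[of "exp x" 1] by (simp add: hyp_radius_def field_simps)
  ultimately show ?thesis by (simp add: frac_le add_pos_pos)
qed

lemma hyp_modulus_less_iff:
  assumes z: "cmod z < 1"
  shows "hyp_modulus z < \<rho> \<longleftrightarrow> cmod z < hyp_radius \<rho>"
proof -
  have "0 < (1 + cmod z) / (1 - cmod z)" using z by (simp add: add_pos_nonneg)
  then have "hyp_modulus z < \<rho> \<longleftrightarrow> (1 + cmod z) / (1 - cmod z) < exp \<rho>"
    unfolding hyp_modulus_def by (metis exp_less_cancel_iff exp_ln)
  also have "\<dots> \<longleftrightarrow> cmod z * (exp \<rho> + 1) < exp \<rho> - 1"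
    using z by (subst pos_divide_less_eq) (auto simp: algebra_simps)
  also have "\<dots> \<longleftrightarrow> cmod z < hyp_radius \<rho>"
    unfolding hyp_radius_def using add_pos_pos[of "exp \<rho>" 1] by (simp add: pos_less_divide_eq)
  finally show ?thesis .
qed

section \<open>Shells as annuli and their masses\<close>

definition hyp_annulus :: "real \<Rightarrow> real \<Rightarrow> complex set" where
  "hyp_annulus r s = {z. r \<le> cmod z \<and> cmod z < s}"

definition hyp_shell :: "real \<Rightarrow> real set \<Rightarrow> complex set" where
  "hyp_shell R U = {z \<in> unit_disc. exp R * (hyp_modulus z - R) \<in> U}"

lemma hyp_annulus_borel [measurable]: "hyp_annulus r s \<in> sets borel"
  unfolding hyp_annulus_def by measurable

lemma hyp_modulus_measurable [measurable]: "hyp_modulus \<in> borel_measurable borel"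
  unfolding hyp_modulus_def by measurable

lemma hyp_shell_borel [measurable]: "U \<in> sets borel \<Longrightarrow> hyp_shell R U \<in> sets borel"
proof -
  assume U: "U \<in> sets borel"
  have "hyp_shell R U = unit_disc \<inter> ((\<lambda>z. exp R * (hyp_modulus z - R)) -` U \<inter> space borel)"
    by (auto simp: hyp_shell_def)
  also have "\<dots> \<in> sets borel"
    using U by (intro sets.Int measurable_sets[of _ borel borel]) auto
  finally show ?thesis .
qed

lemma hyp_shell_interval:
  "hyp_shell R {a..<b} = hyp_annulus (shell_radius R a) (shell_radius R b)"
proof -
  have "exp R * (h - R) < x \<longleftrightarrow> h < R + x * exp (- R)" for h x
    by (simp add: exp_minus field_simps)
  then have lt: "exp R * (hyp_modulus z - R) < x \<longleftrightarrow> cmod z < shell_radius R x" if "cmod z < 1" for x z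
    using hyp_modulus_less_iff[OF that] by simp
  show ?thesis
    unfolding hyp_shell_def hyp_annulus_def
    using lt less_trans[OF _ hyp_radius_less_1] by (auto simp: not_less[symmetric])
qed

lemma hyp_shell_mono: "U \<subseteq> V \<Longrightarrow> hyp_shell R U \<subseteq> hyp_shell R V"
  by (auto simp: hyp_shell_def)

text \<open>An upper bound on the rescaled coordinate keeps the shell inside a closed ball of radius
  strictly less than 1.\<close>

lemma hyp_shell_precompact:
  assumes "U \<in> sets borel" "U \<subseteq> {a..<b}"
  shows "hyp_shell R U \<in> precompact_Borel unit_disc"
proof -
  let ?s = "shell_radius R b"
  have "hyp_shell R U \<subseteq> cball 0 ?s"
    using hyp_shell_mono[OF assms(2), of R] unfolding hyp_shell_interval by (auto simp: hyp_annulus_def)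
  moreover have "cball 0 ?s \<subseteq> unit_disc" using hyp_radius_less_1[of "R + b * exp (- R)"] by auto
  moreover have "hyp_shell R U \<in> sets (restrict_space borel unit_disc)"
    using assms(1) by (subst sets_restrict_space_iff) (auto simp: hyp_shell_def[of _ U] intro: hyp_shell_borel[unfolded hyp_shell_def])
  ultimately show ?thesis unfolding precompact_Borel_def using compact_cball by blast
qed

lemma hyp_density_nonneg: "0 < \<alpha> \<Longrightarrow> 0 \<le> hyp_density \<alpha> z"
  by (simp add: hyp_density_def)

lemma hyp_density_le:
  assumes "0 < \<alpha>" "cmod z < s" "s < 1"
  shows "hyp_density \<alpha> z \<le> \<alpha> / pi / (1 - s^2)^2"
proof -
  have "s^2 < 1" using assms norm_ge_zero[of z] by (subst abs_square_less_1) linarith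
  moreover have "(cmod z)^2 \<le> s^2" using assms by (intro power_mono) auto
  ultimately show ?thesis unfolding hyp_density_def using assms
    by (intro divide_left_mono mult_pos_pos zero_less_power power_mono) auto
qed

lemma hyp_density_ge:
  assumes "0 < \<alpha>" "r \<le> cmod z" "0 \<le> r" "cmod z < 1"
  shows "\<alpha> / pi / (1 - r^2)^2 \<le> hyp_density \<alpha> z"
proof -
  have "(cmod z)^2 < 1" using assms power_strict_mono[of "cmod z" 1 2] by simp
  moreover have "r^2 \<le> (cmod z)^2" using assms by (intro power_mono) auto
  moreover have "r^2 < 1" using calculation by linarith
  ultimately show ?thesis unfolding hyp_density_def using assms
    by (intro divide_left_mono mult_pos_pos zero_less_power power_mono) auto
qed

lemma nn_integral_q_hyp_le:
  assumes \<alpha>: "0 < \<alpha>" and B [measurable]: "B \<in> sets borel" and sub: "B \<subseteq> hyp_annulus r s" and s: "s < 1"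
  shows "(\<integral>\<^sup>+z. ennreal (indicator B z * (q_hyp \<alpha> z)^2) \<partial>mu_hyp \<alpha>) \<le> ennreal (\<alpha> / pi / (1 - s^2)^2) * emeasure lborel B"
proof -
  have B1: "B \<subseteq> unit_disc" using sub s by (auto simp: hyp_annulus_def)
  have "(\<integral>\<^sup>+z. ennreal (indicator B z * (q_hyp \<alpha> z)^2) \<partial>mu_hyp \<alpha>) = (\<integral>\<^sup>+z. ennreal (indicator B z * hyp_density \<alpha> z) \<partial>lborel)"
    using nn_integral_mu_hyp[OF \<alpha>, of "\<lambda>_. 1" B] B1 by simp
  also have "\<dots> \<le> (\<integral>\<^sup>+z. ennreal (\<alpha> / pi / (1 - s^2)^2) * indicator B z \<partial>lborel)"
  proof (rule nn_integral_mono)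
    fix z show "ennreal (indicator B z * hyp_density \<alpha> z) \<le> ennreal (\<alpha> / pi / (1 - s^2)^2) * indicator B z"
      using hyp_density_le[OF \<alpha> _ s, of z] sub by (cases "z \<in> B") (auto simp: hyp_annulus_def intro!: ennreal_leI)
  qed
  also have "\<dots> = ennreal (\<alpha> / pi / (1 - s^2)^2) * emeasure lborel B" by (rule nn_integral_cmult_indicator) simp
  finally show ?thesis .
qed

lemma nn_integral_q_hyp_ge:
  assumes \<alpha>: "0 < \<alpha>" and r: "0 \<le> r" and s: "s < 1"
  shows "ennreal (\<alpha> / pi / (1 - r^2)^2) * emeasure lborel (hyp_annulus r s) \<le> (\<integral>\<^sup>+z. ennreal (indicator (hyp_annulus r s) z * (q_hyp \<alpha> z)^2) \<partial>mu_hyp \<alpha>)"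
proof -
  let ?B = "hyp_annulus r s"
  have B1: "?B \<subseteq> unit_disc" using s by (auto simp: hyp_annulus_def)
  have "ennreal (\<alpha> / pi / (1 - r^2)^2) * emeasure lborel ?B = (\<integral>\<^sup>+z. ennreal (\<alpha> / pi / (1 - r^2)^2) * indicator ?B z \<partial>lborel)"
    by (rule nn_integral_cmult_indicator[symmetric]) simp
  also have "\<dots> \<le> (\<integral>\<^sup>+z. ennreal (indicator ?B z * hyp_density \<alpha> z) \<partial>lborel)"
  proof (rule nn_integral_mono)
    fix z show "ennreal (\<alpha> / pi / (1 - r^2)^2) * indicator ?B z \<le> ennreal (indicator ?B z * hyp_density \<alpha> z)"
      using hyp_density_ge[OF \<alpha> _ r, of z] s by (cases "z \<in> ?B") (auto simp: hyp_annulus_def intro!: ennreal_leI)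
  qed
  also have "\<dots> = (\<integral>\<^sup>+z. ennreal (indicator ?B z * (q_hyp \<alpha> z)^2) \<partial>mu_hyp \<alpha>)"
    using nn_integral_mu_hyp[OF \<alpha>, of "\<lambda>_. 1" ?B] B1 by simp
  finally show ?thesis .
qed

lemma emeasure_hyp_annulus: "0 \<le> r \<Longrightarrow> r \<le> s \<Longrightarrow> emeasure lborel (hyp_annulus r s) = ennreal (pi * (s^2 - r^2))"
  unfolding hyp_annulus_def by (rule emeasure_ring)

lemma q_hyp_integrable:
  assumes \<alpha>: "0 < \<alpha>" and B [measurable]: "B \<in> sets borel" and sub: "B \<subseteq> hyp_annulus r s" and s: "r \<le> s" "0 \<le> r" "s < 1"
  shows "set_integrable (mu_hyp \<alpha>) B (\<lambda>z. (q_hyp \<alpha> z)^2)"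
    and "ennreal (LINT z:B|mu_hyp \<alpha>. (q_hyp \<alpha> z)^2) = (\<integral>\<^sup>+z. ennreal (indicator B z * (q_hyp \<alpha> z)^2) \<partial>mu_hyp \<alpha>)"
proof -
  have "emeasure lborel B \<le> emeasure lborel (hyp_annulus r s)" using sub by (intro emeasure_mono) auto
  then have fin: "emeasure lborel B < \<infinity>" using s by (simp add: emeasure_hyp_annulus le_less_trans)
  have meas: "(\<lambda>z. indicator B z * (q_hyp \<alpha> z)^2) \<in> borel_measurable (mu_hyp \<alpha>)"
    by (rule borel_measurable_mu_hyp) measurable
  have "(\<integral>\<^sup>+z. ennreal (indicator B z * (q_hyp \<alpha> z)^2) \<partial>mu_hyp \<alpha>) < \<infinity>"
    by (rule le_less_trans[OF nn_integral_q_hyp_le[OF \<alpha> B sub s(3)]]) (use fin in \<open>simp add: ennreal_mult_less_top\<close>)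
  then have int: "integrable (mu_hyp \<alpha>) (\<lambda>z. indicator B z * (q_hyp \<alpha> z)^2)"
    by (intro integrableI_nonneg meas) auto
  then show "set_integrable (mu_hyp \<alpha>) B (\<lambda>z. (q_hyp \<alpha> z)^2)" by (simp add: set_integrable_def)
  show "ennreal (LINT z:B|mu_hyp \<alpha>. (q_hyp \<alpha> z)^2) = (\<integral>\<^sup>+z. ennreal (indicator B z * (q_hyp \<alpha> z)^2) \<partial>mu_hyp \<alpha>)"
    using nn_integral_eq_integral[OF int] by (simp add: set_lebesgue_integral_def)
qed

text \<open>Inside the square of half-width \<delta> around \<open>w\<close> the kernel is bounded
  by 1 and the area of the ring part is at most 24 \<delta> (s^2 - r^2); outside, the kernel is at
  most (1 - r^2) / \<delta>. The common prefactor is the area of the whole ring times the density at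
  its outer edge, which leaves the two summands in the last bracket.\<close>

lemma annulus_kernel_integral_le:
  assumes \<alpha>: "0 < \<alpha>" and B [measurable]: "B \<in> sets borel" and sub: "B \<subseteq> hyp_annulus r s"
    and rs: "2/3 \<le> r" "r \<le> s" "s < 1" and w: "w \<in> hyp_annulus r s" and \<delta>: "0 < \<delta>"
  shows "(\<integral>\<^sup>+z. ennreal (indicator B z * (q_hyp \<alpha> z)^2 * k_hyp \<alpha> z w) \<partial>mu_hyp \<alpha>)
    \<le> ennreal (\<alpha> * ((s^2 - r^2) / (1 - s^2)^2) * ((1 - r^2) / \<delta> + 24 / pi * \<delta>))"
proof -
  let ?D = "\<alpha> / pi / (1 - s^2)^2" and ?e = "(1 - r^2) / \<delta>"
  let ?A = "hyp_annulus r s" and ?S = "{z::complex. r \<le> cmod z \<and> cmod z < s \<and> \<bar>Re z - Re w\<bar> < \<delta> \<and> \<bar>Im z - Im w\<bar> < \<delta>}"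
  have [measurable]: "Re \<in> borel_measurable borel" "Im \<in> borel_measurable borel"
    by (intro borel_measurable_continuous_onI continuous_intros)+
  have S [measurable]: "?S \<in> sets borel" by measurable
  have B1: "B \<subseteq> unit_disc" using sub rs by (auto simp: hyp_annulus_def)
  have w1: "w \<in> unit_disc" using w rs by (auto simp: hyp_annulus_def)
  have r2: "r^2 \<le> s^2" "s^2 < 1" using rs power_strict_mono[of s 1 2] by (auto intro: power_mono)
  have e0: "0 \<le> ?e" using r2 \<delta> by simp
  have D0: "0 \<le> ?D" using \<alpha> by simp
  have k_meas: "(\<lambda>z. k_hyp \<alpha> z w) \<in> borel_measurable borel"
    using measurable_compose[OF _ k_hyp_measurable[of \<alpha>], of "\<lambda>z. (z, w)" borel] by simp
  have "(\<integral>\<^sup>+z. ennreal (indicator B z * (q_hyp \<alpha> z)^2 * k_hyp \<alpha> z w) \<partial>mu_hyp \<alpha>)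
     = (\<integral>\<^sup>+z. ennreal (indicator B z * hyp_density \<alpha> z * k_hyp \<alpha> z w) \<partial>lborel)"
    by (rule nn_integral_mu_hyp[OF \<alpha> k_meas B B1 k_hyp_nonneg])
  also have "\<dots> \<le> (\<integral>\<^sup>+z. ennreal (?D * ?e) * indicator ?A z + ennreal ?D * indicator ?S z \<partial>lborel)"
  proof (rule nn_integral_mono)
    fix z
    show "ennreal (indicator B z * hyp_density \<alpha> z * k_hyp \<alpha> z w) \<le> ennreal (?D * ?e) * indicator ?A z + ennreal ?D * indicator ?S z"
    proof (cases "z \<in> B")
      case True
      then have zA: "z \<in> ?A" and z1: "z \<in> unit_disc" using sub B1 by auto
      then have z: "r \<le> cmod z" "cmod z < s" by (auto simp: hyp_annulus_def)
      have dens: "0 \<le> hyp_density \<alpha> z" "hyp_density \<alpha> z \<le> ?D"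
        using hyp_density_nonneg[OF \<alpha>] hyp_density_le[OF \<alpha> z(2) rs(3)] by auto
      show ?thesis
      proof (cases "z \<in> ?S")
        case True
        have "hyp_density \<alpha> z * k_hyp \<alpha> z w \<le> ?D * 1"
          using dens k_hyp_le_1[OF z1 w1 \<alpha>] k_hyp_nonneg by (intro mult_mono) auto
        then have "ennreal (indicator B z * hyp_density \<alpha> z * k_hyp \<alpha> z w) \<le> ennreal ?D"
          using \<open>z \<in> B\<close> by (simp add: ennreal_leI)
        then show ?thesis using True by (simp add: add_increasing)
      next
        case False
        \<comment> \<open>Outside the square one coordinate alone already separates the two points
          by \<delta>.\<close>
        then have "\<delta> \<le> \<bar>Re (z - w)\<bar> \<or> \<delta> \<le> \<bar>Im (z - w)\<bar>" using z by auto
        then have far: "\<delta> \<le> cmod (z - w)" using abs_Re_le_cmod[of "z - w"] abs_Im_le_cmod[of "z - w"] by linarith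
        have "r^2 \<le> (cmod z)^2" "r^2 \<le> (cmod w)^2" using z w rs by (auto simp: hyp_annulus_def intro!: power_mono)
        then have "k_hyp \<alpha> z w \<le> ?e" by (intro k_hyp_le[OF z1 w1 \<alpha> \<delta> far]) auto
        then have "hyp_density \<alpha> z * k_hyp \<alpha> z w \<le> ?D * ?e"
          using dens k_hyp_nonneg by (intro mult_mono) auto
        then have "ennreal (indicator B z * hyp_density \<alpha> z * k_hyp \<alpha> z w) \<le> ennreal (?D * ?e)"
          using \<open>z \<in> B\<close> by (simp only: indicator_simps mult_1 ennreal_leI)
        then show ?thesis unfolding indicator_simps(1)[OF zA] mult_1_right by (rule add_increasing2[rotated]) simp
      qed
    qed simp
  qed
  also have "\<dots> = ennreal (?D * ?e) * emeasure lborel ?A + ennreal ?D * emeasure lborel ?S"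
    by (subst nn_integral_add) (auto simp: nn_integral_cmult_indicator S)
  also have "\<dots> \<le> ennreal (?D * ?e) * ennreal (pi * (s^2 - r^2)) + ennreal ?D * ennreal (24 * \<delta> * (s^2 - r^2))"
    using emeasure_ring_square_le[OF rs(1,2), of \<delta> "Re w" "Im w"] emeasure_hyp_annulus[of r s] rs \<delta>
    by (intro add_mono mult_left_mono) auto
  also have "\<dots> = ennreal (?D * ?e * (pi * (s^2 - r^2)) + ?D * (24 * \<delta> * (s^2 - r^2)))"
  proof -
    have nn: "0 \<le> ?D * ?e" "0 \<le> pi * (s^2 - r^2)" "0 \<le> 24 * \<delta> * (s^2 - r^2)"
      using mult_nonneg_nonneg[OF D0 e0] r2 \<delta> by auto
    show ?thesis
      using nn D0 by (simp only: ennreal_mult[symmetric] ennreal_plus[symmetric] mult_nonneg_nonneg)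
  qed
  also have "?D * ?e * (pi * (s^2 - r^2)) + ?D * (24 * \<delta> * (s^2 - r^2))
    = \<alpha> * ((s^2 - r^2) / (1 - s^2)^2) * ((1 - r^2) / \<delta> + 24 / pi * \<delta>)"
    using \<delta> r2 by (simp add: field_simps)
  finally show ?thesis .
qed

section \<open>Dyadic cells of the disc and factorial moments of shells\<close>

definition dyadic :: "nat \<Rightarrow> complex \<Rightarrow> int \<times> int" where
  "dyadic n z = (\<lfloor>2 ^ n * Re z\<rfloor>, \<lfloor>2 ^ n * Im z\<rfloor>)"

lemma dyadic_borel: "{z. dyadic n z = d} \<in> sets borel"
proof -
  have [measurable]: "Re \<in> borel_measurable borel" "Im \<in> borel_measurable borel"
    by (intro borel_measurable_continuous_onI continuous_intros)+
  have "{z. dyadic n z = d} = {z. of_int (fst d) \<le> 2 ^ n * Re z \<and> 2 ^ n * Re z < of_int (fst d) + 1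
      \<and> of_int (snd d) \<le> 2 ^ n * Im z \<and> 2 ^ n * Im z < of_int (snd d) + 1}"
    by (cases d) (auto simp: dyadic_def floor_eq_iff)
  also have "\<dots> \<in> sets borel" by measurable
  finally show ?thesis .
qed

lemma emeasure_dyadic_le: "emeasure lborel {z. dyadic n z = d} \<le> ennreal ((1 / 2 ^ n)^2)"
proof -
  obtain i j where d: "d = (i, j)" by (cases d)
  let ?l = "Complex (of_int i / 2 ^ n) (of_int j / 2 ^ n)" and ?u = "Complex ((of_int i + 1) / 2 ^ n) ((of_int j + 1) / 2 ^ n)"
  have "{z. dyadic n z = d} \<subseteq> cbox ?l ?u"
    by (auto simp: d dyadic_def floor_eq_iff in_cbox_complex_iff field_simps)
  then have "emeasure lborel {z. dyadic n z = d} \<le> emeasure lborel (cbox ?l ?u)" by (intro emeasure_mono) auto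
  also have "\<dots> = ennreal (\<Prod>b\<in>Basis. (?u - ?l) \<bullet> b)"
    by (subst emeasure_lborel_cbox) (auto simp: Basis_complex_def divide_right_mono)
  also have "(\<Prod>b\<in>Basis. (?u - ?l) \<bullet> b) = (1 / 2 ^ n)^2"
    by (simp add: Basis_complex_def power2_eq_square add_divide_distrib)
  finally show ?thesis .
qed

lemma eventually_floor_scaled_neq:
  fixes x y :: real
  assumes "x \<noteq> y"
  shows "\<forall>\<^sub>F n in sequentially. \<lfloor>2 ^ n * x\<rfloor> \<noteq> \<lfloor>2 ^ n * y\<rfloor>"
proof -
  obtain N where N: "1 / \<bar>x - y\<bar> < 2 ^ N" using real_arch_pow[of 2 "1 / \<bar>x - y\<bar>"] by auto
  have "\<lfloor>2 ^ n * x\<rfloor> \<noteq> \<lfloor>2 ^ n * y\<rfloor>" if "N \<le> n" for n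
  proof
    assume "\<lfloor>2 ^ n * x\<rfloor> = \<lfloor>2 ^ n * y\<rfloor>"
    then have "\<bar>2 ^ n * x - 2 ^ n * y\<bar> < 1" by linarith
    then have "2 ^ n * \<bar>x - y\<bar> < 1" by (simp add: right_diff_distrib[symmetric] abs_mult)
    moreover have "2 ^ N * \<bar>x - y\<bar> \<le> 2 ^ n * \<bar>x - y\<bar>" using that by (intro mult_right_mono power_increasing) auto
    moreover have "1 < 2 ^ N * \<bar>x - y\<bar>" using N assms by (simp add: divide_less_eq)
    ultimately show False by linarith
  qed
  then show ?thesis by (auto simp: eventually_sequentially)
qed

lemma dyadic_separates: "z \<noteq> w \<Longrightarrow> \<forall>\<^sub>F n in sequentially. dyadic n z \<noteq> dyadic n w"
  using eventually_floor_scaled_neq[of "Re z" "Re w"] eventually_floor_scaled_neq[of "Im z" "Im w"]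
  by (auto simp: complex_eq_iff dyadic_def elim: eventually_mono)

lemma dyadic_bounded:
  assumes "cmod z < 1"
  shows "dyadic n z \<in> {- (2 ^ n)..2 ^ n} \<times> {- (2 ^ n)..2 ^ n}"
proof -
  have *: "\<lfloor>2 ^ n * x\<rfloor> \<in> {- (2 ^ n)..2 ^ n}" if "\<bar>x\<bar> \<le> 1" for x :: real
  proof -
    have "\<bar>2 ^ n * x\<bar> \<le> 2 ^ n * 1" using that unfolding abs_mult by (intro mult_mono) auto
    then have "- (2 ^ n) \<le> 2 ^ n * x" "2 ^ n * x \<le> 2 ^ n" by linarith+
    moreover have "real_of_int \<lfloor>2 ^ n * x\<rfloor> \<le> 2 ^ n * x" by (rule of_int_floor_le)
    ultimately have "- (2 ^ n) \<le> \<lfloor>2 ^ n * x\<rfloor>" "real_of_int \<lfloor>2 ^ n * x\<rfloor> \<le> real_of_int (2 ^ n)"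
      by (simp add: le_floor_iff, simp only: of_int_power of_int_numeral)
    then show ?thesis by (simp only: of_int_le_iff atLeastAtMost_iff)
  qed
  show ?thesis unfolding dyadic_def
    using *[of "Re z"] *[of "Im z"] abs_Re_le_cmod[of z] abs_Im_le_cmod[of z] assms by auto
qed

text \<open>The cut-off \<delta> of the kernel estimate is taken as sqrt(1 - r^2), which balances
  the far and the near contribution up to constants.\<close>

definition hyp_error :: "real \<Rightarrow> real \<Rightarrow> real \<Rightarrow> real" where
  "hyp_error \<alpha> L R = (let r = shell_radius R (- L); s = shell_radius R L in
     \<alpha> * ((s^2 - r^2) / (1 - s^2)^2) * ((1 - r^2) / sqrt (1 - r^2) + 24 / pi * sqrt (1 - r^2)))"

definition shell_mass :: "real \<Rightarrow> real \<Rightarrow> real set \<Rightarrow> real" where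
  "shell_mass \<alpha> R U = (LINT z:hyp_shell R U|mu_hyp \<alpha>. (q_hyp \<alpha> z)^2)"

text \<open>Correlations are estimated over the whole window from \<open>- L\<close> to
  \<open>L\<close>, so that the set \<open>U\<close> enters the error only through its mass.\<close>

lemma hyp_shell_factorial_moment:
  fixes M :: "'p measure"
  assumes \<alpha>: "0 < \<alpha>" and H: "hyperbolic_ensemble M \<alpha> H" and U: "U \<in> sets borel" "U \<subseteq> {- L..<L}" and L: "0 \<le> L"
    and r: "2/3 \<le> shell_radius R (- L)" and k: "1 \<le> k"
  defines "N \<equiv> \<lambda>w. nat \<lfloor>measure (H w) (hyp_shell R U)\<rfloor>"
  shows "integrable M (\<lambda>w. fact k * real (N w choose k))"
    and "\<bar>(\<integral>w. fact k * real (N w choose k) \<partial>M) - shell_mass \<alpha> R U ^ k\<bar>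
      \<le> fact k * (hyp_error \<alpha> L R * shell_mass \<alpha> R U ^ (k - 1))"
proof -
  define r s where "r = shell_radius R (- L)" and "s = shell_radius R L"
  let ?A = "hyp_shell R U"
  have A: "?A \<in> sets borel" "?A \<subseteq> hyp_annulus r s"
    using hyp_shell_borel[OF U(1)] hyp_shell_mono[OF U(2), of R] unfolding hyp_shell_interval r_def s_def by auto
  have rs: "2/3 \<le> r" "r \<le> s" "s < 1"
    using assms hyp_radius_less_1 by (auto simp: r_def s_def intro!: hyp_radius_mono)
  have A1: "?A \<subseteq> unit_disc" by (auto simp: hyp_shell_def)
  have r2: "r^2 \<le> s^2" "s^2 < 1" using rs by (auto intro: power_mono simp: abs_square_less_1)
  let ?\<delta> = "sqrt (1 - r^2)"
  have \<delta>: "0 < ?\<delta>" using r2 by simp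
  let ?c = "\<alpha> * ((s^2 - r^2) / (1 - s^2)^2) * ((1 - r^2) / ?\<delta> + 24 / pi * ?\<delta>)"
  have c: "hyp_error \<alpha> L R = ?c" unfolding hyp_error_def Let_def r_def s_def ..
  have cell: "{x\<in>?A. dyadic n x = d} \<in> sets borel" for n d
  proof -
    have "{x\<in>?A. dyadic n x = d} = ?A \<inter> {z. dyadic n z = d}" by auto
    then show ?thesis using A(1) dyadic_borel by auto
  qed
  \<comment> \<open>The index square of side from - 2^n to 2^n covers the dyadic cells that meet the
    disc. The mass of a cell is at most its area 4^(-n) times the density at the outer radius
    \<open>s\<close>.\<close>
  interpret dominated_determinantal_process M unit_disc "mu_hyp \<alpha>" "K_hyp \<alpha>" H ?A "q_hyp \<alpha>" "k_hyp \<alpha>" ?c dyadic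
    "\<lambda>n. {- (2 ^ n)..2 ^ n} \<times> {- (2 ^ n)..2 ^ n}" "\<lambda>n. \<alpha> / pi / (1 - s^2)^2 * (1 / 2 ^ n)^2"
  proof (rule dominated_determinantal_process.intro)
    show "determinantal_process M unit_disc (mu_hyp \<alpha>) (K_hyp \<alpha>) H" using H by (simp add: hyperbolic_ensemble_def)
    show "sigma_finite_measure (mu_hyp \<alpha>)" by (rule sigma_finite_mu_hyp)
    show "?A \<in> precompact_Borel unit_disc" by (rule hyp_shell_precompact[OF U])
    show "q_hyp \<alpha> \<in> borel_measurable (mu_hyp \<alpha>)" by (intro borel_measurable_mu_hyp) measurable
    show "0 \<le> q_hyp \<alpha> x" for x by (simp add: q_hyp_def)
    show "set_integrable (mu_hyp \<alpha>) ?A (\<lambda>x. (q_hyp \<alpha> x)^2)" using q_hyp_integrable(1)[OF \<alpha> A] rs by simp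
    have id: "(\<lambda>z. z) \<in> borel_measurable (mu_hyp \<alpha>)" by (intro borel_measurable_mu_hyp) measurable
    have "(\<lambda>p. (fst p, snd p)) \<in> measurable (mu_hyp \<alpha> \<Otimes>\<^sub>M mu_hyp \<alpha>) (borel \<Otimes>\<^sub>M borel)"
      by (intro measurable_Pair measurable_compose[OF measurable_fst id] measurable_compose[OF measurable_snd id])
    from measurable_compose[OF this k_hyp_measurable[of \<alpha>]]
    show "(\<lambda>(x, y). k_hyp \<alpha> x y) \<in> borel_measurable (mu_hyp \<alpha> \<Otimes>\<^sub>M mu_hyp \<alpha>)" by (simp add: case_prod_beta')
    show "0 \<le> k_hyp \<alpha> x y" for x y by (rule k_hyp_nonneg)
    show "k_hyp \<alpha> x y \<le> 1" if "x \<in> ?A" "y \<in> ?A" for x y using that A1 k_hyp_le_1[OF _ _ \<alpha>] by blast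
    show "K_hyp \<alpha> x x = complex_of_real ((q_hyp \<alpha> x)^2)" if "x \<in> ?A" for x using that A1 K_hyp_diag by blast
    show "cmod (K_hyp \<alpha> x y) \<le> q_hyp \<alpha> x * q_hyp \<alpha> y * k_hyp \<alpha> x y" if "x \<in> ?A" "y \<in> ?A" for x y
      using norm_K_hyp[OF subsetD[OF A1 that(1)] subsetD[OF A1 that(2)], of \<alpha>] by simp
    show "0 \<le> ?c" using \<alpha> r2 \<delta> by (intro mult_nonneg_nonneg add_nonneg_nonneg divide_nonneg_nonneg) auto
    show "(\<integral>\<^sup>+x. ennreal (indicator ?A x * (q_hyp \<alpha> x)^2 * k_hyp \<alpha> x y) \<partial>mu_hyp \<alpha>) \<le> ennreal ?c" if "y \<in> ?A" for y
      using that A(2) by (intro annulus_kernel_integral_le[OF \<alpha> A rs _ \<delta>]) auto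
    show "finite ({- (2 ^ n)..2 ^ n :: int} \<times> {- (2 ^ n)..2 ^ n :: int})" for n by simp
    show "dyadic n x \<in> {- (2 ^ n)..2 ^ n} \<times> {- (2 ^ n)..2 ^ n}" if "x \<in> ?A" for n x
      using that A1 by (intro dyadic_bounded) auto
    show "{x\<in>?A. dyadic n x = d} \<in> sets (restrict_space borel unit_disc)" for n d
      using cell[of n d] A1 by (subst sets_restrict_space_iff) auto
    show "\<forall>\<^sub>F n in sequentially. dyadic n x \<noteq> dyadic n y" if "x \<noteq> y" for x y
      using that by (rule dyadic_separates)
    show "(LINT x:{x\<in>?A. dyadic n x = d}|mu_hyp \<alpha>. (q_hyp \<alpha> x)^2) \<le> \<alpha> / pi / (1 - s^2)^2 * (1 / 2 ^ n)^2" for n d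
    proof -
      let ?C = "{x\<in>?A. dyadic n x = d}"
      have C: "?C \<subseteq> hyp_annulus r s" using A(2) by auto
      have "ennreal (LINT x:?C|mu_hyp \<alpha>. (q_hyp \<alpha> x)^2) \<le> ennreal (\<alpha> / pi / (1 - s^2)^2) * emeasure lborel ?C"
        using q_hyp_integrable(2)[OF \<alpha> cell C] nn_integral_q_hyp_le[OF \<alpha> cell C] rs by simp
      also have "\<dots> \<le> ennreal (\<alpha> / pi / (1 - s^2)^2) * ennreal ((1 / 2 ^ n)^2)"
      proof (rule mult_left_mono)
        have "emeasure lborel ?C \<le> emeasure lborel {z. dyadic n z = d}"
          using dyadic_borel by (intro emeasure_mono) auto
        then show "emeasure lborel ?C \<le> ennreal ((1 / 2 ^ n)^2)"
          using emeasure_dyadic_le order_trans by blast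
      qed simp
      also have "\<dots> = ennreal (\<alpha> / pi / (1 - s^2)^2 * (1 / 2 ^ n)^2)"
        using \<alpha> by (intro ennreal_mult[symmetric]) auto
      finally show ?thesis using \<alpha> by (subst (asm) ennreal_le_iff) auto
    qed
    have "(\<lambda>n. ((1 / 2) ^ n)^2 :: real) \<longlonglongrightarrow> 0^2" by (intro tendsto_intros LIMSEQ_realpow_zero) auto
    from tendsto_mult_left[OF this, of "\<alpha> / pi / (1 - s^2)^2"]
    show "(\<lambda>n. \<alpha> / pi / (1 - s^2)^2 * (1 / 2 ^ n)^2) \<longlonglongrightarrow> 0" by (simp add: power_one_over)
  qed
  show "integrable M (\<lambda>w. fact k * real (N w choose k))"
    using factorial_moment(1)[OF k] by (simp add: N_def number_def)
  show "\<bar>(\<integral>w. fact k * real (N w choose k) \<partial>M) - shell_mass \<alpha> R U ^ k\<bar>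
      \<le> fact k * (hyp_error \<alpha> L R * shell_mass \<alpha> R U ^ (k - 1))"
    using factorial_moment(2)[OF k] unfolding c by (simp add: N_def number_def shell_mass_def v_def)
qed

text \<open>The mass factor converges, by the asymptotics of the ratio of radii, while the bracket
  is a constant multiple of sqrt(1 - r^2).\<close>

lemma hyp_error_tendsto: "(hyp_error \<alpha> L \<longlongrightarrow> 0) at_top"
proof -
  have 1: "((\<lambda>R. 1 - (shell_radius R (- L))^2) \<longlongrightarrow> 0) at_top"
    using tendsto_diff[OF tendsto_const tendsto_power[OF hyp_radius_tendsto_1, of "- L" 2], of 1] by simp
  have "((\<lambda>R. \<alpha> * (((shell_radius R L)^2 - (shell_radius R (- L))^2) / (1 - (shell_radius R L)^2)^2)
     * (sqrt (1 - (shell_radius R (- L))^2) + 24 / pi * sqrt (1 - (shell_radius R (- L))^2)))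
     \<longlongrightarrow> \<alpha> * ((L - (- L)) / 4) * (sqrt 0 + 24 / pi * sqrt 0)) at_top"
    by (intro tendsto_intros hyp_radius_ratio_tendsto 1)
  moreover have "(1 - (hyp_radius \<rho>)^2) / sqrt (1 - (hyp_radius \<rho>)^2) = sqrt (1 - (hyp_radius \<rho>)^2)" for \<rho>
    by (rule real_div_sqrt) (simp add: one_minus_hyp_radius_squared)
  ultimately show ?thesis unfolding hyp_error_def[abs_def] Let_def by simp
qed

lemma eventually_hyp_radius_ge: "\<forall>\<^sub>F R in at_top. 2/3 \<le> shell_radius R a"
  using order_tendstoD(1)[OF hyp_radius_tendsto_1, of "2/3" a] by (auto elim: eventually_mono)

text \<open>The density is radial and increasing, so the mass lies between the area times the
  density at the inner edge and at the outer edge. Both bounds have the same limit because the limit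
  of the ratio does not depend on \<open>c\<close>.\<close>

lemma shell_mass_interval_tendsto:
  assumes \<alpha>: "0 < \<alpha>" and ab: "a \<le> b"
  shows "((\<lambda>R. shell_mass \<alpha> R {a..<b}) \<longlongrightarrow> \<alpha> / 4 * (b - a)) at_top"
proof -
  define r s where "r R = shell_radius R a" and "s R = shell_radius R b" for R
  have lim: "((\<lambda>R. \<alpha> * (((s R)^2 - (r R)^2) / (1 - (shell_radius R c)^2)^2)) \<longlongrightarrow> \<alpha> * ((b - a) / 4)) at_top" for c
    unfolding r_def s_def by (intro tendsto_intros hyp_radius_ratio_tendsto)
  have bounds: "\<alpha> * (((s R)^2 - (r R)^2) / (1 - (r R)^2)^2) \<le> shell_mass \<alpha> R {a..<b} \<and>
     shell_mass \<alpha> R {a..<b} \<le> \<alpha> * (((s R)^2 - (r R)^2) / (1 - (s R)^2)^2)" if "2/3 \<le> r R" for R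
  proof -
    have rs: "0 \<le> r R" "r R \<le> s R" "s R < 1"
      using that ab hyp_radius_less_1 by (auto simp: r_def s_def intro!: hyp_radius_mono mult_right_mono)
    have r2: "(r R)^2 \<le> (s R)^2" using rs by (intro power_mono)
    let ?A = "hyp_annulus (r R) (s R)"
    have mass: "ennreal (shell_mass \<alpha> R {a..<b}) = (\<integral>\<^sup>+z. ennreal (indicator ?A z * (q_hyp \<alpha> z)^2) \<partial>mu_hyp \<alpha>)"
      unfolding shell_mass_def hyp_shell_interval r_def[symmetric] s_def[symmetric]
      by (rule q_hyp_integrable(2)[OF \<alpha> _ subset_refl rs(2,1,3)]) measurable
    have m0: "0 \<le> shell_mass \<alpha> R {a..<b}"
      unfolding shell_mass_def set_lebesgue_integral_def by (intro Bochner_Integration.integral_nonneg) auto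
    have e: "ennreal (\<alpha> / pi / (1 - t^2)^2) * emeasure lborel ?A = ennreal (\<alpha> * (((s R)^2 - (r R)^2) / (1 - t^2)^2))" for t
      unfolding emeasure_hyp_annulus[OF rs(1,2)] using \<alpha> r2 by (subst ennreal_mult[symmetric]) auto
    have "ennreal (\<alpha> * (((s R)^2 - (r R)^2) / (1 - (r R)^2)^2)) \<le> ennreal (shell_mass \<alpha> R {a..<b})"
      unfolding mass e[symmetric] by (rule nn_integral_q_hyp_ge[OF \<alpha> rs(1,3)])
    moreover have "ennreal (shell_mass \<alpha> R {a..<b}) \<le> ennreal (\<alpha> * (((s R)^2 - (r R)^2) / (1 - (s R)^2)^2))"
      unfolding mass e[symmetric] by (rule nn_integral_q_hyp_le[OF \<alpha> _ subset_refl rs(3)]) measurable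
    ultimately show ?thesis using m0 \<alpha> r2 by (auto simp: ennreal_le_iff2 ennreal_le_iff)
  qed
  have ev: "\<forall>\<^sub>F R in at_top. 2/3 \<le> r R" unfolding r_def by (rule eventually_hyp_radius_ge)
  have "((\<lambda>R. shell_mass \<alpha> R {a..<b}) \<longlongrightarrow> \<alpha> * ((b - a) / 4)) at_top"
  proof (rule tendsto_sandwich)
    show "\<forall>\<^sub>F R in at_top. \<alpha> * (((s R)^2 - (r R)^2) / (1 - (r R)^2)^2) \<le> shell_mass \<alpha> R {a..<b}"
      using ev by (rule eventually_mono) (use bounds in blast)
    show "\<forall>\<^sub>F R in at_top. shell_mass \<alpha> R {a..<b} \<le> \<alpha> * (((s R)^2 - (r R)^2) / (1 - (s R)^2)^2)"
      using ev by (rule eventually_mono) (use bounds in blast)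
    show "((\<lambda>R. \<alpha> * (((s R)^2 - (r R)^2) / (1 - (r R)^2)^2)) \<longlongrightarrow> \<alpha> * ((b - a) / 4)) at_top"
      using lim[of a] by (simp only: r_def[symmetric])
    show "((\<lambda>R. \<alpha> * (((s R)^2 - (r R)^2) / (1 - (s R)^2)^2)) \<longlongrightarrow> \<alpha> * ((b - a) / 4)) at_top"
      using lim[of b] by (simp only: s_def[symmetric])
  qed
  then show ?thesis by simp
qed

lemma shell_mass_UN_tendsto:
  fixes a b :: "'i \<Rightarrow> real"
  assumes \<alpha>: "0 < \<alpha>" and S: "finite S" "disjoint_family_on (\<lambda>i. {a i..<b i}) S" and ab: "\<And>i. i \<in> S \<Longrightarrow> a i \<le> b i"
  shows "((\<lambda>R. shell_mass \<alpha> R (\<Union>i\<in>S. {a i..<b i})) \<longlongrightarrow> \<alpha> / 4 * (\<Sum>i\<in>S. b i - a i)) at_top"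
proof -
  have "\<forall>\<^sub>F R in at_top. \<forall>i\<in>S. 2/3 \<le> shell_radius R (a i)"
    using S(1) eventually_hyp_radius_ge by (intro eventually_ball_finite) auto
  then have ev: "\<forall>\<^sub>F R in at_top. (\<Sum>i\<in>S. shell_mass \<alpha> R {a i..<b i}) = shell_mass \<alpha> R (\<Union>i\<in>S. {a i..<b i})"
  proof eventually_elim
    case (elim R)
    let ?A = "\<lambda>i. hyp_shell R {a i..<b i}"
    have int: "integrable (mu_hyp \<alpha>) (\<lambda>z. indicator (?A i) z *\<^sub>R (q_hyp \<alpha> z)\<^sup>2)" if "i \<in> S" for i
    proof -
      have "shell_radius R (a i) \<le> shell_radius R (b i)"
        using ab[OF that] by (intro hyp_radius_mono add_left_mono mult_right_mono) auto
      moreover have "0 \<le> shell_radius R (a i)" using elim that by fastforce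
      ultimately show ?thesis
        using q_hyp_integrable(1)[OF \<alpha> hyp_annulus_borel subset_refl _ _ hyp_radius_less_1]
        unfolding hyp_shell_interval set_integrable_def by blast
    qed
    have "(\<Sum>i\<in>S. shell_mass \<alpha> R {a i..<b i}) = (\<integral>z. (\<Sum>i\<in>S. indicator (?A i) z *\<^sub>R (q_hyp \<alpha> z)\<^sup>2) \<partial>mu_hyp \<alpha>)"
      unfolding shell_mass_def set_lebesgue_integral_def by (rule Bochner_Integration.integral_sum[symmetric]) (rule int)
    also have "\<dots> = (\<integral>z. indicator (hyp_shell R (\<Union>i\<in>S. {a i..<b i})) z *\<^sub>R (q_hyp \<alpha> z)\<^sup>2 \<partial>mu_hyp \<alpha>)"
    proof (intro Bochner_Integration.integral_cong refl)
      fix z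
      have "disjoint_family_on ?A S" using S(2) unfolding disjoint_family_on_def hyp_shell_def by blast
      moreover have "hyp_shell R (\<Union>i\<in>S. {a i..<b i}) = (\<Union>i\<in>S. ?A i)" by (auto simp: hyp_shell_def)
      ultimately show "(\<Sum>i\<in>S. indicator (?A i) z *\<^sub>R (q_hyp \<alpha> z)\<^sup>2) = indicator (hyp_shell R (\<Union>i\<in>S. {a i..<b i})) z *\<^sub>R (q_hyp \<alpha> z)\<^sup>2"
        using S(1) by (simp add: indicator_UN_disjoint sum_distrib_right)
    qed
    finally show ?case by (simp add: shell_mass_def set_lebesgue_integral_def)
  qed
  have "((\<lambda>R. \<Sum>i\<in>S. shell_mass \<alpha> R {a i..<b i}) \<longlongrightarrow> (\<Sum>i\<in>S. \<alpha> / 4 * (b i - a i))) at_top"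
    by (intro tendsto_intros shell_mass_interval_tendsto \<alpha> ab)
  then show ?thesis using ev by (simp add: sum_distrib_left Lim_transform_eventually)
qed

text \<open>The limit \<open>\<Lambda>\<close> of the masses is kept abstract, since the results are
  applied both to finite unions of cells and to a single cell.\<close>

locale hyperbolic_shells =
  fixes M :: "'p measure" and \<alpha> :: real and H :: "'p \<Rightarrow> complex measure"
    and U :: "real set" and L \<Lambda> :: real
  assumes \<alpha>: "0 < \<alpha>" and H: "hyperbolic_ensemble M \<alpha> H"
    and U: "U \<in> sets borel" "U \<subseteq> {- L..<L}" and L: "0 \<le> L"
    and mass: "((\<lambda>R. shell_mass \<alpha> R U) \<longlongrightarrow> \<Lambda>) at_top"
begin

definition N :: "real \<Rightarrow> 'p \<Rightarrow> nat" where "N R w = nat \<lfloor>measure (H w) (hyp_shell R U)\<rfloor>"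

lemma prob: "prob_space M"
  using H by (simp add: hyperbolic_ensemble_def determinantal_process_def simple_point_process_def point_process_def)

sublocale prob_space M by (rule prob)

lemma measure_shell_eq_N: "w \<in> space M \<Longrightarrow> measure (H w) (hyp_shell R U) = real (N R w)"
proof -
  assume "w \<in> space M"
  moreover have "point_process M unit_disc H"
    using H by (simp add: hyperbolic_ensemble_def determinantal_process_def simple_point_process_def)
  ultimately have "H w \<in> Conf unit_disc" by (intro point_process_Conf)
  then obtain n where "measure (H w) (hyp_shell R U) = real n"
    using Conf_count[OF _ hyp_shell_precompact[OF U]] by metis
  then show ?thesis by (simp add: N_def)
qed

lemma eventually_large: "\<forall>\<^sub>F R in at_top. 2/3 \<le> shell_radius R (- L)"
  by (rule eventually_hyp_radius_ge)

lemma binomial_integrable: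
  assumes "2/3 \<le> shell_radius R (- L)"
  shows "integrable M (\<lambda>w. real (N R w choose k))"
proof (cases "1 \<le> k")
  case True
  have "integrable M (\<lambda>w. fact k * real (N R w choose k))"
    unfolding N_def by (rule hyp_shell_factorial_moment(1)[OF \<alpha> H U L assms True])
  then have "integrable M (\<lambda>w. (1 / fact k) * (fact k * real (N R w choose k)))"
    by (rule integrable_mult_right)
  then show ?thesis by (simp only: mult.assoc[symmetric]) simp
next
  case False
  then have "k = 0" by simp
  then show ?thesis by simp
qed

text \<open>The error is a product of \<open>hyp_error\<close>, which tends to 0, with powers of the
  mass, which converge. The case \<open>k = 0\<close> is separate because the determinantal identity
  starts at \<open>k = 1\<close>.\<close>

lemma binomial_moment_tendsto:
  "((\<lambda>R. \<integral>w. real (N R w choose k) \<partial>M) \<longlongrightarrow> \<Lambda> ^ k / fact k) at_top"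
proof (cases "1 \<le> k")
  case True
  let ?e = "\<lambda>R. fact k * (hyp_error \<alpha> L R * shell_mass \<alpha> R U ^ (k - 1))"
  have "(?e \<longlongrightarrow> fact k * (0 * \<Lambda> ^ (k - 1))) at_top"
    by (intro tendsto_intros hyp_error_tendsto mass)
  then have e: "(?e \<longlongrightarrow> 0) at_top" by simp
  have "\<forall>\<^sub>F R in at_top. \<bar>(\<integral>w. fact k * real (N R w choose k) \<partial>M) - shell_mass \<alpha> R U ^ k\<bar> \<le> ?e R"
    using eventually_large unfolding N_def
    by eventually_elim (rule hyp_shell_factorial_moment(2)[OF \<alpha> H U L _ True])
  then have "((\<lambda>R. (\<integral>w. fact k * real (N R w choose k) \<partial>M) - shell_mass \<alpha> R U ^ k) \<longlongrightarrow> 0) at_top"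
    by (intro Lim_null_comparison[OF _ e]) (simp add: real_norm_def)
  from tendsto_add[OF this tendsto_power[OF mass, of k]]
  have "((\<lambda>R. fact k * (\<integral>w. real (N R w choose k) \<partial>M)) \<longlongrightarrow> \<Lambda> ^ k) at_top" by simp
  from tendsto_divide[OF this tendsto_const[of "fact k"]] show ?thesis by simp
next
  case False
  then have "k = 0" by simp
  then show ?thesis by (simp add: prob_space)
qed

lemma N_zero_sets: "{w\<in>space M. measure (H w) (hyp_shell R U) = 0} \<in> sets M"
  and measure_shell_measurable: "(\<lambda>w. measure (H w) (hyp_shell R U)) \<in> borel_measurable M"
proof -
  have "integrable M (\<lambda>w. \<Prod>i<Suc 0. measure (H w) ((\<lambda>_. hyp_shell R U) i))"
    using determinantal_processD[OF H[unfolded hyperbolic_ensemble_def], of "Suc 0" "\<lambda>_. hyp_shell R U"]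
      hyp_shell_precompact[OF U, of R]
    by (simp add: disjoint_family_on_def)
  then show [measurable]: "(\<lambda>w. measure (H w) (hyp_shell R U)) \<in> borel_measurable M" by simp
  show "{w\<in>space M. measure (H w) (hyp_shell R U) = 0} \<in> sets M" by measurable
qed

text \<open>Bonferroni's inequalities hold for each value of the count; they are integrated for
  \<open>R\<close> so large that the binomial moments are known to be integrable.\<close>

theorem avoidance_tendsto:
  "((\<lambda>R. \<P>(w in M. measure (H w) (hyp_shell R U) = 0)) \<longlongrightarrow> exp (- \<Lambda>)) at_top"
proof (rule tendsto_exp_minus_bonferroni[OF binomial_moment_tendsto])
  let ?Z = "\<lambda>R. {w\<in>space M. measure (H w) (hyp_shell R U) = 0}"
  let ?s = "\<lambda>n R w. \<Sum>j\<le>n. (- 1) ^ j * real (N R w choose j)"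
  have sum: "(\<integral>w. ?s n R w \<partial>M) = (\<Sum>j\<le>n. (- 1) ^ j * (\<integral>w. real (N R w choose j) \<partial>M))"
    and int: "integrable M (?s n R)"
    if "2/3 \<le> shell_radius R (- L)" for n R
  proof -
    have i: "integrable M (\<lambda>w. (- 1) ^ j * real (N R w choose j))" for j
      by (intro integrable_mult_right binomial_integrable that)
    show "integrable M (?s n R)" by (intro Bochner_Integration.integrable_sum i)
    show "(\<integral>w. ?s n R w \<partial>M) = (\<Sum>j\<le>n. (- 1) ^ j * (\<integral>w. real (N R w choose j) \<partial>M))"
      by (subst Bochner_Integration.integral_sum[OF i]) simp
  qed
  have Z: "prob (?Z R) = (\<integral>w. indicator (?Z R) w \<partial>M)" "integrable M (indicator (?Z R) :: _ \<Rightarrow> real)" for R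
    using N_zero_sets by (auto simp: emeasure_eq_measure)
  have ind: "indicator (?Z R) w = of_bool (N R w = 0)" if "w \<in> space M" for R w
    using measure_shell_eq_N[OF that] that by (auto simp: indicator_def)
  fix m
  show "\<forall>\<^sub>F R in at_top. (\<Sum>j\<le>Suc (2 * m). (- 1) ^ j * (\<integral>w. real (N R w choose j) \<partial>M)) \<le> prob (?Z R)"
    using eventually_large
  proof eventually_elim
    case (elim R)
    show ?case unfolding Z(1) sum[OF elim, symmetric]
      by (intro integral_mono int[OF elim] Z(2)) (simp only: ind bonferroni_lower)
  qed
  show "\<forall>\<^sub>F R in at_top. prob (?Z R) \<le> (\<Sum>j\<le>2 * m. (- 1) ^ j * (\<integral>w. real (N R w choose j) \<partial>M))"
    using eventually_large
  proof eventually_elim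
    case (elim R)
    show ?case unfolding Z(1) sum[OF elim, symmetric]
      by (intro integral_mono int[OF elim] Z(2)) (simp only: ind bonferroni_upper)
  qed
qed

text \<open>A first moment bound for pairs: a count of at least 2 contains at least one
  pair.\<close>

lemma multiple_le:
  assumes "2/3 \<le> shell_radius R (- L)"
  shows "\<P>(w in M. 2 \<le> measure (H w) (hyp_shell R U)) \<le> (\<integral>w. real (N R w choose 2) \<partial>M)"
proof -
  let ?Z = "{w\<in>space M. 2 \<le> measure (H w) (hyp_shell R U)}"
  note [measurable] = measure_shell_measurable
  have Z: "?Z \<in> sets M" by measurable
  then have "prob ?Z = (\<integral>w. indicator ?Z w \<partial>M)" by simp
  also have "\<dots> \<le> (\<integral>w. real (N R w choose 2) \<partial>M)"
  proof (intro integral_mono binomial_integrable[OF assms])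
    show "integrable M (indicator ?Z :: _ \<Rightarrow> real)" using Z by (simp add: emeasure_eq_measure)
    fix w assume "w \<in> space M"
    show "indicator ?Z w \<le> real (N R w choose 2)"
    proof (cases "w \<in> ?Z")
      case True
      then have "2 \<le> N R w" using measure_shell_eq_N[OF \<open>w \<in> space M\<close>, of R] by simp
      then have "1 \<le> real (N R w choose 2)"
        using zero_less_binomial[of 2 "N R w"] by (simp add: Suc_le_eq)
      then show ?thesis using True by simp
    qed simp
  qed
  finally show ?thesis .
qed

theorem multiple_bound:
  assumes "\<Lambda>\<^sup>2 / 2 < x"
  shows "\<forall>\<^sub>F R in at_top. \<P>(w in M. 2 \<le> measure (H w) (hyp_shell R U)) < x"
proof -
  have "\<forall>\<^sub>F R in at_top. (\<integral>w. real (N R w choose 2) \<partial>M) < x"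
    using order_tendstoD(2)[OF binomial_moment_tendsto[of 2]] assms by (simp add: fact_2)
  then show ?thesis using eventually_large by eventually_elim (use multiple_le le_less_trans in blast)
qed

end

section \<open>Dyadic neighbourhoods in the vague topology\<close>

lemma continuous_map_measurable:
  assumes "continuous_map S T g"
  shows "g \<in> measurable (borel_of_topology S) (borel_of_topology T)"
  unfolding borel_of_topology_def[of T]
proof (rule measurable_measure_of)
  show "{U. openin T U} \<subseteq> Pow (topspace T)" by (auto dest: openin_subset)
  show "g \<in> space (borel_of_topology S) \<rightarrow> topspace T" using continuous_map_funspace[OF assms] by simp
  fix U assume "U \<in> {U. openin T U}"
  then have "openin S {x \<in> topspace S. g x \<in> U}" using openin_continuous_map_preimage[OF assms] by simp
  moreover have "g -` U \<inter> space (borel_of_topology S) = {x \<in> topspace S. g x \<in> U}" by auto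
  moreover have "{U. openin S U} \<subseteq> Pow (topspace S)" by (auto dest: openin_subset)
  ultimately show "g -` U \<inter> space (borel_of_topology S) \<in> sets (borel_of_topology S)"
    by (simp add: borel_of_topology_def sets_measure_of)
qed

lemma continuous_map_real_measurable:
  fixes \<phi> :: "'b \<Rightarrow> real"
  assumes "continuous_map T euclideanreal \<phi>"
  shows "\<phi> \<in> borel_measurable (borel_of_topology T)"
proof (rule borel_measurableI)
  fix S :: "real set" assume "open S"
  then have "openin T {x \<in> topspace T. \<phi> x \<in> S}"
    using openin_continuous_map_preimage[OF assms, of S] by (simp add: open_openin[symmetric])
  moreover have "\<phi> -` S \<inter> space (borel_of_topology T) = {x \<in> topspace T. \<phi> x \<in> S}" by auto
  moreover have "{U. openin T U} \<subseteq> Pow (topspace T)" by (auto dest: openin_subset)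
  ultimately show "\<phi> -` S \<inter> space (borel_of_topology T) \<in> sets (borel_of_topology T)"
    by (simp add: borel_of_topology_def sets_measure_of)
qed

definition dcell :: "nat \<Rightarrow> int \<Rightarrow> real set" where "dcell L j = {x. \<lfloor>2 ^ L * x\<rfloor> = j}"

text \<open>One parameter serves as depth and as half-width of the window: as \<open>L\<close> grows
  the cells shrink while together they exhaust the line.\<close>

definition dcells :: "nat \<Rightarrow> int set" where "dcells L = {- (int L * 2 ^ L)..<int L * 2 ^ L}"

abbreviation same_counts :: "nat \<Rightarrow> real measure \<Rightarrow> real measure \<Rightarrow> bool" where
  "same_counts L \<eta> \<xi> \<equiv> \<forall>j\<in>dcells L. measure \<eta> (dcell L j) = measure \<xi> (dcell L j)"

lemma dcell_eq: "dcell L j = {of_int j / 2 ^ L..<of_int (j + 1) / 2 ^ L}"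
proof (rule Set.set_eqI)
  fix x :: real
  have "x \<in> dcell L j \<longleftrightarrow> of_int j \<le> 2 ^ L * x \<and> 2 ^ L * x < of_int j + 1"
    by (simp add: dcell_def floor_eq_iff)
  also have "\<dots> \<longleftrightarrow> of_int j / 2 ^ L \<le> x \<and> x < (of_int j + 1) / 2 ^ L"
    by (simp add: pos_divide_le_eq pos_less_divide_eq mult.commute)
  finally show "x \<in> dcell L j \<longleftrightarrow> x \<in> {of_int j / 2 ^ L..<of_int (j + 1) / 2 ^ L}" by simp
qed

lemma finite_dcells [simp]: "finite (dcells L)" by (simp add: dcells_def)

lemma card_dcells: "real (card (dcells L)) = 2 * real L * 2 ^ L"
proof -
  have "card (dcells L) = nat (int L * 2 ^ L - (- (int L * 2 ^ L)))"
    unfolding dcells_def by (rule card_atLeastLessThan_int)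
  also have "int L * 2 ^ L - (- (int L * 2 ^ L)) = int (2 * L * 2 ^ L)" by simp
  finally have "card (dcells L) = 2 * L * 2 ^ L" by (simp only: nat_int)
  then show ?thesis by simp
qed

lemma dcell_borel [measurable, simp]: "dcell L j \<in> sets borel" by (simp add: dcell_eq)

lemma disjoint_dcells: "disjoint_family_on (dcell L) S" by (auto simp: disjoint_family_on_def dcell_def)

text \<open>The half-width \<open>m\<close> is independent of the depth, because the support of a
  test function stays fixed while the cells shrink.\<close>

lemma UN_dcell: "(\<Union>j\<in>{- (int m * 2 ^ L)..<int m * 2 ^ L}. dcell L j) = {- real m..<real m}"
proof -
  have "- (int m * 2 ^ L) \<le> \<lfloor>2 ^ L * x\<rfloor> \<longleftrightarrow> - real m \<le> x" for x :: real
  proof -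
    have "- (int m * 2 ^ L) \<le> \<lfloor>2 ^ L * x\<rfloor> \<longleftrightarrow> 2 ^ L * (- real m) \<le> 2 ^ L * x"
      by (simp add: le_floor_iff mult.commute)
    then show ?thesis using mult_le_cancel_left_pos[of "2 ^ L" "- real m" x] by (simp only:) simp
  qed
  moreover have "\<lfloor>2 ^ L * x\<rfloor> < int m * 2 ^ L \<longleftrightarrow> x < real m" for x :: real
  proof -
    have "\<lfloor>2 ^ L * x\<rfloor> < int m * 2 ^ L \<longleftrightarrow> 2 ^ L * x < 2 ^ L * real m"
      by (simp add: floor_less_iff mult.commute)
    then show ?thesis using mult_less_cancel_left_pos[of "2 ^ L" x "real m"] by (simp only:) simp
  qed
  ultimately show ?thesis by (auto simp: dcell_def)
qed

lemma bounded_precompact_Borel: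
  assumes "B \<in> sets borel" "B \<subseteq> {a..<b::real}"
  shows "B \<in> precompact_Borel UNIV"
proof -
  have "B \<subseteq> {a..b}" using assms(2) atLeastLessThan_subseteq_atLeastAtMost_iff[of a b a b] by blast
  then have "compact {a..b} \<and> B \<subseteq> {a..b} \<and> {a..b} \<subseteq> UNIV" by simp
  moreover have "B \<in> sets (restrict_space borel UNIV)" using assms(1) by (simp add: sets_restrict_space)
  ultimately show ?thesis unfolding precompact_Borel_def by blast
qed

lemma dcell_precompact [simp]: "dcell L j \<in> precompact_Borel UNIV"
proof (rule bounded_precompact_Borel)
  show "dcell L j \<subseteq> {of_int j / 2 ^ L..<of_int (j + 1) / 2 ^ L}" unfolding dcell_eq ..
qed simp

lemma sets_Conf_UNIV: "\<xi> \<in> Conf UNIV \<Longrightarrow> sets \<xi> = sets borel"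
proof -
  assume "\<xi> \<in> Conf UNIV"
  then have "sets \<xi> = sets (restrict_space borel UNIV)" by (rule sets_Conf)
  also have "\<dots> = sets borel" by (simp add: sets_restrict_space)
  finally show ?thesis .
qed

text \<open>A test function is replaced by its value at the left end point of each cell. The error
  is at most the oscillation times the number of points in the window, and the replacement is
  determined by the dyadic counts.\<close>

lemma integral_dyadic_approx:
  fixes f :: "real \<Rightarrow> real"
  assumes \<xi>: "\<xi> \<in> Conf UNIV" and f: "f \<in> borel_measurable borel" and \<omega>: "0 \<le> \<omega>"
    and near: "\<And>x. \<bar>f x - f (of_int \<lfloor>2 ^ L * x\<rfloor> / 2 ^ L)\<bar> \<le> \<omega> * indicator {- real m..<real m} x"
    and supp: "\<And>x. x \<notin> {- real m..<real m} \<Longrightarrow> f (of_int \<lfloor>2 ^ L * x\<rfloor> / 2 ^ L) = 0"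
  shows "\<bar>(\<integral>x. f x \<partial>\<xi>) - (\<Sum>j\<in>{- (int m * 2 ^ L)..<int m * 2 ^ L}. f (of_int j / 2 ^ L) * measure \<xi> (dcell L j))\<bar>
    \<le> \<omega> * measure \<xi> {- real m..<real m}"
proof -
  let ?J = "{- (int m * 2 ^ L)..<int m * 2 ^ L}" and ?B = "{- real m..<real m}"
  let ?g = "\<lambda>x. \<Sum>j\<in>?J. f (of_int j / 2 ^ L) * indicator (dcell L j) x"
  have fin: "emeasure \<xi> A < \<infinity>" if "A \<in> precompact_Borel UNIV" for A using \<xi> that by (simp add: Conf_def)
  have B: "?B \<in> precompact_Borel UNIV" by (rule bounded_precompact_Borel) auto
  have int_ind: "integrable \<xi> (indicator A :: real \<Rightarrow> real)" if "A \<in> precompact_Borel UNIV" for A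
    using fin[OF that] precompact_BorelD(1)[OF that] sets_Conf[OF \<xi>] by simp
  have g: "f (of_int \<lfloor>2 ^ L * x\<rfloor> / 2 ^ L) = ?g x" for x
  proof (cases "x \<in> ?B")
    case True
    then have "\<lfloor>2 ^ L * x\<rfloor> \<in> ?J" using UN_dcell[where m=m and L=L] by (auto simp: dcell_def)
    moreover have "?g x = (\<Sum>j\<in>?J. if j = \<lfloor>2 ^ L * x\<rfloor> then f (of_int \<lfloor>2 ^ L * x\<rfloor> / 2 ^ L) else 0)"
      by (rule sum.cong) (auto simp: dcell_def)
    ultimately show ?thesis by simp
  next
    case False
    then have "x \<notin> dcell L j" if "j \<in> ?J" for j using UN_dcell[where m=m and L=L] that by blast
    then have "?g x = 0" by (intro sum.neutral) auto
    then show ?thesis using supp[OF False] by simp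
  qed
  have f_meas: "f \<in> borel_measurable \<xi>" using f measurable_cong_sets[OF sets_Conf_UNIV[OF \<xi>] refl] by blast
  have int_g: "integrable \<xi> ?g" by (intro Bochner_Integration.integrable_sum integrable_mult_right int_ind) simp
  have int_d: "integrable \<xi> (\<lambda>x. f x - ?g x)"
  proof (rule Bochner_Integration.integrable_bound)
    show "integrable \<xi> (\<lambda>x. \<omega> * indicator ?B x)" by (intro integrable_mult_right int_ind B)
    show "(\<lambda>x. f x - ?g x) \<in> borel_measurable \<xi>" using f_meas borel_measurable_integrable[OF int_g] by simp
    show "AE x in \<xi>. norm (f x - ?g x) \<le> norm (\<omega> * indicator ?B x)"
      using near \<omega> by (intro AE_I2) (simp add: g[symmetric])
  qed
  have "(\<integral>x. f x \<partial>\<xi>) = (\<integral>x. (f x - ?g x) + ?g x \<partial>\<xi>)" by simp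
  also have "\<dots> = (\<integral>x. f x - ?g x \<partial>\<xi>) + (\<integral>x. ?g x \<partial>\<xi>)"
    by (rule Bochner_Integration.integral_add[OF int_d int_g])
  also have "(\<integral>x. ?g x \<partial>\<xi>) = (\<Sum>j\<in>?J. f (of_int j / 2 ^ L) * measure \<xi> (dcell L j))"
  proof (subst Bochner_Integration.integral_sum)
    show "integrable \<xi> (\<lambda>x. f (of_int j / 2 ^ L) * indicator (dcell L j) x)" for j
      by (intro integrable_mult_right int_ind) simp
    have "dcell L j \<inter> space \<xi> = dcell L j" for j using sets_eq_imp_space_eq[OF sets_Conf_UNIV[OF \<xi>]] by simp
    then show "(\<Sum>j\<in>?J. \<integral>x. f (of_int j / 2 ^ L) * indicator (dcell L j) x \<partial>\<xi>) = (\<Sum>j\<in>?J. f (of_int j / 2 ^ L) * measure \<xi> (dcell L j))"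
      by simp
  qed
  finally have "\<bar>(\<integral>x. f x \<partial>\<xi>) - (\<Sum>j\<in>?J. f (of_int j / 2 ^ L) * measure \<xi> (dcell L j))\<bar> = norm (\<integral>x. f x - ?g x \<partial>\<xi>)" by simp
  also have "\<dots> \<le> (\<integral>x. norm (f x - ?g x) \<partial>\<xi>)" by (rule integral_norm_bound)
  also have "\<dots> \<le> (\<integral>x. \<omega> * indicator ?B x \<partial>\<xi>)"
    using near by (intro integral_mono integrable_norm int_d integrable_mult_right int_ind B) (simp add: g[symmetric])
  also have "\<dots> = \<omega> * measure \<xi> ?B"
  proof -
    have "?B \<inter> space \<xi> = ?B" using sets_eq_imp_space_eq[OF sets_Conf_UNIV[OF \<xi>]] by simp
    then show ?thesis by simp
  qed
  finally show ?thesis .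
qed

text \<open>Equal dyadic counts give equal step function integrals and equally many points in the
  window. The second fact makes the error for \<open>\<eta>\<close> controllable by the count of
  \<open>\<xi>\<close> alone, so one threshold serves all \<open>\<eta>\<close>.\<close>

lemma Cc_dyadic_approx:
  assumes f: "f \<in> Cc (UNIV::real set)" and \<xi>: "\<xi> \<in> Conf UNIV" and \<epsilon>: "0 < \<epsilon>"
  shows "\<exists>L0. \<forall>L\<ge>L0. \<forall>\<eta>\<in>Conf UNIV. same_counts L \<eta> \<xi> \<longrightarrow>
    \<bar>(\<integral>x. f x \<partial>\<eta>) - (\<integral>x. f x \<partial>\<xi>)\<bar> < \<epsilon>"
proof -
  obtain C where cont: "continuous_on UNIV f" and C: "compact C" "\<And>x. x \<notin> C \<Longrightarrow> f x = 0"
    using f by (auto simp: Cc_def)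
  obtain b where b: "\<And>x. x \<in> C \<Longrightarrow> \<bar>x\<bar> \<le> b" using compact_imp_bounded[OF C(1)] by (auto simp: bounded_real)
  obtain p :: nat where p: "b < real p" using reals_Archimedean2 by blast
  \<comment> \<open>One unit of margin: the left end point of a cell containing a point outside the
    window still lies where \<open>f\<close> vanishes.\<close>
  define m where "m = Suc p"
  have f0: "f x = 0" if "real p \<le> \<bar>x\<bar>" for x using C(2) b[of x] p that by force
  let ?B = "{- real m..<real m}"
  have B: "?B \<in> precompact_Borel UNIV" by (rule bounded_precompact_Borel) auto
  \<comment> \<open>The 2 accounts for the two approximations, of \<open>\<eta>\<close> and of
    \<open>\<xi>\<close>; the summand 1 keeps the denominator positive and the final inequality
    strict.\<close>
  define \<omega> where "\<omega> = \<epsilon> / (2 * (measure \<xi> ?B + 1))"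
  have \<omega>: "0 < \<omega>" using \<epsilon> by (simp add: \<omega>_def add_nonneg_pos)
  have "uniformly_continuous_on {- real m..real m} f"
    by (intro compact_uniformly_continuous continuous_on_subset[OF cont]) auto
  then obtain d where d: "0 < d" "\<And>x y. x \<in> {- real m..real m} \<Longrightarrow> y \<in> {- real m..real m} \<Longrightarrow> dist x y < d \<Longrightarrow> dist (f x) (f y) < \<omega>"
    using \<omega> unfolding uniformly_continuous_on_def by metis
  obtain n0 where n0: "1 / d < 2 ^ n0" using real_arch_pow[of 2 "1/d"] by auto
  \<comment> \<open>From \<open>n0\<close> on the mesh is below the modulus of continuity; from
    \<open>m\<close> on the cells of the window belong to \<open>dcells L\<close>.\<close>
  define L0 where "L0 = max m n0"
  have *: "\<bar>(\<integral>x. f x \<partial>\<eta>) - (\<integral>x. f x \<partial>\<xi>)\<bar> < \<epsilon>"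
    if L: "L0 \<le> L" and \<eta>: "\<eta> \<in> Conf UNIV" and eq: "same_counts L \<eta> \<xi>" for L \<eta>
  proof -
    let ?J = "{- (int m * 2 ^ L)..<int m * 2 ^ L}"
    have "2 ^ n0 \<le> (2::real) ^ L" using L by (intro power_increasing) (auto simp: L0_def)
    then have "1 / d < 2 ^ L" using n0 by linarith
    then have small: "1 / 2 ^ L < d" using d(1) by (simp add: field_simps)
    have fl: "of_int \<lfloor>2 ^ L * x\<rfloor> / 2 ^ L \<le> x" "x < of_int \<lfloor>2 ^ L * x\<rfloor> / 2 ^ L + 1 / 2 ^ L" for x :: real
    proof -
      show "of_int \<lfloor>2 ^ L * x\<rfloor> / 2 ^ L \<le> x" using of_int_floor_le[of "2 ^ L * x"] by (simp add: divide_le_eq mult.commute)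
      have "2 ^ L * x < of_int \<lfloor>2 ^ L * x\<rfloor> + 1" by linarith
      then show "x < of_int \<lfloor>2 ^ L * x\<rfloor> / 2 ^ L + 1 / 2 ^ L" by (simp add: add_divide_distrib[symmetric] less_divide_eq mult.commute)
    qed
    have one: "1 / 2 ^ L \<le> (1::real)" by simp
    have supp: "f (of_int \<lfloor>2 ^ L * x\<rfloor> / 2 ^ L) = 0" if "x \<notin> ?B" for x
    proof (rule f0)
      have "\<not> (- real m \<le> x \<and> x < real m)" using that by simp
      then show "real p \<le> \<bar>of_int \<lfloor>2 ^ L * x\<rfloor> / 2 ^ L\<bar>"
        using fl[of x] one unfolding m_def of_nat_Suc by linarith
    qed
    have near: "\<bar>f x - f (of_int \<lfloor>2 ^ L * x\<rfloor> / 2 ^ L)\<bar> \<le> \<omega> * indicator ?B x" for x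
    proof (cases "x \<in> ?B")
      case True
      let ?y = "of_int \<lfloor>2 ^ L * x\<rfloor> / 2 ^ L :: real"
      have "2 ^ L * (- real m) \<le> 2 ^ L * x" using True by (intro mult_left_mono) auto
      then have "of_int (- (int m * 2 ^ L)) \<le> 2 ^ L * x" by (simp add: mult.commute)
      then have "- (int m * 2 ^ L) \<le> \<lfloor>2 ^ L * x\<rfloor>" by (simp only: le_floor_iff)
      then have "real_of_int (- (int m * 2 ^ L)) \<le> of_int \<lfloor>2 ^ L * x\<rfloor>" by (simp only: of_int_le_iff)
      then have "- real m \<le> ?y" by (simp add: le_divide_eq)
      moreover have "?y \<le> real m" using fl(1)[of x] True by simp
      moreover have "dist x ?y < d" using fl[of x] small by (simp add: dist_real_def)
      ultimately have "dist (f x) (f ?y) < \<omega>" using True by (intro d(2)) auto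
      then show ?thesis using True by (simp add: dist_real_def)
    next
      case False
      then have "f x = 0" by (intro f0) (auto simp: m_def)
      then show ?thesis using supp[OF False] False by simp
    qed
    have f_meas: "f \<in> borel_measurable borel" using cont by (rule borel_measurable_continuous_onI)
    have approx: "\<bar>(\<integral>x. f x \<partial>\<eta>') - (\<Sum>j\<in>?J. f (of_int j / 2 ^ L) * measure \<eta>' (dcell L j))\<bar> \<le> \<omega> * measure \<eta>' ?B"
      if "\<eta>' \<in> Conf UNIV" for \<eta>'
      using that f_meas less_imp_le[OF \<omega>] near by (rule integral_dyadic_approx) (rule supp)
    have "?J \<subseteq> dcells L" using L by (auto simp: dcells_def L0_def intro: order_trans mult_right_mono less_le_trans)
    then have eqJ: "measure \<eta> (dcell L j) = measure \<xi> (dcell L j)" if "j \<in> ?J" for j using eq that by blast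
    have count: "measure \<eta>' ?B = (\<Sum>j\<in>?J. measure \<eta>' (dcell L j))" if "\<eta>' \<in> Conf UNIV" for \<eta>'
      unfolding UN_dcell[where m=m and L=L, symmetric] by (rule measure_Conf_UN[OF that]) (auto simp: disjoint_dcells)
    have B_eq: "measure \<eta> ?B = measure \<xi> ?B" using count[OF \<eta>] count[OF \<xi>] eqJ by simp
    have "(\<Sum>j\<in>?J. f (of_int j / 2 ^ L) * measure \<eta> (dcell L j)) = (\<Sum>j\<in>?J. f (of_int j / 2 ^ L) * measure \<xi> (dcell L j))"
      by (rule sum.cong) (auto simp: eqJ)
    then have "\<bar>(\<integral>x. f x \<partial>\<eta>) - (\<integral>x. f x \<partial>\<xi>)\<bar> \<le> 2 * \<omega> * measure \<xi> ?B"
      using approx[OF \<eta>, unfolded B_eq] approx[OF \<xi>] by linarith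
    also have "\<dots> < 2 * \<omega> * (measure \<xi> ?B + 1)" using \<omega> by (intro mult_strict_left_mono) auto
    also have "\<dots> = \<epsilon>" using measure_nonneg[of \<xi> ?B] by (simp add: \<omega>_def field_simps add_nonneg_eq_0_iff)
    finally show ?thesis .
  qed
  then show ?thesis by blast
qed

text \<open>Induction over the generation of the topology: basic sets are handled by the
  approximation of test functions, and a binary intersection takes the larger threshold. The sets of
  configurations with prescribed counts need not themselves be vaguely open, as counts jump when a
  point crosses the end of a cell.\<close>

lemma vague_open_contains_dyadic:
  assumes W: "openin (vague_topology UNIV) W" and \<xi>: "\<xi> \<in> W"
  shows "\<exists>L0. \<forall>L\<ge>L0. \<forall>\<eta>\<in>Conf (UNIV::real set). same_counts L \<eta> \<xi> \<longrightarrow> \<eta> \<in> W"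
proof -
  have "generate_topology_on {{\<xi> \<in> Conf (UNIV::real set). (\<integral>x. f x \<partial>\<xi>) \<in> U} | f U. f \<in> Cc UNIV \<and> open U} W"
    using W unfolding vague_topology_def openin_topology_generated_by_iff .
  then show ?thesis using \<xi>
  proof (induction arbitrary: \<xi>)
    case Empty
    then show ?case by simp
  next
    case (Int a b)
    obtain L1 where L1: "\<forall>L\<ge>L1. \<forall>\<eta>\<in>Conf (UNIV::real set). same_counts L \<eta> \<xi> \<longrightarrow> \<eta> \<in> a"
      using Int.IH(1) Int.prems by blast
    obtain L2 where L2: "\<forall>L\<ge>L2. \<forall>\<eta>\<in>Conf (UNIV::real set). same_counts L \<eta> \<xi> \<longrightarrow> \<eta> \<in> b"
      using Int.IH(2) Int.prems by blast
    show ?case using L1 L2 by (intro exI[of _ "max L1 L2"]) auto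
  next
    case (UN K)
    then obtain k where k: "k \<in> K" "\<xi> \<in> k" by blast
    from UN.IH[OF this] show ?case using k(1) by blast
  next
    case (Basis s)
    then obtain f U where s: "s = {\<xi> \<in> Conf (UNIV::real set). (\<integral>x. f x \<partial>\<xi>) \<in> U}" "f \<in> Cc UNIV" "open U" by blast
    with Basis.prems have \<xi>: "\<xi> \<in> Conf UNIV" "(\<integral>x. f x \<partial>\<xi>) \<in> U" by auto
    obtain \<epsilon> where \<epsilon>: "0 < \<epsilon>" "\<And>y. dist y (\<integral>x. f x \<partial>\<xi>) < \<epsilon> \<Longrightarrow> y \<in> U"
      using s(3) \<xi>(2) unfolding open_dist by blast
    obtain L0 where "\<forall>L\<ge>L0. \<forall>\<eta>\<in>Conf UNIV. same_counts L \<eta> \<xi> \<longrightarrow>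
      \<bar>(\<integral>x. f x \<partial>\<eta>) - (\<integral>x. f x \<partial>\<xi>)\<bar> < \<epsilon>"
      using Cc_dyadic_approx[OF s(2) \<xi>(1) \<epsilon>(1)] by blast
    then show ?case using \<epsilon>(2) by (intro exI[of _ L0]) (simp add: s(1) dist_real_def)
  qed
qed

section \<open>Convergence in law from avoidance probabilities\<close>

text \<open>One step of inclusion-exclusion, trading a negated event for a difference of
  probabilities with fewer negations.\<close>

lemma (in prob_space) prob_insert_negated:
  assumes e: "\<And>j. j \<in> C \<Longrightarrow> {w\<in>space M. e j w} \<in> sets M"
    and C: "finite C" "V \<subseteq> C" "insert s S \<subseteq> C"
  shows "\<P>(w in M. (\<forall>j\<in>V. e j w) \<and> (\<forall>j\<in>insert s S. \<not> e j w))
    = \<P>(w in M. (\<forall>j\<in>V. e j w) \<and> (\<forall>j\<in>S. \<not> e j w))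
      - \<P>(w in M. (\<forall>j\<in>insert s V. e j w) \<and> (\<forall>j\<in>S. \<not> e j w))"
proof -
  let ?A = "\<lambda>V S. {w\<in>space M. (\<forall>j\<in>V. e j w) \<and> (\<forall>j\<in>S. \<not> e j w)}"
  have A: "?A V S \<in> sets M" if "V \<subseteq> C" "S \<subseteq> C" for V S
  proof -
    have fin: "finite V" "finite S" using that C(1) finite_subset by auto
    have "{w\<in>space M. \<forall>j\<in>V. e j w} \<in> sets M" using e that fin by (intro sets.sets_Collect_finite_All) auto
    moreover have "{w\<in>space M. \<forall>j\<in>S. \<not> e j w} \<in> sets M"
      using e that fin by (intro sets.sets_Collect_finite_All sets.sets_Collect_neg) auto
    ultimately show ?thesis by (rule sets.sets_Collect_conj[rotated])
  qed
  have "?A V (insert s S) = ?A V S - ?A (insert s V) S" by auto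
  moreover have sub: "S \<subseteq> C" "insert s V \<subseteq> C" using C by auto
  ultimately show ?thesis using finite_measure_Diff[OF A[OF C(2) sub(1)] A[OF sub(2,1)]] by auto
qed

text \<open>Removing negations one at a time expresses the probability of an exact occupancy pattern
  through avoidance probabilities only. The induction must let \<open>V\<close> vary, because a
  removed negation reappears in it as a positive condition.\<close>

lemma occupied_prob_tendsto:
  fixes M :: "'p measure" and N :: "'q measure" and e :: "'r \<Rightarrow> 'i \<Rightarrow> 'p \<Rightarrow> bool" and e' :: "'i \<Rightarrow> 'q \<Rightarrow> bool"
  assumes M: "prob_space M" and N: "prob_space N"
    and e: "\<And>R j. j \<in> C \<Longrightarrow> {w\<in>space M. e R j w} \<in> sets M" and e': "\<And>j. j \<in> C \<Longrightarrow> {w\<in>space N. e' j w} \<in> sets N"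
    and avoid: "\<And>V. V \<subseteq> C \<Longrightarrow> ((\<lambda>R. \<P>(w in M. \<forall>j\<in>V. e R j w)) \<longlongrightarrow> \<P>(w in N. \<forall>j\<in>V. e' j w)) F"
    and S: "finite S" and C: "finite C" "S \<subseteq> C" "V \<subseteq> C"
  shows "((\<lambda>R. \<P>(w in M. (\<forall>j\<in>V. e R j w) \<and> (\<forall>j\<in>S. \<not> e R j w)))
    \<longlongrightarrow> \<P>(w in N. (\<forall>j\<in>V. e' j w) \<and> (\<forall>j\<in>S. \<not> e' j w))) F"
  using S C(2,3)
proof (induction S arbitrary: V)
  case empty
  then show ?case using avoid[of V] by simp
next
  case (insert s S)
  have sub: "S \<subseteq> C" "insert s V \<subseteq> C" using insert.prems by auto
  note M_eq = prob_space.prob_insert_negated[OF M _ C(1) insert.prems(2,1), of "e R" for R, OF e]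
  note N_eq = prob_space.prob_insert_negated[OF N _ C(1) insert.prems(2,1), of e', OF e']
  show ?case
    by (subst M_eq, assumption, subst N_eq, assumption) (intro tendsto_diff insert.IH sub insert.prems)
qed

definition occupied :: "nat \<Rightarrow> real measure \<Rightarrow> int set" where
  "occupied L \<xi> = {j \<in> dcells L. measure \<xi> (dcell L j) \<noteq> 0}"

definition crowded :: "nat \<Rightarrow> real measure \<Rightarrow> bool" where
  "crowded L \<xi> \<longleftrightarrow> (\<exists>j\<in>dcells L. 2 \<le> measure \<xi> (dcell L j))"

text \<open>Inserting the bound \<open>B\<close> avoids the infimum of an empty set.\<close>

definition lower_envelope :: "(real measure \<Rightarrow> real) \<Rightarrow> real \<Rightarrow> nat \<Rightarrow> int set \<Rightarrow> real" where
  "lower_envelope \<phi> B L S = Inf (insert B {\<phi> \<eta> | \<eta>. \<eta> \<in> Conf UNIV \<and> (\<forall>j\<in>dcells L. measure \<eta> (dcell L j) = of_bool (j \<in> S))})"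

text \<open>Without a doubly occupied cell, the set of occupied cells encodes all the counts of that
  level.\<close>

lemma not_crowded_measure:
  assumes "\<xi> \<in> Conf UNIV" "\<not> crowded L \<xi>" "j \<in> dcells L"
  shows "measure \<xi> (dcell L j) = of_bool (j \<in> occupied L \<xi>)"
proof -
  obtain n :: nat where n: "measure \<xi> (dcell L j) = real n" using Conf_count[OF assms(1) dcell_precompact] by metis
  moreover have "real n < 2" using n assms(2,3) by (auto simp: crowded_def not_le)
  then have "n < 2" by simp
  then have "n = 0 \<or> n = 1" by auto
  ultimately show ?thesis using assms(3) by (auto simp: occupied_def)
qed

locale bounded_functional =
  fixes \<phi> :: "real measure \<Rightarrow> real" and B :: real
  assumes \<phi>: "continuous_map (vague_topology UNIV) euclideanreal \<phi>"
    and B: "\<And>\<xi>. \<xi> \<in> Conf UNIV \<Longrightarrow> \<bar>\<phi> \<xi>\<bar> \<le> B" "0 \<le> B"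
begin

lemma envelope_set_bounds:
  "x \<in> insert B {\<phi> \<eta> | \<eta>. \<eta> \<in> Conf UNIV \<and> (\<forall>j\<in>dcells L. measure \<eta> (dcell L j) = of_bool (j \<in> S))} \<Longrightarrow> - B \<le> x"
  using B by (auto simp: abs_le_iff) (smt (verit) B)

lemma lower_envelope_bounds: "\<bar>lower_envelope \<phi> B L S\<bar> \<le> B"
proof -
  have "lower_envelope \<phi> B L S \<le> B"
    unfolding lower_envelope_def by (rule cInf_lower[OF insertI1 bdd_belowI]) (rule envelope_set_bounds)
  moreover have "- B \<le> lower_envelope \<phi> B L S"
    unfolding lower_envelope_def by (rule cInf_greatest[OF insert_not_empty]) (rule envelope_set_bounds)
  ultimately show ?thesis by simp
qed

lemma lower_envelope_le:
  assumes "\<xi> \<in> Conf UNIV" "\<not> crowded L \<xi>"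
  shows "lower_envelope \<phi> B L (occupied L \<xi>) \<le> \<phi> \<xi>"
  unfolding lower_envelope_def
proof (rule cInf_lower)
  show "\<phi> \<xi> \<in> insert B {\<phi> \<eta> | \<eta>. \<eta> \<in> Conf UNIV \<and> (\<forall>j\<in>dcells L. measure \<eta> (dcell L j) = of_bool (j \<in> occupied L \<xi>))}"
    using assms not_crowded_measure by blast
qed (rule bdd_belowI, rule envelope_set_bounds)

text \<open>The set where \<open>\<phi>\<close> exceeds \<open>\<phi> \<xi> - \<epsilon>\<close> is
  vaguely open, so for deep levels it contains every configuration with the dyadic counts of
  \<open>\<xi>\<close>; these are all the competitors in the infimum.\<close>

lemma lower_envelope_ge:
  assumes \<xi>: "\<xi> \<in> Conf UNIV" and \<epsilon>: "0 < \<epsilon>"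
  shows "\<exists>L0. \<forall>L\<ge>L0. \<not> crowded L \<xi> \<longrightarrow> \<phi> \<xi> - \<epsilon> \<le> lower_envelope \<phi> B L (occupied L \<xi>)"
proof -
  let ?W = "{\<eta> \<in> Conf UNIV. \<phi> \<eta> \<in> {\<phi> \<xi> - \<epsilon><..}}"
  have "openin euclideanreal {\<phi> \<xi> - \<epsilon><..}" by (simp add: open_openin[symmetric])
  then have "openin (vague_topology UNIV) {\<eta> \<in> topspace (vague_topology UNIV). \<phi> \<eta> \<in> {\<phi> \<xi> - \<epsilon><..}}"
    by (rule openin_continuous_map_preimage[OF \<phi>])
  then have W: "openin (vague_topology UNIV) ?W" by simp
  have "\<xi> \<in> ?W" using \<xi> \<epsilon> by simp
  from vague_open_contains_dyadic[OF W this] obtain L0 where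
    L0: "\<And>L \<eta>. L0 \<le> L \<Longrightarrow> \<eta> \<in> Conf UNIV \<Longrightarrow> same_counts L \<eta> \<xi> \<Longrightarrow> \<eta> \<in> ?W"
    by blast
  have "\<phi> \<xi> - \<epsilon> \<le> lower_envelope \<phi> B L (occupied L \<xi>)" if "L0 \<le> L" "\<not> crowded L \<xi>" for L
    unfolding lower_envelope_def
  proof (rule cInf_greatest)
    fix x assume "x \<in> insert B {\<phi> \<eta> | \<eta>. \<eta> \<in> Conf UNIV \<and> (\<forall>j\<in>dcells L. measure \<eta> (dcell L j) = of_bool (j \<in> occupied L \<xi>))}"
    then consider "x = B" | \<eta> where "x = \<phi> \<eta>" "\<eta> \<in> Conf UNIV" "\<forall>j\<in>dcells L. measure \<eta> (dcell L j) = of_bool (j \<in> occupied L \<xi>)"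
      by blast
    then show "\<phi> \<xi> - \<epsilon> \<le> x"
    proof cases
      case 1
      \<comment> \<open>The inserted value \<open>B\<close> does no harm, since it is an upper bound
        of \<open>\<phi>\<close>.\<close>
      then show ?thesis using B(1)[OF \<xi>] \<epsilon> by linarith
    next
      case 2
      have "same_counts L \<eta> \<xi>"
        using 2(3) not_crowded_measure[OF \<xi> that(2)] by simp
      then have "\<eta> \<in> ?W" by (rule L0[OF that(1) 2(2)])
      then show ?thesis using 2(1) by simp
    qed
  qed simp
  then show ?thesis by blast
qed

end

locale dyadic_counts = prob_space M for M :: "'p measure" +
  fixes Y :: "'p \<Rightarrow> real measure"
  assumes count_measurable: "(\<lambda>w. measure (Y w) (dcell L j)) \<in> borel_measurable M"
begin

lemma occupied_sets: "{w\<in>space M. occupied L (Y w) = S} \<in> sets M"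
proof -
  note [measurable] = count_measurable
  have "{w\<in>space M. occupied L (Y w) = S} = (if S \<subseteq> dcells L
      then {w\<in>space M. \<forall>j\<in>dcells L. (measure (Y w) (dcell L j) \<noteq> 0) = (j \<in> S)} else {})"
    by (auto simp: occupied_def)
  moreover have "{w\<in>space M. \<forall>j\<in>dcells L. (measure (Y w) (dcell L j) \<noteq> 0) = (j \<in> S)} \<in> sets M"
    by (intro sets.sets_Collect_finite_All finite_dcells) measurable
  ultimately show ?thesis by simp
qed

lemma crowded_sets: "{w\<in>space M. crowded L (Y w)} \<in> sets M"
proof -
  note [measurable] = count_measurable
  show ?thesis unfolding crowded_def by (intro sets.sets_Collect_finite_Ex finite_dcells) measurable
qed

lemma crowded_integrable: "integrable M (\<lambda>w. b * indicator {w\<in>space M. crowded L (Y w)} w :: real)"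
  by (intro integrable_mult_right integrable_real_indicator crowded_sets) (simp add: emeasure_eq_measure)

lemma prob_crowded_le:
  assumes "\<And>j. j \<in> dcells L \<Longrightarrow> \<P>(w in M. 2 \<le> measure (Y w) (dcell L j)) \<le> b"
  shows "\<P>(w in M. crowded L (Y w)) \<le> real (card (dcells L)) * b"
proof -
  note [measurable] = count_measurable
  have "{w\<in>space M. crowded L (Y w)} = (\<Union>j\<in>dcells L. {w\<in>space M. 2 \<le> measure (Y w) (dcell L j)})"
    by (auto simp: crowded_def)
  then have "\<P>(w in M. crowded L (Y w)) \<le> (\<Sum>j\<in>dcells L. \<P>(w in M. 2 \<le> measure (Y w) (dcell L j)))"
    by (simp only:) (intro finite_measure_subadditive_finite finite_dcells, auto)
  also have "\<dots> \<le> (\<Sum>j\<in>dcells L. b)" using assms by (intro sum_mono) auto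
  finally show ?thesis by simp
qed

text \<open>A level has finitely many patterns, so these expectations are finite linear combinations
  of pattern probabilities and converge along with them.\<close>

lemma integral_occupied:
  fixes g :: "int set \<Rightarrow> real"
  shows "integrable M (\<lambda>w. g (occupied L (Y w)))"
    and "(\<integral>w. g (occupied L (Y w)) \<partial>M) = (\<Sum>S\<in>Pow (dcells L). g S * \<P>(w in M. occupied L (Y w) = S))"
proof -
  have ind: "g (occupied L (Y w)) = (\<Sum>S\<in>Pow (dcells L). g S * indicator {w\<in>space M. occupied L (Y w) = S} w)"
    if "w\<in>space M" for w
  proof -
    have "(\<Sum>S\<in>Pow (dcells L). g S * indicator {w\<in>space M. occupied L (Y w) = S} w)
        = (\<Sum>S\<in>Pow (dcells L). if S = occupied L (Y w) then g S else 0)"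
      using that by (intro sum.cong) (auto simp: indicator_def)
    also have "\<dots> = g (occupied L (Y w))" by (subst sum.delta) (auto simp: occupied_def)
    finally show ?thesis by simp
  qed
  have int: "integrable M (\<lambda>w. g S * indicator {w\<in>space M. occupied L (Y w) = S} w)" for S
    by (intro integrable_mult_right integrable_real_indicator occupied_sets) (simp add: emeasure_eq_measure)
  show "integrable M (\<lambda>w. g (occupied L (Y w)))"
    by (rule iffD2[OF Bochner_Integration.integrable_cong[OF refl ind]]) (assumption, intro Bochner_Integration.integrable_sum int)
  show "(\<integral>w. g (occupied L (Y w)) \<partial>M) = (\<Sum>S\<in>Pow (dcells L). g S * \<P>(w in M. occupied L (Y w) = S))"
    by (subst Bochner_Integration.integral_cong[OF refl ind], assumption, subst Bochner_Integration.integral_sum[OF int])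
      (simp add: Int_absorb2 subset_iff)
qed

end

text \<open>The number \<open>\<beta> L\<close> bounds the probability that one given cell of level
  \<open>L\<close> is doubly occupied. Its decay against the number of cells expresses simplicity of
  the limit. For the approximating processes the bound holds only eventually, with a threshold that
  may depend on the cell.\<close>

locale convergent_avoidance =
  fixes M :: "'p measure" and Y :: "'r \<Rightarrow> 'p \<Rightarrow> real measure" and F :: "'r filter"
    and N :: "'q measure" and P :: "'q \<Rightarrow> real measure" and \<beta> :: "nat \<Rightarrow> real"
  assumes Y_counts: "\<And>R. dyadic_counts M (Y R)" and P_counts: "dyadic_counts N P"
    and Y: "\<And>R. Y R \<in> measurable M (borel_of_topology (vague_topology UNIV))"
    and P: "P \<in> measurable N (borel_of_topology (vague_topology UNIV))"
    and avoid: "\<And>L V. V \<subseteq> dcells L \<Longrightarrow>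
      ((\<lambda>R. \<P>(w in M. \<forall>j\<in>V. measure (Y R w) (dcell L j) = 0))
        \<longlongrightarrow> \<P>(w in N. \<forall>j\<in>V. measure (P w) (dcell L j) = 0)) F"
    and Y_multiple: "\<And>L j. \<forall>\<^sub>F R in F. \<P>(w in M. 2 \<le> measure (Y R w) (dcell L j)) \<le> \<beta> L"
    and P_multiple: "\<And>L j. \<P>(w in N. 2 \<le> measure (P w) (dcell L j)) \<le> \<beta> L"
    and \<beta>: "(\<lambda>L. real (card (dcells L)) * \<beta> L) \<longlonglongrightarrow> 0"
begin

sublocale M: dyadic_counts M "Y R" for R by (rule Y_counts)
sublocale N: dyadic_counts N P by (rule P_counts)

lemma prob_M: "prob_space M" and prob_N: "prob_space N"
  using Y_counts P_counts by (auto simp: dyadic_counts_def)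

lemma Y_Conf: "w\<in>space M \<Longrightarrow> Y R w \<in> Conf UNIV" using measurable_space[OF Y] by simp
lemma P_Conf: "w\<in>space N \<Longrightarrow> P w \<in> Conf UNIV" using measurable_space[OF P] by simp

lemma occupied_tendsto:
  assumes S: "S \<subseteq> dcells L"
  shows "((\<lambda>R. \<P>(w in M. occupied L (Y R w) = S)) \<longlongrightarrow> \<P>(w in N. occupied L (P w) = S)) F"
proof -
  have eq: "occupied L \<xi> = S \<longleftrightarrow> (\<forall>j\<in>dcells L - S. measure \<xi> (dcell L j) = 0) \<and> (\<forall>j\<in>S. measure \<xi> (dcell L j) \<noteq> 0)" for \<xi>
    using S by (auto simp: occupied_def)
  show ?thesis unfolding eq
  proof (rule occupied_prob_tendsto[OF prob_M prob_N, where C = "dcells L"])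
    note [measurable] = M.count_measurable N.count_measurable
    show "{w\<in>space M. measure (Y R w) (dcell L j) = 0} \<in> sets M" for R j by measurable
    show "{w\<in>space N. measure (P w) (dcell L j) = 0} \<in> sets N" for j by measurable
    show "finite S" by (rule finite_subset[OF S finite_dcells])
  qed (use S avoid in auto)
qed

lemma integral_occupied_tendsto:
  fixes g :: "int set \<Rightarrow> real"
  shows "((\<lambda>R. \<integral>w. g (occupied L (Y R w)) \<partial>M) \<longlongrightarrow> (\<integral>w. g (occupied L (P w)) \<partial>N)) F"
  unfolding M.integral_occupied(2) N.integral_occupied(2) by (intro tendsto_intros occupied_tendsto) auto

lemma crowded_Y: "\<forall>\<^sub>F R in F. \<P>(w in M. crowded L (Y R w)) \<le> real (card (dcells L)) * \<beta> L"
proof -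
  have "\<forall>\<^sub>F R in F. \<forall>j\<in>dcells L. \<P>(w in M. 2 \<le> measure (Y R w) (dcell L j)) \<le> \<beta> L"
    using Y_multiple by (intro eventually_ball_finite) auto
  then show ?thesis by eventually_elim (rule M.prob_crowded_le, blast)
qed

text \<open>The level \<open>L\<close> is chosen from the limit process alone; afterwards it stays
  fixed while \<open>R\<close> varies, so only finitely many pattern probabilities and cells are
  involved.\<close>

theorem integral_lower_bound:
  assumes \<phi>: "continuous_map (vague_topology UNIV) euclideanreal \<phi>" and bdd: "bounded (\<phi> ` Conf UNIV)" and \<epsilon>: "0 < \<epsilon>"
  shows "\<forall>\<^sub>F R in F. (\<integral>w. \<phi> (P w) \<partial>N) - \<epsilon> < (\<integral>w. \<phi> (Y R w) \<partial>M)"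
proof -
  obtain B0 where B0: "\<And>\<xi>. \<xi> \<in> Conf UNIV \<Longrightarrow> \<bar>\<phi> \<xi>\<bar> \<le> B0" using bdd by (auto simp: bounded_real)
  define B where "B = max B0 0"
  interpret bounded_functional \<phi> B
  proof
    show "\<bar>\<phi> \<xi>\<bar> \<le> B" if "\<xi> \<in> Conf UNIV" for \<xi> using B0[OF that] by (simp add: B_def)
  qed (auto simp: \<phi> B_def)
  let ?g = "\<lambda>L. lower_envelope \<phi> B L" and ?\<gamma> = "\<lambda>L. real (card (dcells L)) * \<beta> L"
  note meas_\<phi> = continuous_map_real_measurable[OF \<phi>]
  have \<phi>Y_meas: "(\<lambda>w. \<phi> (Y R w)) \<in> borel_measurable M" for R by (rule measurable_compose[OF Y meas_\<phi>])
  have \<phi>P_meas: "(\<lambda>w. \<phi> (P w)) \<in> borel_measurable N" by (rule measurable_compose[OF P meas_\<phi>])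
  have \<phi>Y: "integrable M (\<lambda>w. \<phi> (Y R w))" for R
    by (rule M.integrable_const_bound[of _ B]) (use B(1) Y_Conf \<phi>Y_meas in auto)
  have \<phi>P: "integrable N (\<lambda>w. \<phi> (P w))"
    by (rule N.integrable_const_bound[of _ B]) (use B(1) P_Conf \<phi>P_meas in auto)
  \<comment> \<open>The gap between \<open>\<phi>\<close> and its envelope, switched off on crowded
    configurations. It is bounded by \<open>2 * B\<close> and tends to 0 pointwise, so its integral
    tends to 0 by dominated convergence.\<close>
  define h where "h L w = (\<phi> (P w) - ?g L (occupied L (P w))) * indicator (space N - {w\<in>space N. crowded L (P w)}) w" for L w
  have h_meas: "h L \<in> borel_measurable N" for L
    unfolding h_def using N.crowded_sets
    by (intro borel_measurable_times borel_measurable_diff \<phi>P_meas borel_measurable_integrable[OF N.integral_occupied(1)] borel_measurable_indicator sets.Diff) auto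
  have h_bound: "\<bar>h L w\<bar> \<le> 2 * B" if "w\<in>space N" for L w
    using B(1)[OF P_Conf[OF that]] lower_envelope_bounds[of L "occupied L (P w)"] B(2) by (auto simp: h_def indicator_def)
  have h_lim: "(\<lambda>L. h L w) \<longlonglongrightarrow> 0" if w: "w\<in>space N" for w
  proof (rule LIMSEQ_I)
    fix r :: real assume "0 < r"
    then have r2: "0 < r / 2" by simp
    obtain L0 where L0: "\<And>L. L0 \<le> L \<Longrightarrow> \<not> crowded L (P w) \<Longrightarrow> \<phi> (P w) - r / 2 \<le> ?g L (occupied L (P w))"
      using lower_envelope_ge[OF P_Conf[OF w] r2] by blast
    have "\<bar>h L w\<bar> < r" if "L0 \<le> L" for L
    proof (cases "crowded L (P w)")
      case True
      then show ?thesis using w \<open>0 < r\<close> by (simp add: h_def)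
    next
      case False
      then have "\<phi> (P w) - r / 2 \<le> ?g L (occupied L (P w))" "?g L (occupied L (P w)) \<le> \<phi> (P w)"
        using L0[OF that] lower_envelope_le[OF P_Conf[OF w]] by auto
      moreover have "h L w = \<phi> (P w) - ?g L (occupied L (P w))" using False w by (simp add: h_def)
      ultimately show ?thesis using \<open>0 < r\<close> by linarith
    qed
    then show "\<exists>L0. \<forall>L\<ge>L0. norm (h L w - 0) < r" by auto
  qed
  have "(\<lambda>L. \<integral>w. h L w \<partial>N) \<longlonglongrightarrow> (\<integral>w. 0 \<partial>N)"
  proof (rule integral_dominated_convergence)
    show "integrable N (\<lambda>_. 2 * B)" by simp
    show "AE w in N. norm (h L w) \<le> 2 * B" for L using h_bound by (intro AE_I2) simp
    show "AE w in N. (\<lambda>L. h L w) \<longlonglongrightarrow> 0" using h_lim by (intro AE_I2)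
  qed (use h_meas in auto)
  then have "(\<lambda>L. \<integral>w. h L w \<partial>N) \<longlonglongrightarrow> 0" by simp
  \<comment> \<open>The factor 4 collects a correction of \<open>2 * B\<close> on the crowded event
    for each of the two processes.\<close>
  from tendsto_add[OF this tendsto_mult_right_zero[OF \<beta>, of "4 * B"]]
  have "(\<lambda>L. (\<integral>w. h L w \<partial>N) + 4 * B * ?\<gamma> L) \<longlonglongrightarrow> 0" by simp
  then have "\<forall>\<^sub>F L in sequentially. (\<integral>w. h L w \<partial>N) + 4 * B * ?\<gamma> L < \<epsilon>" using \<epsilon> by (rule order_tendstoD(2))
  then obtain L where L: "(\<integral>w. h L w \<partial>N) + 4 * B * ?\<gamma> L < \<epsilon>"
    using eventually_happens trivial_limit_sequentially by blast
  have h_int: "integrable N (h L)"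
    by (rule N.integrable_const_bound[of _ "2 * B"]) (use h_bound h_meas in auto)
  have P_le: "(\<integral>w. \<phi> (P w) \<partial>N) \<le> (\<integral>w. ?g L (occupied L (P w)) \<partial>N) + (\<integral>w. h L w \<partial>N) + 2 * B * ?\<gamma> L"
  proof -
    have "(\<integral>w. \<phi> (P w) \<partial>N) \<le> (\<integral>w. ?g L (occupied L (P w)) + h L w + 2 * B * indicator {w\<in>space N. crowded L (P w)} w \<partial>N)"
    proof (rule integral_mono)
      fix w assume w: "w\<in>space N"
      show "\<phi> (P w) \<le> ?g L (occupied L (P w)) + h L w + 2 * B * indicator {w\<in>space N. crowded L (P w)} w"
        using B(1)[OF P_Conf[OF w]] lower_envelope_bounds[of L "occupied L (P w)"] w
        by (cases "crowded L (P w)") (auto simp: h_def)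
    qed (intro Bochner_Integration.integrable_add \<phi>P N.integral_occupied(1) h_int N.crowded_integrable)+
    also have "\<dots> = (\<integral>w. ?g L (occupied L (P w)) \<partial>N) + (\<integral>w. h L w \<partial>N) + (\<integral>w. 2 * B * indicator {w\<in>space N. crowded L (P w)} w \<partial>N)"
      by (simp only: Bochner_Integration.integral_add Bochner_Integration.integrable_add N.integral_occupied(1) h_int N.crowded_integrable)
    also have "(\<integral>w. 2 * B * indicator {w\<in>space N. crowded L (P w)} w \<partial>N) = 2 * B * \<P>(w in N. crowded L (P w))"
      by (simp add: Int_absorb2 subset_iff)
    also have "\<dots> \<le> 2 * B * ?\<gamma> L" using N.prob_crowded_le[OF P_multiple] B(2) by (intro mult_left_mono) auto
    finally show ?thesis by simp
  qed
  have Y_ge: "(\<integral>w. ?g L (occupied L (Y R w)) \<partial>M) - 2 * B * ?\<gamma> L \<le> (\<integral>w. \<phi> (Y R w) \<partial>M)"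
    if "\<P>(w in M. crowded L (Y R w)) \<le> ?\<gamma> L" for R
  proof -
    have "(\<integral>w. ?g L (occupied L (Y R w)) \<partial>M) \<le> (\<integral>w. \<phi> (Y R w) + 2 * B * indicator {w\<in>space M. crowded L (Y R w)} w \<partial>M)"
    proof (rule integral_mono)
      fix w assume w: "w\<in>space M"
      show "?g L (occupied L (Y R w)) \<le> \<phi> (Y R w) + 2 * B * indicator {w\<in>space M. crowded L (Y R w)} w"
        using B(1)[OF Y_Conf[OF w, of R]] lower_envelope_bounds[of L "occupied L (Y R w)"] lower_envelope_le[OF Y_Conf[OF w, of R], of L] w
        by (cases "crowded L (Y R w)") auto
    qed (intro Bochner_Integration.integrable_add \<phi>Y M.integral_occupied(1) M.crowded_integrable)+
    also have "\<dots> = (\<integral>w. \<phi> (Y R w) \<partial>M) + (\<integral>w. 2 * B * indicator {w\<in>space M. crowded L (Y R w)} w \<partial>M)"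
      by (rule Bochner_Integration.integral_add[OF \<phi>Y M.crowded_integrable])
    also have "(\<integral>w. 2 * B * indicator {w\<in>space M. crowded L (Y R w)} w \<partial>M) = 2 * B * \<P>(w in M. crowded L (Y R w))"
      by (simp add: Int_absorb2 subset_iff)
    also have "\<dots> \<le> 2 * B * ?\<gamma> L" using that B(2) by (intro mult_left_mono) auto
    finally show ?thesis by simp
  qed
  have "(\<integral>w. \<phi> (P w) \<partial>N) - \<epsilon> + 2 * B * ?\<gamma> L < (\<integral>w. ?g L (occupied L (P w)) \<partial>N)" using P_le L by linarith
  from order_tendstoD(1)[OF integral_occupied_tendsto this]
  have "\<forall>\<^sub>F R in F. (\<integral>w. \<phi> (P w) \<partial>N) - \<epsilon> + 2 * B * ?\<gamma> L < (\<integral>w. ?g L (occupied L (Y R w)) \<partial>M)" .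
  then show ?thesis using crowded_Y[of L] by eventually_elim (use Y_ge in fastforce)
qed

theorem converges_in_law: "converges_in_law (vague_topology UNIV) M Y F N P"
  unfolding converges_in_law_def
proof (intro conjI allI impI prob_M prob_N Y P)
  fix \<phi> :: "real measure \<Rightarrow> real"
  assume "continuous_map (vague_topology UNIV) euclideanreal \<phi> \<and> bounded (\<phi> ` topspace (vague_topology UNIV))"
  then have \<phi>: "continuous_map (vague_topology UNIV) euclideanreal \<phi>" "bounded (\<phi> ` Conf UNIV)" by auto
  have \<phi>': "continuous_map (vague_topology UNIV) euclideanreal (\<lambda>\<xi>. - \<phi> \<xi>)" by (intro continuous_map_minus \<phi>)
  have "(\<lambda>\<xi>. - \<phi> \<xi>) ` Conf UNIV = uminus ` (\<phi> ` Conf UNIV)" by (simp add: image_image)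
  then have bdd': "bounded ((\<lambda>\<xi>. - \<phi> \<xi>) ` Conf UNIV)" using \<phi>(2) by (simp add: bounded_uminus)
  show "((\<lambda>R. \<integral>w. \<phi> (Y R w) \<partial>M) \<longlongrightarrow> (\<integral>w. \<phi> (P w) \<partial>N)) F"
  proof (rule tendstoI)
    fix \<epsilon> :: real assume \<epsilon>: "0 < \<epsilon>"
    from integral_lower_bound[OF \<phi> \<epsilon>] integral_lower_bound[OF \<phi>' bdd' \<epsilon>]
    show "\<forall>\<^sub>F R in F. dist (\<integral>w. \<phi> (Y R w) \<partial>M) (\<integral>w. \<phi> (P w) \<partial>N) < \<epsilon>"
      by eventually_elim (simp add: dist_real_def abs_less_iff)
  qed
qed

end

section \<open>Rescaled hyperbolic configurations\<close>

definition hyp_rescale :: "real \<Rightarrow> complex \<Rightarrow> real" where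
  "hyp_rescale R z = exp R * (hyp_modulus z - R)"

abbreviation hyp_push :: "real \<Rightarrow> complex measure \<Rightarrow> real measure" where
  "hyp_push R \<equiv> push_configuration (hyp_rescale R) UNIV"

lemma hyp_shell_eq: "hyp_shell R U = hyp_rescale R -` U \<inter> unit_disc"
  by (auto simp: hyp_shell_def hyp_rescale_def)

lemma hyp_rescale_continuous: "continuous_on unit_disc (hyp_rescale R)"
proof -
  have "1 + cmod z \<noteq> 0" for z using norm_ge_zero[of z] by linarith
  then show ?thesis unfolding hyp_rescale_def hyp_modulus_def
    by (intro continuous_intros) auto
qed

lemma hyp_rescale_measurable:
  assumes "sets \<xi> = sets (restrict_space borel unit_disc)"
  shows "hyp_rescale R \<in> measurable \<xi> (restrict_space borel UNIV)"
proof -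
  have "hyp_rescale R \<in> borel_measurable borel" unfolding hyp_rescale_def by measurable
  then have "hyp_rescale R \<in> borel_measurable (restrict_space borel unit_disc)" by (rule measurable_restrict_space1)
  moreover have "sets (restrict_space borel UNIV) = sets (borel :: real measure)" by (simp add: sets_restrict_space)
  ultimately show ?thesis using measurable_cong_sets[OF assms] by blast
qed

lemma emeasure_hyp_push:
  assumes \<xi>: "sets \<xi> = sets (restrict_space borel unit_disc)" and B: "B \<in> sets borel"
  shows "emeasure (hyp_push R \<xi>) B = emeasure \<xi> (hyp_shell R B)"
proof -
  have "space \<xi> = unit_disc" using sets_eq_imp_space_eq[OF \<xi>] by (simp add: space_restrict_space)
  moreover have "B \<in> sets (restrict_space borel UNIV)" using B by (simp add: sets_restrict_space)
  ultimately show ?thesis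
    unfolding push_configuration_def hyp_shell_eq by (simp add: emeasure_distr[OF hyp_rescale_measurable[OF \<xi>]])
qed

lemma measure_hyp_push:
  assumes "\<xi> \<in> Conf unit_disc" "B \<in> sets borel"
  shows "measure (hyp_push R \<xi>) B = measure \<xi> (hyp_shell R B)"
  using emeasure_hyp_push[OF sets_Conf[OF assms(1)] assms(2)] by (simp add: measure_def)

lemma precompact_Borel_compact:
  "B \<in> precompact_Borel X \<Longrightarrow> \<exists>C. compact C \<and> B \<subseteq> C \<and> C \<subseteq> X"
  by (simp add: precompact_Borel_def)

text \<open>Local finiteness is inherited because a bounded set of the line pulls back to a shell
  that is precompact in the disc.\<close>

lemma hyp_push_Conf:
  assumes \<xi>: "\<xi> \<in> Conf unit_disc"
  shows "hyp_push R \<xi> \<in> Conf UNIV"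
proof -
  obtain I :: "nat set" and x where x: "x \<in> I \<rightarrow> unit_disc"
    and eq: "\<xi> = distr (count_space I) (restrict_space borel unit_disc) x"
    and fin: "\<And>B. B \<in> precompact_Borel unit_disc \<Longrightarrow> emeasure \<xi> B < \<infinity>"
    using \<xi> unfolding Conf_def by auto
  have x_meas: "x \<in> measurable (count_space I) (restrict_space borel unit_disc)"
    using x by (auto simp: space_restrict_space)
  have "hyp_push R \<xi> = distr (count_space I) (restrict_space borel UNIV) (hyp_rescale R \<circ> x)"
    unfolding push_configuration_def eq by (rule distr_distr[OF hyp_rescale_measurable[OF refl] x_meas])
  moreover have "hyp_rescale R \<circ> x \<in> I \<rightarrow> UNIV" by simp
  moreover have "emeasure (hyp_push R \<xi>) B < \<infinity>" if pre: "B \<in> precompact_Borel UNIV" for B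
  proof -
    obtain C where C: "compact C" "B \<subseteq> C" using precompact_Borel_compact[OF pre] by blast
    have B: "B \<in> sets borel" using precompact_BorelD(1)[OF pre] by (simp add: sets_restrict_space)
    obtain b where b: "\<And>x. x \<in> C \<Longrightarrow> \<bar>x\<bar> \<le> b" using compact_imp_bounded[OF C(1)] by (auto simp: bounded_real)
    \<comment> \<open>Raising the upper end beyond \<open>b\<close> fits the closed bound into a
      half-open interval.\<close>
    have "B \<subseteq> {- b..<b + 1}"
    proof
      fix y assume "y \<in> B"
      then have "\<bar>y\<bar> \<le> b" using b C(2) by blast
      then show "y \<in> {- b..<b + 1}" unfolding atLeastLessThan_iff by linarith
    qed
    then show ?thesis
      using fin[OF hyp_shell_precompact[OF B]] emeasure_hyp_push[OF sets_Conf[OF \<xi>] B] by simp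
  qed
  ultimately show ?thesis unfolding Conf_def by blast
qed

text \<open>Points near the unit circle have large rescaled coordinate, beyond the support of
  \<open>f\<close>; so the composition is supported in a closed ball inside the disc.\<close>

lemma Cc_hyp_rescale:
  assumes f: "f \<in> Cc UNIV"
  shows "(\<lambda>z. f (hyp_rescale R z)) \<in> Cc unit_disc"
proof -
  obtain C where cont: "continuous_on UNIV f" and C: "compact C" "\<And>x. x \<notin> C \<Longrightarrow> f x = 0"
    using f by (auto simp: Cc_def)
  obtain b where b: "\<And>x. x \<in> C \<Longrightarrow> \<bar>x\<bar> \<le> b" using compact_imp_bounded[OF C(1)] by (auto simp: bounded_real)
  let ?D = "cball 0 (shell_radius R (b + 1)) :: complex set"
  have "continuous_on unit_disc (\<lambda>z. f (hyp_rescale R z))"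
    by (rule continuous_on_compose2[OF cont hyp_rescale_continuous]) simp
  moreover have "?D \<subseteq> unit_disc" using hyp_radius_less_1[of "R + (b + 1) * exp (- R)"] by auto
  moreover have "f (hyp_rescale R z) = 0" if z: "z \<in> unit_disc - ?D" for z
  proof (rule C(2), rule notI)
    assume "hyp_rescale R z \<in> C"
    then have "hyp_rescale R z \<in> {- b..<b + 1}" using b[of "hyp_rescale R z"] by (auto simp: abs_le_iff)
    then have "z \<in> hyp_shell R {- b..<b + 1}" using z by (simp add: hyp_shell_eq)
    then show False using z unfolding hyp_shell_interval hyp_annulus_def by simp
  qed
  ultimately show ?thesis unfolding Cc_def using compact_cball by blast
qed

text \<open>By change of variables the preimage of a basic open set is the basic open set of the
  composed test function. The rescaled processes inherit their measurability from this.\<close>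

lemma hyp_push_continuous: "continuous_map (vague_topology unit_disc) (vague_topology UNIV) (hyp_push R)"
  unfolding vague_topology_def[of UNIV]
proof (rule continuous_on_generated_topo)
  fix W assume "W \<in> {{\<xi> \<in> Conf UNIV. (\<integral>x. f x \<partial>\<xi>) \<in> U} | f U. f \<in> Cc (UNIV::real set) \<and> open U}"
  then obtain f U where W: "W = {\<xi> \<in> Conf UNIV. (\<integral>x. f x \<partial>\<xi>) \<in> U}" and f: "f \<in> Cc UNIV" and U: "open U" by blast
  have f_meas: "f \<in> borel_measurable (restrict_space borel UNIV)"
    using f by (intro measurable_restrict_space1 borel_measurable_continuous_onI) (simp add: Cc_def)
  have int: "(\<integral>x. f x \<partial>hyp_push R \<xi>) = (\<integral>z. f (hyp_rescale R z) \<partial>\<xi>)" if "\<xi> \<in> Conf unit_disc" for \<xi>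
    unfolding push_configuration_def by (rule integral_distr[OF hyp_rescale_measurable[OF sets_Conf[OF that]] f_meas])
  have "hyp_push R -` W \<inter> topspace (vague_topology unit_disc) = {\<xi> \<in> Conf unit_disc. (\<integral>z. f (hyp_rescale R z) \<partial>\<xi>) \<in> U}"
    using hyp_push_Conf int by (auto simp: W)
  moreover have "openin (vague_topology unit_disc) \<dots>"
    unfolding vague_topology_def using Cc_hyp_rescale[OF f, of R] U by (intro topology_generated_by_Basis) blast
  ultimately show "openin (vague_topology unit_disc) (hyp_push R -` W \<inter> topspace (vague_topology unit_disc))" by simp
next
  have "\<Union> {{\<xi> \<in> Conf UNIV. (\<integral>x. f x \<partial>\<xi>) \<in> U} | f U. f \<in> Cc (UNIV::real set) \<and> open U} = Conf UNIV"
    using topspace_vague_topology[of "UNIV::real set"] unfolding vague_topology_def topology_generated_by_topspace .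
  then show "hyp_push R ` topspace (vague_topology unit_disc)
      \<subseteq> \<Union> {{\<xi> \<in> Conf UNIV. (\<integral>x. f x \<partial>\<xi>) \<in> U} | f U. f \<in> Cc (UNIV::real set) \<and> open U}"
    using hyp_push_Conf by (simp only: topspace_vague_topology) blast
qed

section \<open>Comparison of the rescaled ensemble with the Poisson process\<close>

lemma UN_dcell_measure_zero_iff:
  assumes "\<xi> \<in> Conf UNIV" "V \<subseteq> dcells L"
  shows "measure \<xi> (\<Union>j\<in>V. dcell L j) = 0 \<longleftrightarrow> (\<forall>j\<in>V. measure \<xi> (dcell L j) = 0)"
proof -
  have fin: "finite V" by (rule finite_subset[OF assms(2) finite_dcells])
  have "measure \<xi> (\<Union>j\<in>V. dcell L j) = (\<Sum>j\<in>V. measure \<xi> (dcell L j))"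
    by (rule measure_Conf_UN[OF assms(1) dcell_precompact fin disjoint_dcells])
  then show ?thesis using fin by (simp add: sum_nonneg_eq_0_iff)
qed

lemma UN_dcell_subset:
  assumes "V \<subseteq> dcells L"
  shows "(\<Union>j\<in>V. dcell L j) \<subseteq> {- real L..<real L}"
proof -
  have "(\<Union>j\<in>V. dcell L j) \<subseteq> (\<Union>j\<in>dcells L. dcell L j)" using assms by blast
  then show ?thesis using UN_dcell[where m=L and L=L] unfolding dcells_def by simp
qed

abbreviation total_length :: "nat \<Rightarrow> int set \<Rightarrow> real" where
  "total_length L V \<equiv> \<Sum>j\<in>V. of_int (j + 1) / 2 ^ L - of_int j / 2 ^ L"

lemma dcell_length: "of_int (j + 1) / 2 ^ L - of_int j / 2 ^ L = 1 / (2 ^ L :: real)"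
  by (simp add: diff_divide_distrib[symmetric])

lemma measure_intensity_UN_dcell:
  assumes \<alpha>: "0 < \<alpha>" and V: "finite V"
  shows "measure (density lborel (\<lambda>_. ennreal (\<alpha> / 4))) (\<Union>j\<in>V. dcell L j) = \<alpha> / 4 * total_length L V"
proof -
  have dc: "measure lborel (dcell L j) = of_int (j + 1) / 2 ^ L - of_int j / 2 ^ L" for j
    unfolding dcell_eq by (subst measure_lborel_Ico) (auto simp: divide_right_mono)
  have fm: "emeasure lborel (dcell L j) \<noteq> \<infinity>" for j
    unfolding dcell_eq by (subst emeasure_lborel_Ico) (auto simp: divide_right_mono)
  have sum: "measure lborel (\<Union>j\<in>V. dcell L j) = (\<Sum>j\<in>V. measure lborel (dcell L j))"
    by (rule measure_finite_Union[OF V _ disjoint_dcells fm]) auto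
  have scale: "measure (density lborel (\<lambda>_. ennreal (\<alpha> / 4))) A = \<alpha> / 4 * measure lborel A" if "A \<in> sets borel" for A
    using that \<alpha> by (simp add: measure_def emeasure_density nn_integral_cmult_indicator enn2real_mult)
  have "(\<Union>j\<in>V. dcell L j) \<in> sets borel" using V by (intro sets.finite_UN) auto
  from scale[OF this] show ?thesis unfolding sum dc .
qed

text \<open>The left side is the probability that a Poisson variable of mean \<open>x\<close> is at
  least 2; the bound comes from exp(- x) \<ge> 1 - x.\<close>

lemma one_minus_exp_le: "0 \<le> x \<Longrightarrow> 1 - exp (- x) - exp (- x) * x \<le> (x::real)\<^sup>2"
proof -
  assume x: "0 \<le> x"
  have "(1 - x) * (1 + x) \<le> exp (- x) * (1 + x)" using x exp_ge_add_one_self[of "- x"] by (intro mult_right_mono) auto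
  then show ?thesis by (simp add: power2_eq_square algebra_simps)
qed

theorem theorem1p5:
  fixes \<alpha> :: real
    and M :: "'p measure" and H :: "'p \<Rightarrow> complex measure"
    and N :: "'q measure" and P :: "'q \<Rightarrow> real measure"
  assumes "\<alpha> > 0"
    and "hyperbolic_ensemble M \<alpha> H"
    and "poisson_process N UNIV (density lborel (\<lambda>_. ennreal (\<alpha> / 4))) P"
  shows "converges_in_law (vague_topology UNIV) M
           (\<lambda>R \<omega>. push_configuration (\<lambda>z. exp R * (hyp_modulus z - R)) UNIV (H \<omega>)) at_top
           N P"
proof -
  let ?\<nu> = "density lborel (\<lambda>_. ennreal (\<alpha> / 4)) :: real measure"
  \<comment> \<open>The Poisson mean of the count in one cell of depth \<open>L\<close>.\<close>
  define x where "x L = \<alpha> / 4 * (1 / 2 ^ L)" for L :: nat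
  have x0: "0 < x L" for L using assms(1) by (simp add: x_def)
  have det: "determinantal_process M unit_disc (mu_hyp \<alpha>) (K_hyp \<alpha>) H"
    using assms(2) by (simp add: hyperbolic_ensemble_def)
  then have ppH: "point_process M unit_disc H" by (simp add: determinantal_process_def simple_point_process_def)
  have ppP: "point_process N UNIV P" using assms(3) by (simp add: poisson_process_def)
  have poisson: "measure N {w \<in> space N. measure (P w) B = real n} = exp (- measure ?\<nu> B) * measure ?\<nu> B ^ n / fact n"
    if "B \<in> precompact_Borel UNIV" for B n
    using assms(3) that unfolding poisson_process_def by blast
  have probN: "prob_space N" using ppP by (simp add: point_process_def)
  have HC: "H w \<in> Conf unit_disc" if "w \<in> space M" for w using point_process_Conf[OF ppH that] .
  have PC: "P w \<in> Conf UNIV" if "w \<in> space N" for w using point_process_Conf[OF ppP that] .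
  have shells: "hyperbolic_shells M \<alpha> H (\<Union>j\<in>V. dcell L j) (real L) (\<alpha> / 4 * total_length L V)"
    if V: "V \<subseteq> dcells L" for V L
  proof
    have fin: "finite V" by (rule finite_subset[OF V finite_dcells])
    show "(\<Union>j\<in>V. dcell L j) \<in> sets borel" using fin by (intro sets.finite_UN) auto
    show "(\<Union>j\<in>V. dcell L j) \<subseteq> {- real L..<real L}" by (rule UN_dcell_subset[OF V])
    show "((\<lambda>R. shell_mass \<alpha> R (\<Union>j\<in>V. dcell L j)) \<longlongrightarrow> \<alpha> / 4 * total_length L V) at_top"
      unfolding dcell_eq
    proof (rule shell_mass_UN_tendsto[OF assms(1) fin])
      show "disjoint_family_on (\<lambda>j. {of_int j / 2 ^ L..<of_int (j + 1) / 2 ^ L} :: real set) V"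
        using disjoint_dcells[of L V] unfolding disjoint_family_on_def dcell_eq .
    qed (simp add: divide_right_mono)
  qed (use assms in auto)
  have P_count: "(\<lambda>w. measure (P w) (dcell L j)) \<in> borel_measurable N" for L j
  proof -
    \<comment> \<open>Independence of a family with a single member contains the measurability of
      that count.\<close>
    have "prob_space.indep_vars N (\<lambda>_. borel) (\<lambda>i w. measure (P w) ((\<lambda>_. dcell L j) i)) {..<Suc 0}"
      using assms(3) unfolding poisson_process_def
      by (elim conjE allE[of _ "Suc 0"] allE[of _ "\<lambda>_. dcell L j"] mp) (simp add: disjoint_family_on_def)
    then show ?thesis by (simp add: prob_space.indep_vars_def[OF probN])
  qed
  have H_count: "(\<lambda>w. measure (H w) (hyp_shell R (dcell L j))) \<in> borel_measurable M" for R L j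
  proof -
    have "hyp_shell R (dcell L j) \<in> precompact_Borel unit_disc"
      by (rule hyp_shell_precompact[OF dcell_borel]) (unfold dcell_eq, rule order_refl)
    then have "integrable M (\<lambda>w. \<Prod>i<Suc 0. measure (H w) ((\<lambda>_. hyp_shell R (dcell L j)) i))"
      using determinantal_processD[OF det, of "Suc 0" "\<lambda>_. hyp_shell R (dcell L j)"]
      by (simp add: disjoint_family_on_def)
    then show ?thesis by simp
  qed
  have convergent: "convergent_avoidance M (\<lambda>R w. hyp_push R (H w)) at_top N P (\<lambda>L. (x L)\<^sup>2)"
  proof (rule convergent_avoidance.intro)
    have probM: "prob_space M" using ppH by (simp add: point_process_def)
    have "(\<lambda>w. measure (hyp_push R (H w)) (dcell L j)) \<in> borel_measurable M" for R L j
      using H_count by (subst measurable_cong[OF measure_hyp_push[OF HC dcell_borel]])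
    then show "dyadic_counts M (\<lambda>w. hyp_push R (H w))" for R
      using probM by (simp add: dyadic_counts_def dyadic_counts_axioms_def)
    show "dyadic_counts N P" using probN P_count by (simp add: dyadic_counts_def dyadic_counts_axioms_def)
    show "(\<lambda>w. hyp_push R (H w)) \<in> measurable M (borel_of_topology (vague_topology UNIV))" for R
      using ppH by (intro measurable_compose[OF _ continuous_map_measurable[OF hyp_push_continuous]]) (simp add: point_process_def)
    show "P \<in> measurable N (borel_of_topology (vague_topology UNIV))" using ppP by (simp add: point_process_def)
    show "((\<lambda>R. measure M {w\<in>space M. \<forall>j\<in>V. measure (hyp_push R (H w)) (dcell L j) = 0})
        \<longlongrightarrow> measure N {w\<in>space N. \<forall>j\<in>V. measure (P w) (dcell L j) = 0}) at_top"
      if V: "V \<subseteq> dcells L" for V L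
    proof -
      interpret S: hyperbolic_shells M \<alpha> H "\<Union>j\<in>V. dcell L j" "real L" "\<alpha> / 4 * total_length L V"
        by (rule shells[OF V])
      have fin: "finite V" by (rule finite_subset[OF V finite_dcells])
      \<comment> \<open>Avoiding several cells means avoiding their union, so statements about one
        set suffice: the avoidance limit for shells on one side and the Poisson law at
        \<open>n = 0\<close> on the other.\<close>
      have "{w\<in>space M. \<forall>j\<in>V. measure (hyp_push R (H w)) (dcell L j) = 0} = {w\<in>space M. measure (H w) (hyp_shell R (\<Union>j\<in>V. dcell L j)) = 0}" for R
        using UN_dcell_measure_zero_iff[OF hyp_push_Conf[OF HC] V] measure_hyp_push[OF HC S.U(1)] by auto
      moreover have "{w\<in>space N. \<forall>j\<in>V. measure (P w) (dcell L j) = 0} = {w\<in>space N. measure (P w) (\<Union>j\<in>V. dcell L j) = real 0}"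
        using UN_dcell_measure_zero_iff[OF PC V] by auto
      moreover have "(\<Union>j\<in>V. dcell L j) \<in> precompact_Borel UNIV" by (rule bounded_precompact_Borel[OF S.U])
      ultimately show ?thesis
        using S.avoidance_tendsto poisson[of "\<Union>j\<in>V. dcell L j" 0] measure_intensity_UN_dcell[OF assms(1) fin, of L] by simp
    qed
    show "\<forall>\<^sub>F R in at_top. measure M {w\<in>space M. 2 \<le> measure (hyp_push R (H w)) (dcell L j)} \<le> (x L)\<^sup>2" for L j
    proof -
      \<comment> \<open>Here \<open>j\<close> is an arbitrary integer, so the window is fitted to
        the cell instead of using the one from \<open>- L\<close> to \<open>L\<close>.\<close>
      let ?L = "max (\<bar>of_int j / 2 ^ L\<bar>) (\<bar>of_int (j + 1) / 2 ^ L\<bar>) :: real"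
      have mass: "((\<lambda>R. shell_mass \<alpha> R (dcell L j)) \<longlongrightarrow> x L) at_top"
        using shell_mass_interval_tendsto[OF assms(1), of "of_int j / 2 ^ L" "of_int (j + 1) / 2 ^ L"]
        unfolding dcell_length x_def dcell_eq by (simp add: divide_right_mono)
      interpret S: hyperbolic_shells M \<alpha> H "dcell L j" ?L "x L"
      proof
        have "{a..<b} \<subseteq> {- max \<bar>a\<bar> \<bar>b\<bar>..<max \<bar>a\<bar> \<bar>b\<bar>}" for a b :: real
        proof
          fix y assume "y \<in> {a..<b}"
          then have "a \<le> y" "y < b" by auto
          then show "y \<in> {- max \<bar>a\<bar> \<bar>b\<bar>..<max \<bar>a\<bar> \<bar>b\<bar>}"
            using max.cobounded1[of "\<bar>a\<bar>" "\<bar>b\<bar>"] max.cobounded2[of "\<bar>b\<bar>" "\<bar>a\<bar>"]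
            unfolding atLeastLessThan_iff by linarith
        qed
        then show "dcell L j \<subseteq> {- ?L..<?L}" unfolding dcell_eq by blast
        show "0 \<le> ?L" by (rule order_trans[OF abs_ge_zero max.cobounded1])
      qed (use assms mass in auto)
      have "{w\<in>space M. 2 \<le> measure (hyp_push R (H w)) (dcell L j)} = {w\<in>space M. 2 \<le> measure (H w) (hyp_shell R (dcell L j))}" for R
        using measure_hyp_push[OF HC dcell_borel] by auto
      \<comment> \<open>The second binomial moment tends to half the square of the mean, so the full
        square is a strict upper bound in the limit.\<close>
      moreover have "(x L)\<^sup>2 / 2 < (x L)\<^sup>2" using x0[of L] by simp
      from S.multiple_bound[OF this] have "\<forall>\<^sub>F R in at_top. measure M {w\<in>space M. 2 \<le> measure (H w) (hyp_shell R (dcell L j))} \<le> (x L)\<^sup>2"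
        by (rule eventually_mono) simp
      ultimately show ?thesis by simp
    qed
    show "measure N {w\<in>space N. 2 \<le> measure (P w) (dcell L j)} \<le> (x L)\<^sup>2" for L j
    proof -
      interpret N: prob_space N by (rule probN)
      note [measurable] = P_count
      have \<nu>: "measure ?\<nu> (dcell L j) = x L"
        using measure_intensity_UN_dcell[OF assms(1), of "{j}" L] unfolding dcell_length x_def by simp
      let ?E = "\<lambda>n. {w\<in>space N. measure (P w) (dcell L j) = real n}"
      have E: "?E n \<in> sets N" for n by measurable
      \<comment> \<open>The Poisson law is prescribed value by value; since counts are integers, the
        tail is the complement of the values 0 and 1.\<close>
      have "{w\<in>space N. 2 \<le> measure (P w) (dcell L j)} = space N - (?E 0 \<union> ?E 1)"
      proof -
        have "2 \<le> measure (P w) (dcell L j) \<longleftrightarrow> \<not> (measure (P w) (dcell L j) = real 0 \<or> measure (P w) (dcell L j) = real 1)"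
          if w: "w \<in> space N" for w
        proof -
          obtain n :: nat where n: "measure (P w) (dcell L j) = real n" using Conf_count[OF PC[OF w] dcell_precompact] by metis
          show ?thesis unfolding n by auto
        qed
        then show ?thesis by blast
      qed
      moreover have "measure N (?E 0 \<union> ?E 1) = measure N (?E 0) + measure N (?E 1)"
        by (rule N.finite_measure_Union[OF E E]) auto
      ultimately have "measure N {w\<in>space N. 2 \<le> measure (P w) (dcell L j)} = 1 - (measure N (?E 0) + measure N (?E 1))"
        using N.prob_compl[OF sets.Un[OF E[of 0] E[of 1]]] by simp
      also have "\<dots> = 1 - exp (- x L) - exp (- x L) * x L"
        using poisson[OF dcell_precompact, of L j 0] poisson[OF dcell_precompact, of L j 1] unfolding \<nu> by simp
      also have "\<dots> \<le> (x L)\<^sup>2" by (rule one_minus_exp_le[OF less_imp_le[OF x0]])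
      finally show ?thesis .
    qed
    have "(\<lambda>L. real L * (1 / 2) ^ L) \<longlonglongrightarrow> 0" by (rule powser_times_n_limit_0) simp
    from tendsto_mult_right_zero[OF this, of "2 * (\<alpha> / 4)\<^sup>2"]
    have "(\<lambda>L. 2 * (\<alpha> / 4)\<^sup>2 * (real L * (1 / 2) ^ L)) \<longlonglongrightarrow> 0" .
    \<comment> \<open>There are 2 L 2^L cells, each doubly occupied with probability at most
      (\<alpha> / 4)^2 4^(-L), so one factor 2^(-L) survives and beats the growth of the
      window.\<close>
    moreover have "real (card (dcells L)) * (x L)\<^sup>2 = 2 * (\<alpha> / 4)\<^sup>2 * (real L * (1 / 2) ^ L)" for L
      unfolding card_dcells x_def by (simp add: power2_eq_square power_one_over field_simps)
    ultimately show "(\<lambda>L. real (card (dcells L)) * (x L)\<^sup>2) \<longlonglongrightarrow> 0" by simp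
  qed
  show ?thesis
    using convergent_avoidance.converges_in_law[OF convergent] unfolding hyp_rescale_def .
qed

end
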